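(* Consider a sequence of linear models $y = X\beta + z$ satisfying the working assumption stated in the context, and suppose in addition that $\sigma/M\to 0$. Then, for each of the three procedures forward stepwise regression, the lasso, and least angle regression, the rank $T$ of the first noise variable selected by the procedure satisfies $$\log T = (1+o_{\mathbb P}(1))\left[\sqrt{\frac{2n\log p}{k}} - \frac{n}{2k} + \log\frac{n}{2p\log p}\right].$$
   Context: Asymptotics. We consider a sequence of problems indexed by $(k_l,n_l,p_l)$ with $k_l,n_l,p_l\to\infty$ as $l\to\infty$; the index $l$ is suppressed. All limits are as $l\to\infty$. $o_{\mathbb P}(1)$ denotes a sequence of random variables converging to zero in probability. Constants do not depend on $l$. Working assumption. $y=X\beta+z$, where $X\in\mathbb R^{n\times p}$ has independent $\mathcal N(0,1/n)$ entries, $z\in\mathbb R^n$ has independent $\mathcal N(0,\sigma^2)$ entries ($\sigma=0$ allowed), and $X$ and $z$ are independent. The (nonrandom) vector $\beta\in\mathbb R^p$ has $k$ fixed components equal to some $M\neq 0$ and the rest are zero. The nonrandom parameters $\sigma\ge 0$ and $M$ may vary with $l$. Moreover $c_1 p/\log^{c_2}p\le n\le c_3p$ and $c_4 n\le k\le\min\{0.99p,\; c_5 n\log^{0.99}p\}$ for arbitrary positive constants $c_1,\dots,c_5$. Signal and noise variables. Variable $j$ (column $X_j$) is a signal variable if $\beta_j\ne0$ and a noise (spurious) variable if $\beta_j=0$. Procedures (no intercept, no normalization of columns). - Forward stepwise: start from the empty set; at each step add the variable that, together with the variables already selected, gives the smallest least-squares residual sum of squares for $y$. - Lasso: the path of minimizers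 of $\frac12\|y-Xb\|_2^2+\lambda\|b\|_1$ over $b\in\mathbb R^p$ as $\lambda$ decreases from $\infty$ to $0$; a variable is selected when its coefficient first becomes nonzero along the path. - Least angle regression: start with zero coefficients and with the variable having the largest absolute inner product with $y$; move the coefficients of the included variables in their joint least-squares direction (for the current residual) until an unselected variable has as large an absolute inner product with the current residual; that variable is included in the next step; continue until the residual is zero or all variables are included. (Removing a variable from the active set whenever its coefficient hits zero yields the lasso path.) Rank. For a given procedure, $T$ is the rank of the first noise variable: one plus the number of signal variables selected before the first noise variable. *)

theory Defs
  imports "HOL-Probability.Probability"
begin

text \<open>
  Dimensions vary along the sequence of problems, so vectors are functions
  \<^typ>\<open>nat \<Rightarrow> real\<close> and matrices functions \<^typ>\<open>nat \<Rightarrow> nat \<Rightarrow> real\<close> (row, then column),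
  of which only the entries with row index \<open>i < n\<close> and column index \<open>j < p\<close> are read.
\<close>

definition sq_norm :: "nat \<Rightarrow> (nat \<Rightarrow> real) \<Rightarrow> real" where
  "sq_norm n v = (\<Sum>i<n. (v i)\<^sup>2)"

definition residual :: "nat \<Rightarrow> (nat \<Rightarrow> nat \<Rightarrow> real) \<Rightarrow> (nat \<Rightarrow> real) \<Rightarrow> (nat \<Rightarrow> real) \<Rightarrow> nat \<Rightarrow> real" where
  "residual p X y b i = y i - (\<Sum>j<p. X i j * b j)"

definition col_inner :: "nat \<Rightarrow> (nat \<Rightarrow> nat \<Rightarrow> real) \<Rightarrow> nat \<Rightarrow> (nat \<Rightarrow> real) \<Rightarrow> real" where
  "col_inner n X j v = (\<Sum>i<n. X i j * v i)"

subsection \<open>Rank of the first noise variable\<close>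

text \<open>
  \<open>\<S>\<close> is the nested family of the sets of variables selected in the course of a procedure.
  A signal variable is selected before the first noise variable iff it belongs to a member
  of \<open>\<S>\<close> containing signal variables only. If no noise variable is ever selected, this
  counts all the selected variables.
\<close>

definition first_noise_rank :: "nat set \<Rightarrow> nat set set \<Rightarrow> nat" where
  "first_noise_rank signal \<S> = 1 + card (\<Union>{S \<in> \<S>. S \<subseteq> signal})"

subsection \<open>Forward stepwise regression\<close>

definition rss :: "nat \<Rightarrow> (nat \<Rightarrow> nat \<Rightarrow> real) \<Rightarrow> (nat \<Rightarrow> real) \<Rightarrow> nat set \<Rightarrow> real" where
  "rss n X y S = (INF b. sq_norm n (\<lambda>i. y i - (\<Sum>j\<in>S. X i j * b j)))"

text \<open>Ties, here and in the other two procedures, are resolved by an arbitrary choice.\<close>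

primrec fs_selected :: "nat \<Rightarrow> nat \<Rightarrow> (nat \<Rightarrow> nat \<Rightarrow> real) \<Rightarrow> (nat \<Rightarrow> real) \<Rightarrow> nat \<Rightarrow> nat set" where
  "fs_selected n p X y 0 = {}"
| "fs_selected n p X y (Suc m) =
     (let S = fs_selected n p X y m
      in insert (arg_min_on (\<lambda>j. rss n X y (insert j S)) ({..<p} - S)) S)"

definition forward_stepwise_rank ::
  "nat \<Rightarrow> nat \<Rightarrow> (nat \<Rightarrow> nat \<Rightarrow> real) \<Rightarrow> (nat \<Rightarrow> real) \<Rightarrow> nat set \<Rightarrow> nat" where
  "forward_stepwise_rank n p X y signal = first_noise_rank signal (fs_selected n p X y ` {..p})"

subsection \<open>Lasso\<close>

definition lasso_objective ::
  "nat \<Rightarrow> nat \<Rightarrow> (nat \<Rightarrow> nat \<Rightarrow> real) \<Rightarrow> (nat \<Rightarrow> real) \<Rightarrow> real \<Rightarrow> (nat \<Rightarrow> real) \<Rightarrow> real" where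
  "lasso_objective n p X y lam b = sq_norm n (residual p X y b) / 2 + lam * (\<Sum>j<p. \<bar>b j\<bar>)"

definition lasso_path ::
  "nat \<Rightarrow> nat \<Rightarrow> (nat \<Rightarrow> nat \<Rightarrow> real) \<Rightarrow> (nat \<Rightarrow> real) \<Rightarrow> real \<Rightarrow> nat \<Rightarrow> real" where
  "lasso_path n p X y lam = arg_min (lasso_objective n p X y lam) (\<lambda>b. \<forall>j\<ge>p. b j = 0)"

definition lasso_selected ::
  "nat \<Rightarrow> nat \<Rightarrow> (nat \<Rightarrow> nat \<Rightarrow> real) \<Rightarrow> (nat \<Rightarrow> real) \<Rightarrow> real \<Rightarrow> nat set" where
  "lasso_selected n p X y lam = {j. j < p \<and> (\<exists>lam'\<ge>lam. lasso_path n p X y lam' j \<noteq> 0)}"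

definition lasso_rank ::
  "nat \<Rightarrow> nat \<Rightarrow> (nat \<Rightarrow> nat \<Rightarrow> real) \<Rightarrow> (nat \<Rightarrow> real) \<Rightarrow> nat set \<Rightarrow> nat" where
  "lasso_rank n p X y signal = first_noise_rank signal (lasso_selected n p X y ` {0<..})"

subsection \<open>Least angle regression\<close>

text \<open>
  A state consists of the set \<open>A\<close> of included variables and the coefficients \<open>b\<close> at the
  moment when the last of them was included. The coefficients move along \<open>b + t d\<close>, where
  \<open>d\<close> is the least-squares fit of the current residual on the columns in \<open>A\<close>; the inner
  products of these columns with the residual keep equal absolute values until all of them
  vanish at \<open>t = 1\<close>. The step ends at the first \<open>t\<close> at which the absolute inner product of
  an unselected variable is as large as these, or at \<open>t = 1\<close> if there is none.
  Once the residual is zero or all variables are included, \<open>A\<close> no longer changes.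
\<close>

definition ls_direction ::
  "nat \<Rightarrow> nat \<Rightarrow> (nat \<Rightarrow> nat \<Rightarrow> real) \<Rightarrow> (nat \<Rightarrow> real) \<Rightarrow> nat set \<Rightarrow> nat \<Rightarrow> real" where
  "ls_direction n p X r A = arg_min (\<lambda>d. sq_norm n (residual p X r d)) (\<lambda>d. \<forall>j. j \<notin> A \<longrightarrow> d j = 0)"

definition lar_step ::
  "nat \<Rightarrow> nat \<Rightarrow> (nat \<Rightarrow> nat \<Rightarrow> real) \<Rightarrow> (nat \<Rightarrow> real) \<Rightarrow>
   nat set \<times> (nat \<Rightarrow> real) \<Rightarrow> nat set \<times> (nat \<Rightarrow> real)" where
  "lar_step n p X y = (\<lambda>(A, b).
     let d = ls_direction n p X (residual p X y b) A;
         move = (\<lambda>t j. b j + t * d j);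
         corr = (\<lambda>t j. \<bar>col_inner n X j (residual p X y (move t))\<bar>);
         t = Inf {t \<in> {0..1}. t = 1 \<or> (\<exists>j \<in> {..<p} - A. \<forall>i\<in>A. corr t i \<le> corr t j)}
     in if A = {..<p} \<or> (\<forall>i<n. residual p X y (move t) i = 0)
        then (A, move t)
        else (insert (arg_max_on (corr t) ({..<p} - A)) A, move t))"

definition lar_state ::
  "nat \<Rightarrow> nat \<Rightarrow> (nat \<Rightarrow> nat \<Rightarrow> real) \<Rightarrow> (nat \<Rightarrow> real) \<Rightarrow> nat \<Rightarrow> nat set \<times> (nat \<Rightarrow> real)" where
  "lar_state n p X y m =
     (lar_step n p X y ^^ m) ({arg_max_on (\<lambda>j. \<bar>col_inner n X j y\<bar>) {..<p}}, \<lambda>_. 0)"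

definition lar_rank ::
  "nat \<Rightarrow> nat \<Rightarrow> (nat \<Rightarrow> nat \<Rightarrow> real) \<Rightarrow> (nat \<Rightarrow> real) \<Rightarrow> nat set \<Rightarrow> nat" where
  "lar_rank n p X y signal = first_noise_rank signal (range (\<lambda>m. fst (lar_state n p X y m)))"

subsection \<open>Probability\<close>

text \<open>The law \<open>N(0, s\<^sup>2)\<close>, including the degenerate case \<open>s = 0\<close>.\<close>

definition normal_rv :: "'a measure \<Rightarrow> ('a \<Rightarrow> real) \<Rightarrow> real \<Rightarrow> bool" where
  "normal_rv P Z s \<longleftrightarrow>
     (if s = 0 then Z \<in> borel_measurable P \<and> (AE \<omega> in P. Z \<omega> = 0)
      else distributed P lborel Z (normal_density 0 s))"

text \<open>
  Convergence to zero in probability, in terms of outer probability: \<^const>\<open>measure\<close> is \<open>0\<close> on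
  every non-measurable set, so the measure of the bad event itself is used only when that event
  is known to be measurable (lemma below).
\<close>

definition tendsto_zero_in_prob :: "(nat \<Rightarrow> 'a measure) \<Rightarrow> (nat \<Rightarrow> 'a \<Rightarrow> real) \<Rightarrow> bool" where
  "tendsto_zero_in_prob P D \<longleftrightarrow>
     (\<forall>\<epsilon>>0. \<exists>A. (\<forall>l. A l \<in> sets (P l) \<and> {\<omega> \<in> space (P l). \<bar>D l \<omega>\<bar> > \<epsilon>} \<subseteq> A l) \<and>
       (\<lambda>l. measure (P l) (A l)) \<longlonglongrightarrow> 0)"

lemma tendsto_zero_in_prob_measurable:
  assumes P: "\<And>l. prob_space (P l)" and D: "\<And>l. D l \<in> borel_measurable (P l)"
  shows "tendsto_zero_in_prob P D \<longleftrightarrow>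
    (\<forall>\<epsilon>>0. (\<lambda>l. measure (P l) {\<omega> \<in> space (P l). \<bar>D l \<omega>\<bar> > \<epsilon>}) \<longlonglongrightarrow> 0)"
proof -
  have meas: "{\<omega> \<in> space (P l). \<bar>D l \<omega>\<bar> > \<epsilon>} \<in> sets (P l)" for l \<epsilon>
    using D[of l] by measurable
  show ?thesis
  proof (intro iffI allI impI)
    fix \<epsilon> :: real
    assume "tendsto_zero_in_prob P D" "\<epsilon> > 0"
    then obtain A where A: "\<And>l. A l \<in> sets (P l)"
        "\<And>l. {\<omega> \<in> space (P l). \<bar>D l \<omega>\<bar> > \<epsilon>} \<subseteq> A l"
        "(\<lambda>l. measure (P l) (A l)) \<longlonglongrightarrow> 0"
      unfolding tendsto_zero_in_prob_def by meson
    have "measure (P l) {\<omega> \<in> space (P l). \<bar>D l \<omega>\<bar> > \<epsilon>} \<le> measure (P l) (A l)" for l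
      using prob_space.finite_measure[OF P] A(1,2) by (intro finite_measure.finite_measure_mono)
    then show "(\<lambda>l. measure (P l) {\<omega> \<in> space (P l). \<bar>D l \<omega>\<bar> > \<epsilon>}) \<longlonglongrightarrow> 0"
      by (intro tendsto_sandwich[OF _ _ tendsto_const A(3)]) auto
  next
    assume "\<forall>\<epsilon>>0. (\<lambda>l. measure (P l) {\<omega> \<in> space (P l). \<bar>D l \<omega>\<bar> > \<epsilon>}) \<longlonglongrightarrow> 0"
    then show "tendsto_zero_in_prob P D"
      unfolding tendsto_zero_in_prob_def using meas
      by (intro allI impI exI[of _ "\<lambda>l. {\<omega> \<in> space (P l). \<bar>D l \<omega>\<bar> > _}"]) auto
  qed
qed

end

theory Submission
  imports Defs "HOL-Real_Asymp.Real_Asymp"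
begin

text \<open>
  \<^bold>\<open>Reduction of the rate.\<close> Put \<open>u = ln p\<close>, \<open>a = sqrt (n / k)\<close> and \<open>L = a * sqrt (2 * u)\<close>, which is the
  first term of the bracket. Since \<open>k\<close> is at most of order \<open>n * u powr 0.99\<close>, \<open>L\<close> grows at least like a
  positive power of \<open>u\<close>, whereas the other two terms of the bracket are \<open>O(ln u)\<close>. So the claim is that, for
  every \<open>\<epsilon> > 0\<close>, the rank lies between \<open>exp ((1 - \<epsilon>) * L)\<close> and \<open>exp ((1 + \<epsilon>) * L)\<close> with probability
  tending to one (\<open>rate_asymp\<close>). As \<open>n / k\<close> is bounded, \<open>L = O(sqrt u)\<close>, so the rank is only \<open>p\<close> to a power
  tending to zero.

  \<^bold>\<open>The procedures act like marginal screening.\<close> With high probability all column norms are close to one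
  and all inner products of distinct columns are at most \<open>p powr (- 1/8)\<close>. While only \<open>p powr o(1)\<close>
  variables are selected, with coefficients of bounded size, the correlation of any other column
  with the residual therefore differs negligibly from its correlation with \<open>y\<close>, uniformly over all
  possible selections. Hence each procedure starts by selecting the variables in the order of the
  marginal correlations \<open>\<bar>\<langle>X\<^sub>j, y\<rangle>\<bar>\<close>, up to a small slack. The predicate \<open>tracks\<close> expresses this, and it
  holds for the three procedures by \<open>tracks_forward_stepwise\<close>, \<open>tracks_lasso\<close> and \<open>tracks_lar\<close>. It reduces
  the rank to the number of signal variables whose marginal correlation exceeds those of all the
  noise variables (\<open>first_noise_rank_le\<close>, \<open>first_noise_rank_ge\<close>). This part is deterministic.

  \<^bold>\<open>Counting large marginal correlations.\<close> The entries of \<open>y\<close> have variance \<open>s\<^sup>2 = k * M\<^sup>2 / n + \<sigma>\<^sup>2\<close>.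
  Given \<open>y\<close>, the noise correlations are independent and nearly \<open>N(0, s\<^sup>2)\<close>, so the largest is about
  \<open>s * sqrt (2 * u)\<close>. A signal correlation is nearly \<open>N(M, s\<^sup>2)\<close>, where \<open>\<bar>M\<bar> / s\<close> is about \<open>a\<close> because
  \<open>\<sigma> / M\<close> tends to zero. The expected number of signals above the largest noise correlation is thus
  about \<open>k * exp (- (sqrt (2 * u) - a)\<^sup>2 / 2)\<close>, which is \<open>exp (L + O(ln u))\<close> because \<open>k / p\<close> is at least an
  inverse power of \<open>u\<close>. Markov's inequality makes this an upper bound on the count. The signal
  correlations depend on each other through \<open>y\<close>; for the lower bound the signals are therefore split
  into \<open>exp ((1 - 9 * \<epsilon>) * L)\<close> groups. The columns of a group are independent of \<open>y\<close> without the contribution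
  of the group, and what the group contributes besides \<open>M * X\<^sub>j\<close> is small, so that each group contains
  a large correlation except with a tiny probability. The resulting bounds are collected in \<open>rank_bounds\<close>;
  the locales \<open>tuning\<close> and \<open>asymptotic_regime\<close> choose the thresholds and show that the failure
  probability vanishes.
\<close>

section \<open>Near-orthonormal designs\<close>

definition vanishes_off :: "nat set \<Rightarrow> (nat \<Rightarrow> real) \<Rightarrow> bool" where
  "vanishes_off A b \<longleftrightarrow> (\<forall>j. j \<notin> A \<longrightarrow> b j = 0)"

abbreviation gram :: "nat \<Rightarrow> (nat \<Rightarrow> nat \<Rightarrow> real) \<Rightarrow> nat \<Rightarrow> nat \<Rightarrow> real" where
  "gram n X i j \<equiv> col_inner n X i (\<lambda>r. X r j)"

lemma col_inner_sum:
  "col_inner n X j (\<lambda>r. \<Sum>i\<in>I. X r i * b i) = (\<Sum>i\<in>I. gram n X j i * b i)"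
  unfolding col_inner_def sum_distrib_left sum_distrib_right
  by (subst sum.swap) (simp add: mult.assoc)

lemma col_inner_residual:
  "col_inner n X j (residual p X y b) = col_inner n X j y - (\<Sum>i<p. gram n X j i * b i)"
proof -
  have "col_inner n X j (residual p X y b) =
      col_inner n X j y - col_inner n X j (\<lambda>r. \<Sum>i<p. X r i * b i)"
    unfolding col_inner_def residual_def by (simp add: right_diff_distrib sum_subtractf)
  then show ?thesis by (simp add: col_inner_sum)
qed

lemma sq_norm_fit:
  "sq_norm n (\<lambda>r. \<Sum>i<p. X r i * d i) = (\<Sum>i<p. \<Sum>j<p. gram n X i j * d i * d j)"
proof -
  have "sq_norm n (\<lambda>r. \<Sum>i<p. X r i * d i) = (\<Sum>r<n. \<Sum>i<p. \<Sum>j<p. X r i * d i * (X r j * d j))"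
    unfolding sq_norm_def by (simp add: power2_eq_square sum_product)
  also have "\<dots> = (\<Sum>i<p. \<Sum>j<p. \<Sum>r<n. X r i * d i * (X r j * d j))"
    by (subst sum.swap, rule sum.cong[OF refl], rule sum.swap)
  also have "\<dots> = (\<Sum>i<p. \<Sum>j<p. gram n X i j * d i * d j)"
    unfolding col_inner_def sum_distrib_right by (intro sum.cong refl) (simp add: mult_ac)
  finally show ?thesis .
qed

text \<open>
  The expansion about \<open>b\<close> serves twice: with \<open>d\<close> supported on one coordinate it yields the optimality
  conditions, and with arbitrary \<open>d\<close> it compares \<open>b\<close> with any other candidate.
\<close>

lemma sq_norm_residual_add:
  "sq_norm n (residual p X y (\<lambda>j. b j + d j)) =
     sq_norm n (residual p X y b) - 2 * (\<Sum>j<p. d j * col_inner n X j (residual p X y b))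
       + sq_norm n (\<lambda>r. \<Sum>i<p. X r i * d i)"
proof -
  let ?r = "residual p X y b" and ?f = "\<lambda>r. \<Sum>i<p. X r i * d i"
  have eq: "residual p X y (\<lambda>j. b j + d j) r = ?r r - ?f r" for r
    by (simp add: residual_def distrib_left sum.distrib)
  have "(\<Sum>r<n. ?r r * ?f r) = (\<Sum>j<p. d j * col_inner n X j ?r)"
    unfolding col_inner_def sum_distrib_left by (subst sum.swap) (simp add: mult_ac)
  then show ?thesis
    unfolding sq_norm_def eq
    by (simp add: power2_diff sum.distrib sum_subtractf mult.assoc flip: sum_distrib_left)
qed

lemma residual_residual:
  "residual p X (residual p X y b) d = residual p X y (\<lambda>j. b j + d j)"
  by (rule ext) (simp add: residual_def distrib_left sum.distrib)

lemma sum_single_coordinate: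
  assumes "j < (p::nat)"
  shows "(\<Sum>i<p. f i * (if i = j then t else 0)) = f j * (t::real)"
  using assms by (simp add: if_distrib[of "\<lambda>x. _ * x"] sum.delta cong: if_cong)

lemma sq_norm_single_column:
  assumes "i < p"
  shows "sq_norm n (\<lambda>r. \<Sum>k<p. X r k * (if k = i then t else 0)) = gram n X i i * t\<^sup>2"
  unfolding sum_single_coordinate[OF assms] sq_norm_def col_inner_def sum_distrib_right
  by (simp add: power2_eq_square mult_ac)

text \<open>
  Optimality in a single coordinate with current value \<open>b\<close> and residual correlation \<open>g\<close>. Small steps
  in both directions give the bound on \<open>g\<close>; shrinking \<open>b\<close> proportionally shows that the bound is
  attained, with the sign of \<open>b\<close>, unless \<open>b = 0\<close>.
\<close>

lemma soft_threshold_optimality: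
  fixes g a lam b :: real
  assumes a: "a \<ge> 0" and lam: "lam \<ge> 0"
    and min: "\<And>t. - t * g + a * t\<^sup>2 / 2 + lam * (\<bar>b + t\<bar> - \<bar>b\<bar>) \<ge> 0"
  shows "\<bar>g\<bar> \<le> lam" "g * b = lam * \<bar>b\<bar>"
proof -
  have lin: "x \<le> 0" if "\<And>t. 0 < t \<Longrightarrow> t \<le> T \<Longrightarrow> t * x \<le> a * t\<^sup>2 / 2" "T > 0" "a \<ge> 0"
    for x T a :: real
  proof (rule ccontr)
    assume "\<not> x \<le> 0"
    define t where "t = min T (x / (a + 1))"
    have t: "0 < t" "t \<le> T" using \<open>\<not> x \<le> 0\<close> \<open>T > 0\<close> \<open>a \<ge> 0\<close> by (auto simp: t_def)
    have "t * x \<le> a * t * t / 2" using that(1)[OF t] by (simp add: power2_eq_square)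
    then have "x \<le> a * t / 2" using t by (simp add: field_simps)
    also have "\<dots> \<le> a * (x / (a + 1)) / 2"
      using \<open>a \<ge> 0\<close> by (intro divide_right_mono mult_left_mono) (auto simp: t_def)
    also have "\<dots> < x" using \<open>a \<ge> 0\<close> \<open>\<not> x \<le> 0\<close> by (simp add: field_simps add_strict_increasing2)
    finally show False by simp
  qed
  have "g - lam \<le> 0"
  proof (rule lin[where T = 1 and a = a])
    fix t :: real assume "0 < t"
    then have "lam * (\<bar>b + t\<bar> - \<bar>b\<bar>) \<le> lam * t" using lam by (intro mult_left_mono) auto
    with min[of t] show "t * (g - lam) \<le> a * t\<^sup>2 / 2" by (simp add: algebra_simps)
  qed (use a in simp_all)
  moreover have "- g - lam \<le> 0"
  proof (rule lin[where T = 1 and a = a])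
    fix t :: real assume "0 < t"
    then have "lam * (\<bar>b + - t\<bar> - \<bar>b\<bar>) \<le> lam * t" using lam by (intro mult_left_mono) auto
    with min[of "- t"] show "t * (- g - lam) \<le> a * t\<^sup>2 / 2" by (simp add: algebra_simps)
  qed (use a in simp_all)
  ultimately show g: "\<bar>g\<bar> \<le> lam" by linarith
  show "g * b = lam * \<bar>b\<bar>"
  proof (cases "b = 0")
    case False
    have "lam * \<bar>b\<bar> - g * b \<le> 0"
    proof (rule lin[where T = 1 and a = "a * b\<^sup>2"])
      fix t :: real assume t: "0 < t" "t \<le> 1"
      have "b + - t * b = (1 - t) * b" by (simp add: algebra_simps)
      then have "\<bar>b + - t * b\<bar> = (1 - t) * \<bar>b\<bar>" using t by (simp add: abs_mult)
      then have "0 \<le> t * (g * b) + a * (t * b)\<^sup>2 / 2 + lam * ((1 - t) * \<bar>b\<bar> - \<bar>b\<bar>)"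
        using min[of "- t * b"] by (simp add: mult_ac)
      then show "t * (lam * \<bar>b\<bar> - g * b) \<le> a * b\<^sup>2 * t\<^sup>2 / 2"
        by (simp add: algebra_simps power_mult_distrib)
    qed (use a in simp_all)
    moreover have "g * b \<le> lam * \<bar>b\<bar>"
      using mult_right_mono[OF g, of "\<bar>b\<bar>"] by (simp flip: abs_mult)
    ultimately show ?thesis by simp
  qed simp
qed

text \<open>
  Here \<open>m\<close> bounds the number of variables that a procedure has selected. The last condition makes the
  Gram matrix of any \<open>m + 1\<close> columns diagonally dominant.
\<close>

locale near_orthonormal =
  fixes n p :: nat and X :: "nat \<Rightarrow> nat \<Rightarrow> real" and w \<eta> :: real and m :: nat
  assumes col_norm: "\<And>j. j < p \<Longrightarrow> \<bar>gram n X j j - 1\<bar> \<le> w"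
    and incoherent: "\<And>i j. i < p \<Longrightarrow> j < p \<Longrightarrow> i \<noteq> j \<Longrightarrow> \<bar>gram n X i j\<bar> \<le> \<eta>"
    and w_pos: "w > 0" and \<eta>_nonneg: "\<eta> \<ge> 0"
    and small: "w + (real m + 1) * \<eta> \<le> 1 / 2"
begin

lemma w_nonneg: "w \<ge> 0"
  using w_pos by simp

lemma w_le: "w \<le> 1 / 2"
  using small \<eta>_nonneg by (smt (verit) mult_nonneg_nonneg of_nat_0_le_iff)

lemma gram_diag: "j < p \<Longrightarrow> 1 - w \<le> gram n X j j" "j < p \<Longrightarrow> gram n X j j \<le> 1 + w"
  using col_norm[of j] by (auto simp: abs_le_iff)

lemma off_diagonal_le:
  assumes "j < p"
  shows "\<bar>\<Sum>i\<in>{..<p}-{j}. gram n X j i * b i\<bar> \<le> \<eta> * (\<Sum>i<p. \<bar>b i\<bar>)"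
proof -
  have "\<bar>\<Sum>i\<in>{..<p}-{j}. gram n X j i * b i\<bar> \<le> (\<Sum>i\<in>{..<p}-{j}. \<eta> * \<bar>b i\<bar>)"
    using assms by (intro order.trans[OF sum_abs] sum_mono)
      (auto simp: abs_mult intro!: mult_right_mono incoherent)
  also have "\<dots> \<le> (\<Sum>i<p. \<eta> * \<bar>b i\<bar>)"
    using \<eta>_nonneg by (intro sum_mono2) auto
  finally show ?thesis by (simp add: sum_distrib_left)
qed

lemma col_inner_residual_split:
  assumes "j < p"
  shows "col_inner n X j (residual p X y b) =
    col_inner n X j y - gram n X j j * b j - (\<Sum>i\<in>{..<p}-{j}. gram n X j i * b i)"
  using assms by (simp add: col_inner_residual sum.remove[of "{..<p}" j])

lemma sum_vanishes_off:
  assumes "vanishes_off A b" "A \<subseteq> {..<p}" "\<And>j. b j = 0 \<Longrightarrow> f j = (0::real)"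
  shows "(\<Sum>j<p. f j) = (\<Sum>j\<in>A. f j)"
  using assms by (intro sum.mono_neutral_right) (auto simp: vanishes_off_def)

text \<open>
  The off-diagonal part of the quadratic form is at most \<open>\<eta>\<close> times the squared \<open>\<ell>\<^sub>1\<close> norm of \<open>u\<close>, hence at
  most \<open>card A * \<eta>\<close> times the squared Euclidean norm by the Cauchy-Schwarz inequality.
\<close>

lemma sq_norm_fit_ge:
  assumes A: "A \<subseteq> {..<p}" and u: "vanishes_off A u"
  shows "(1 - (w + real (card A) * \<eta>)) * (\<Sum>i<p. (u i)\<^sup>2) \<le> sq_norm n (\<lambda>r. \<Sum>i<p. X r i * u i)"
proof -
  let ?S = "\<Sum>i<p. \<bar>u i\<bar>"
  have row: "(1 - w) * (u i)\<^sup>2 - \<eta> * \<bar>u i\<bar> * ?S \<le> (\<Sum>j<p. gram n X i j * u i * u j)" if "i < p" for i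
  proof -
    have "(\<Sum>j<p. gram n X i j * u i * u j) =
        gram n X i i * (u i)\<^sup>2 + u i * (\<Sum>j\<in>{..<p}-{i}. gram n X i j * u j)"
      using that by (simp add: sum.remove[of "{..<p}" i] sum_distrib_left power2_eq_square mult_ac)
    moreover have "\<bar>u i * (\<Sum>j\<in>{..<p}-{i}. gram n X i j * u j)\<bar> \<le> \<bar>u i\<bar> * (\<eta> * ?S)"
      unfolding abs_mult by (intro mult_left_mono off_diagonal_le that) auto
    moreover have "(1 - w) * (u i)\<^sup>2 \<le> gram n X i i * (u i)\<^sup>2"
      by (intro mult_right_mono gram_diag that) auto
    ultimately show ?thesis by (auto simp: abs_le_iff mult_ac)
  qed
  have "?S = (\<Sum>i\<in>A. \<bar>u i\<bar> * 1)" using u A by (subst sum_vanishes_off[OF u A]) auto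
  then have "?S\<^sup>2 \<le> (\<Sum>i\<in>A. \<bar>u i\<bar>\<^sup>2) * (\<Sum>i\<in>A. 1\<^sup>2)"
    using Cauchy_Schwarz_ineq_sum[of "\<lambda>i. \<bar>u i\<bar>" "\<lambda>_. 1" A] by simp
  also have "\<dots> = real (card A) * (\<Sum>i<p. (u i)\<^sup>2)"
    using u A by (subst sum_vanishes_off[OF u A, of "\<lambda>i. (u i)\<^sup>2"]) auto
  finally have "\<eta> * ?S\<^sup>2 \<le> \<eta> * (real (card A) * (\<Sum>i<p. (u i)\<^sup>2))"
    using \<eta>_nonneg by (rule mult_left_mono)
  moreover have "(\<Sum>i<p. (1 - w) * (u i)\<^sup>2 - \<eta> * \<bar>u i\<bar> * ?S) \<le> sq_norm n (\<lambda>r. \<Sum>i<p. X r i * u i)"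
    unfolding sq_norm_fit by (intro sum_mono row) auto
  moreover have "(\<Sum>i<p. (1 - w) * (u i)\<^sup>2 - \<eta> * \<bar>u i\<bar> * ?S) = (1 - w) * (\<Sum>i<p. (u i)\<^sup>2) - \<eta> * ?S\<^sup>2"
    by (simp add: sum_subtractf power2_eq_square flip: sum_distrib_left sum_distrib_right)
  ultimately show ?thesis by (simp add: algebra_simps)
qed

lemma card_small:
  assumes "card A \<le> m + 1"
  shows "w + real (card A) * \<eta> \<le> 1 / 2"
proof -
  have "real (card A) * \<eta> \<le> (real m + 1) * \<eta>"
    using assms \<eta>_nonneg by (intro mult_right_mono) auto
  with small show ?thesis by linarith
qed

text \<open>
  The lower bound on fitted values confines all candidates that are not worse than \<open>0\<close> to a compact
  box. The case \<open>lam = 0\<close> is least squares on the columns in \<open>A\<close>.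
\<close>

lemma restricted_minimizer_exists:
  assumes A: "A \<subseteq> {..<p}" "card A \<le> m + 1" and lam: "lam \<ge> 0"
  shows "\<exists>b. is_arg_min (lasso_objective n p X y lam) (vanishes_off A) b"
proof -
  let ?f = "lasso_objective n p X y lam"
  define R where "R = sqrt (8 * sq_norm n y)"
  define K where "K = (\<Pi>\<^sub>E j\<in>UNIV. if j \<in> A then {- R..R} else {0::real})"
  have K_iff: "b \<in> K \<longleftrightarrow> vanishes_off A b \<and> (\<forall>j\<in>A. \<bar>b j\<bar> \<le> R)" for b
    unfolding K_def vanishes_off_def by (auto simp: PiE_iff abs_le_iff split: if_splits)
  have R: "R \<ge> 0" by (simp add: R_def sq_norm_def sum_nonneg)
  have f0: "?f (\<lambda>_. 0) = sq_norm n y / 2"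
    by (simp add: lasso_objective_def sq_norm_def residual_def)
  have "compact K" unfolding K_def
    using compactin_PiE[of "\<lambda>_::nat. euclidean :: real topology" UNIV "\<lambda>j. if j \<in> A then {- R..R} else {0}"]
    by (simp add: euclidean_product_topology)
  moreover have "K \<noteq> {}" using K_iff[of "\<lambda>_. 0"] R by (auto simp: vanishes_off_def)
  moreover have "continuous_on K ?f"
  proof -
    have "continuous_on K (\<lambda>b. b j)" for j
      by (rule continuous_on_subset[OF continuous_on_product_coordinates]) simp
    then show ?thesis
      unfolding lasso_objective_def sq_norm_def residual_def
      by (intro continuous_on_add continuous_on_mult continuous_on_const continuous_on_sum
          continuous_on_diff continuous_on_power continuous_on_divide continuous_on_rabs) auto
  qed
  ultimately obtain b where b: "b \<in> K" "\<And>b'. b' \<in> K \<Longrightarrow> ?f b \<le> ?f b'"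
    using continuous_attains_inf[of K ?f] by blast
  have far: "sq_norm n y / 2 < ?f b'" if b': "vanishes_off A b'" "b' \<notin> K" for b'
  proof (rule ccontr)
    assume "\<not> sq_norm n y / 2 < ?f b'"
    moreover have "lam * (\<Sum>j<p. \<bar>b' j\<bar>) \<ge> 0" using lam by (intro mult_nonneg_nonneg sum_nonneg) auto
    ultimately have le: "sq_norm n (residual p X y b') \<le> sq_norm n y"
      by (simp add: lasso_objective_def)
    have "sq_norm n (\<lambda>r. \<Sum>i<p. X r i * b' i) \<le>
        2 * sq_norm n y + 2 * sq_norm n (residual p X y b')"
      unfolding sq_norm_def sum_distrib_left sum.distrib[symmetric]
    proof (intro sum_mono)
      fix r
      have "(y r - residual p X y b' r)\<^sup>2 \<le> 2 * (y r)\<^sup>2 + 2 * (residual p X y b' r)\<^sup>2"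
        using sum_squares_ge_zero[of "y r + residual p X y b' r" 0]
        by (simp add: power2_eq_square algebra_simps)
      then show "(\<Sum>i<p. X r i * b' i)\<^sup>2 \<le> 2 * (y r)\<^sup>2 + 2 * (residual p X y b' r)\<^sup>2"
        by (simp add: residual_def)
    qed
    with le have "sq_norm n (\<lambda>r. \<Sum>i<p. X r i * b' i) \<le> 4 * sq_norm n y" by simp
    moreover have "1 / 2 * (\<Sum>i<p. (b' i)\<^sup>2) \<le> (1 - (w + real (card A) * \<eta>)) * (\<Sum>i<p. (b' i)\<^sup>2)"
      using card_small[OF A(2)] by (intro mult_right_mono sum_nonneg) auto
    ultimately have "(\<Sum>i<p. (b' i)\<^sup>2) \<le> 8 * sq_norm n y"
      using sq_norm_fit_ge[OF A(1) b'(1)] by simp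
    then have "\<bar>b' j\<bar> \<le> R" if "j \<in> A" for j
      using member_le_sum[of j "{..<p}" "\<lambda>i. (b' i)\<^sup>2"] that A(1) unfolding R_def
      by (intro real_le_rsqrt) auto
    with b' show False by (simp add: K_iff)
  qed
  have "?f b \<le> ?f b'" if "vanishes_off A b'" for b'
  proof (cases "b' \<in> K")
    case False
    have "?f b \<le> ?f (\<lambda>_. 0)" using R by (intro b(2)) (simp add: K_iff vanishes_off_def)
    with far[OF that False] f0 show ?thesis by simp
  qed (rule b(2))
  with b(1) show ?thesis
    by (intro exI[of _ b]) (auto simp: is_arg_min_linorder K_iff)
qed

lemma restricted_minimizer_kkt:
  assumes A: "A \<subseteq> {..<p}" and lam: "lam \<ge> 0"
    and min: "is_arg_min (lasso_objective n p X y lam) (vanishes_off A) b" and j: "j \<in> A"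
  shows "\<bar>col_inner n X j (residual p X y b)\<bar> \<le> lam"
    "col_inner n X j (residual p X y b) * b j = lam * \<bar>b j\<bar>"
proof -
  let ?g = "col_inner n X j (residual p X y b)"
  have jp: "j < p" using j A by auto
  have step: "- t * ?g + gram n X j j * t\<^sup>2 / 2 + lam * (\<bar>b j + t\<bar> - \<bar>b j\<bar>) \<ge> 0" for t
  proof -
    let ?d = "\<lambda>i. if i = j then t else 0"
    have "vanishes_off A (\<lambda>i. b i + ?d i)"
      using min j by (auto simp: is_arg_min_linorder vanishes_off_def)
    then have le: "lasso_objective n p X y lam b \<le> lasso_objective n p X y lam (\<lambda>i. b i + ?d i)"
      using min by (auto simp: is_arg_min_linorder)
    have fit: "sq_norm n (\<lambda>r. \<Sum>i<p. X r i * ?d i) = gram n X j j * t\<^sup>2"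
      by (rule sq_norm_single_column[OF jp])
    have cross: "(\<Sum>i<p. ?d i * col_inner n X i (residual p X y b)) = t * ?g"
      using sum_single_coordinate[OF jp, of "\<lambda>i. col_inner n X i (residual p X y b)" t]
      by (simp add: mult.commute)
    have l1: "(\<Sum>i<p. \<bar>b i + ?d i\<bar>) = (\<Sum>i<p. \<bar>b i\<bar>) + (\<bar>b j + t\<bar> - \<bar>b j\<bar>)"
      using jp by (simp add: sum.remove[of "{..<p}" j])
    have "sq_norm n (residual p X y b) / 2 + lam * (\<Sum>i<p. \<bar>b i\<bar>) \<le>
        (sq_norm n (residual p X y b) - 2 * (t * ?g) + gram n X j j * t\<^sup>2) / 2
          + lam * ((\<Sum>i<p. \<bar>b i\<bar>) + (\<bar>b j + t\<bar> - \<bar>b j\<bar>))"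
      using le unfolding lasso_objective_def sq_norm_residual_add fit cross l1 .
    then show ?thesis by (simp add: distrib_left add_divide_distrib diff_divide_distrib)
  qed
  have "gram n X j j \<ge> 0" using gram_diag(1)[OF jp] w_le by linarith
  from soft_threshold_optimality[OF this lam step]
  show "\<bar>?g\<bar> \<le> lam" "?g * b j = lam * \<bar>b j\<bar>" by auto
qed

end

locale near_orthonormal_response = near_orthonormal +
  fixes y :: "nat \<Rightarrow> real" and Q :: real
  assumes corr_le: "\<And>j. j < p \<Longrightarrow> \<bar>col_inner n X j y\<bar> \<le> Q" and Q_pos: "Q > 0"
begin

abbreviation corr :: "nat \<Rightarrow> real" where "corr j \<equiv> \<bar>col_inner n X j y\<bar>"
abbreviation res_corr :: "(nat \<Rightarrow> real) \<Rightarrow> nat \<Rightarrow> real" where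
  "res_corr b j \<equiv> col_inner n X j (residual p X y b)"

text \<open>
  In the bounds below \<open>tiny\<close> is the influence that the selected coefficients can have on the inner product
  with one column, and \<open>slack\<close> is the accuracy with which marginal correlations are compared. The
  latter also accounts for the column norms, by which forward stepwise divides.
\<close>

definition slack :: real where "slack = 8 * (w + (real m + 1) * \<eta>) * Q"
definition tiny :: real where "tiny = 2 * real m * \<eta> * Q"

lemma tiny_nonneg: "tiny \<ge> 0"
  using Q_pos \<eta>_nonneg by (simp add: tiny_def)

lemma tiny_le: "4 * tiny < slack" "tiny \<le> Q"
proof -
  have "real m * \<eta> * Q < (w + (real m + 1) * \<eta>) * Q"
    using Q_pos \<eta>_nonneg w_pos by (intro mult_strict_right_mono) (auto simp: algebra_simps)
  moreover have "(w + (real m + 1) * \<eta>) * Q \<le> 1 / 2 * Q"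
    using Q_pos by (intro mult_right_mono small) auto
  moreover have "tiny = 2 * (real m * \<eta> * Q)" "slack = 8 * ((w + (real m + 1) * \<eta>) * Q)"
    by (simp_all only: tiny_def slack_def mult.assoc)
  ultimately show "4 * tiny < slack" "tiny \<le> Q" by linarith+
qed

text \<open>
  A coefficient whose residual correlation has its own sign has moved its column's correlation
  towards zero without crossing it. So it is at most of the size of the marginal correlation, up to the
  influence of the other selected columns, which is absorbed on the left-hand side.
\<close>

lemma l1_norm_le:
  assumes A: "A \<subseteq> {..<p}" "card A \<le> m" and b: "vanishes_off A b"
    and sgn: "\<And>j. j \<in> A \<Longrightarrow> res_corr b j * b j \<ge> 0"
  shows "(\<Sum>j<p. \<bar>b j\<bar>) \<le> 2 * real m * Q"
proof -
  let ?S = "\<Sum>j<p. \<bar>b j\<bar>"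
  have coord: "(1 - w) * \<bar>b j\<bar> \<le> Q + \<eta> * ?S" if j: "j \<in> A" for j
  proof (cases "b j = 0")
    case True
    have "\<eta> * ?S \<ge> 0" using \<eta>_nonneg by (intro mult_nonneg_nonneg sum_nonneg) auto
    with True Q_pos show ?thesis by simp
  next
    case False
    let ?e = "\<Sum>i\<in>{..<p}-{j}. gram n X j i * b i"
    have jp: "j < p" using j A by auto
    have "0 \<le> col_inner n X j y * b j - gram n X j j * (b j)\<^sup>2 - ?e * b j"
      using sgn[OF j] by (simp add: col_inner_residual_split[OF jp] left_diff_distrib power2_eq_square)
    moreover have "\<bar>col_inner n X j y * b j\<bar> \<le> Q * \<bar>b j\<bar>"
      unfolding abs_mult by (intro mult_right_mono corr_le[OF jp] abs_ge_zero)
    moreover have "\<bar>?e * b j\<bar> \<le> \<eta> * ?S * \<bar>b j\<bar>"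
      unfolding abs_mult by (intro mult_right_mono off_diagonal_le[OF jp] abs_ge_zero)
    moreover have "(1 - w) * (b j)\<^sup>2 \<le> gram n X j j * (b j)\<^sup>2"
      by (intro mult_right_mono gram_diag jp) auto
    ultimately have "(1 - w) * (b j)\<^sup>2 \<le> Q * \<bar>b j\<bar> + \<eta> * ?S * \<bar>b j\<bar>" by linarith
    then have "(1 - w) * (\<bar>b j\<bar> * \<bar>b j\<bar>) \<le> (Q + \<eta> * ?S) * \<bar>b j\<bar>"
      by (simp add: distrib_right power2_eq_square)
    then have "((1 - w) * \<bar>b j\<bar>) * \<bar>b j\<bar> \<le> (Q + \<eta> * ?S) * \<bar>b j\<bar>" by (simp add: mult_ac)
    then show ?thesis using False by (simp add: mult_le_cancel_right)
  qed
  have "(1 - w) * ?S = (\<Sum>j\<in>A. (1 - w) * \<bar>b j\<bar>)"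
    using b A by (subst sum_vanishes_off[OF b A(1)]) (auto simp: sum_distrib_left)
  also have "\<dots> \<le> (\<Sum>j\<in>A. Q + \<eta> * ?S)" by (rule sum_mono[OF coord])
  also have "\<dots> = real (card A) * (Q + \<eta> * ?S)" by simp
  also have "\<dots> \<le> real m * (Q + \<eta> * ?S)"
    using A Q_pos \<eta>_nonneg by (intro mult_right_mono add_nonneg_nonneg mult_nonneg_nonneg sum_nonneg) auto
  finally have "(1 - (w + real m * \<eta>)) * ?S \<le> real m * Q" by (simp add: algebra_simps)
  moreover have "1 / 2 * ?S \<le> (1 - (w + real m * \<eta>)) * ?S"
    using small \<eta>_nonneg by (intro mult_right_mono sum_nonneg) (auto simp: algebra_simps)
  ultimately show ?thesis by simp
qed

lemma off_diagonal_tiny: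
  assumes "j < p" "(\<Sum>i<p. \<bar>b i\<bar>) \<le> 2 * real m * Q"
  shows "\<bar>\<Sum>i\<in>{..<p}-{j}. gram n X j i * b i\<bar> \<le> tiny"
  using off_diagonal_le[OF assms(1), of b] mult_left_mono[OF assms(2) \<eta>_nonneg]
  by (simp add: tiny_def mult_ac)

text \<open>
  This is why the procedures act like marginal screening: selecting few variables with bounded
  coefficients hardly changes the correlations of the others.
\<close>

lemma res_corr_inactive:
  assumes "j < p" "(\<Sum>i<p. \<bar>b i\<bar>) \<le> 2 * real m * Q" "b j = 0"
  shows "corr j \<le> \<bar>res_corr b j\<bar> + tiny" "\<bar>res_corr b j\<bar> \<le> corr j + tiny"
  using off_diagonal_tiny[OF assms(1,2)] assms(3)
  by (simp_all add: col_inner_residual_split[OF assms(1)] abs_le_iff abs_if split: if_splits)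

end

section \<open>Selection by marginal correlation\<close>

lemma arg_max_on_finite:
  fixes f :: "'a \<Rightarrow> real"
  assumes "finite S" "S \<noteq> {}"
  shows "arg_max_on f S \<in> S" "\<And>x. x \<in> S \<Longrightarrow> f x \<le> f (arg_max_on f S)"
proof -
  have ex: "\<exists>x. is_arg_max f (\<lambda>x. x \<in> S) x"
    using obtains_MAX[OF assms] assms
    by (metis (mono_tags, lifting) Max_ge finite_imageI imageI is_arg_max_linorder)
  have "is_arg_max f (\<lambda>x. x \<in> S) (arg_max_on f S)"
    unfolding arg_max_on_def arg_max_def by (rule someI_ex[OF ex])
  then show "arg_max_on f S \<in> S" "\<And>x. x \<in> S \<Longrightarrow> f x \<le> f (arg_max_on f S)"
    by (simp_all add: is_arg_max_linorder)
qed

context near_orthonormal_response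
begin

definition strong :: "real \<Rightarrow> nat set" where
  "strong \<tau> = {j. j < p \<and> \<tau> \<le> corr j}"

text \<open>
  The common property of the three procedures: as long as at most \<open>m\<close> variables have marginal
  correlation at least \<open>\<tau>\<close>, some stage of the procedure agrees with thresholding at \<open>\<tau>\<close> up to \<open>slack\<close>.
  The empty stage is added because least angle regression starts with one variable included.
\<close>

definition tracks :: "nat set set \<Rightarrow> bool" where
  "tracks \<S> \<longleftrightarrow> (\<forall>S\<in>\<S>. S \<subseteq> {..<p}) \<and> (\<forall>S\<in>\<S>. \<forall>S'\<in>\<S>. S \<subseteq> S' \<or> S' \<subseteq> S) \<and>
     (\<forall>\<tau>>0. card (strong \<tau>) \<le> m \<longrightarrow>
        (\<exists>S\<in>insert {} \<S>. strong (\<tau> + slack) \<subseteq> S \<and> S \<subseteq> strong \<tau>))"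

lemma finite_strong: "finite (strong \<tau>)"
  by (simp add: strong_def)

text \<open>
  The stage given by \<open>tracks\<close> contains the noise variable \<open>j\<close>, so by nestedness all stages without
  noise variables are contained in it.
\<close>

lemma first_noise_rank_le:
  assumes tr: "tracks \<S>" and \<tau>: "\<tau> > 0" "card (strong \<tau>) \<le> m"
    and j: "j \<in> strong (\<tau> + slack)" "j \<notin> signal"
  shows "first_noise_rank signal \<S> \<le> m + 1"
proof -
  obtain S where S: "S \<in> insert {} \<S>" "strong (\<tau> + slack) \<subseteq> S" "S \<subseteq> strong \<tau>"
    using tr \<tau> unfolding tracks_def by meson
  have jS: "j \<in> S" using S(2) j(1) by (rule subsetD)
  then have "S \<in> \<S>" using S(1) by auto
  then have "S' \<subseteq> S" if "S' \<in> \<S>" "S' \<subseteq> signal" for S'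
    using tr jS j(2) that unfolding tracks_def by (meson subsetD)
  then have "\<Union>{S' \<in> \<S>. S' \<subseteq> signal} \<subseteq> strong \<tau>"
    using S(3) by (intro Union_least) (auto intro: order_trans)
  then have "card (\<Union>{S' \<in> \<S>. S' \<subseteq> signal}) \<le> card (strong \<tau>)"
    by (intro card_mono finite_strong)
  with \<tau>(2) show ?thesis by (simp add: first_noise_rank_def)
qed

lemma first_noise_rank_ge:
  assumes tr: "tracks \<S>" and \<tau>: "\<tau> > 0" "card (strong \<tau>) \<le> m" and sub: "strong \<tau> \<subseteq> signal"
  shows "card (strong (\<tau> + slack)) + 1 \<le> first_noise_rank signal \<S>"
proof -
  obtain S where S: "S \<in> insert {} \<S>" "strong (\<tau> + slack) \<subseteq> S" "S \<subseteq> strong \<tau>"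
    using tr \<tau> unfolding tracks_def by meson
  have "S \<subseteq> \<Union>{S' \<in> \<S>. S' \<subseteq> signal}" using S(1,3) sub by (cases "S = {}") (auto intro!: Union_upper)
  moreover have "\<Union>{S' \<in> \<S>. S' \<subseteq> signal} \<subseteq> {..<p}"
  proof (rule Union_least)
    fix S' assume "S' \<in> {S' \<in> \<S>. S' \<subseteq> signal}"
    with tr show "S' \<subseteq> {..<p}" unfolding tracks_def by simp
  qed
  ultimately have "card (strong (\<tau> + slack)) \<le> card (\<Union>{S' \<in> \<S>. S' \<subseteq> signal})"
    using S(2) by (intro card_mono) (meson finite_lessThan finite_subset order_trans)+
  then show ?thesis by (simp add: first_noise_rank_def)
qed

text \<open>
  Consider the first stage that leaves \<open>strong \<tau>\<close>. The variable that is added there has correlation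
  below \<open>\<tau>\<close>, so all variables that are not yet selected have correlation below \<open>\<tau> + slack\<close>. The second
  alternative of \<open>step\<close> covers stages at which the procedure may stop.
\<close>

lemma tracks_greedy:
  assumes S0: "S 0 = {}" and Sp: "\<And>r. S r \<subseteq> {..<p}" and inc: "\<And>r. S r \<subseteq> S (Suc r)"
    and step: "\<And>r. card (S r) \<le> m \<Longrightarrow>
      (\<exists>j\<in>{..<p} - S r. S (Suc r) = insert j (S r) \<and> (\<forall>i\<in>{..<p} - S r. corr i \<le> corr j + slack)) \<or>
      (\<forall>i\<in>{..<p} - S r. corr i \<le> slack)"
    and \<S>: "insert {} \<S> = range S"
  shows "tracks \<S>"
  unfolding tracks_def
proof (intro conjI ballI allI impI)
  fix T assume "T \<in> \<S>"
  then have "T \<in> range S" unfolding \<S>[symmetric] by simp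
  then show "T \<subseteq> {..<p}" using Sp by auto
next
  fix T T' assume "T \<in> \<S>" "T' \<in> \<S>"
  then have "T \<in> range S" "T' \<in> range S" unfolding \<S>[symmetric] by simp_all
  then obtain r r' where "T = S r" "T' = S r'" by auto
  then show "T \<subseteq> T' \<or> T' \<subseteq> T"
    using lift_Suc_mono_le[of S r r', OF inc] lift_Suc_mono_le[of S r' r, OF inc] nat_le_linear[of r r']
    by auto
next
  fix \<tau> :: real assume \<tau>: "\<tau> > 0" "card (strong \<tau>) \<le> m"
  have card_le: "card (S r) \<le> m" if "S r \<subseteq> strong \<tau>" for r
    using card_mono[OF finite_strong that] \<tau>(2) by simp
  have "\<exists>r. S r \<subseteq> strong \<tau> \<and> strong (\<tau> + slack) \<subseteq> S r"
  proof (rule ccontr)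
    assume no: "\<nexists>r. S r \<subseteq> strong \<tau> \<and> strong (\<tau> + slack) \<subseteq> S r"
    have "S r \<subseteq> strong \<tau> \<and> card (S r) = r" for r
    proof (induction r)
      case (Suc r)
      obtain i where i: "i \<in> {..<p} - S r" "\<tau> + slack \<le> corr i"
        using no Suc by (auto simp: strong_def)
      have "\<not> corr i \<le> slack" using i \<tau>(1) by simp
      with step[of r] card_le[of r] Suc i(1)
      obtain j where j: "j \<in> {..<p} - S r" "S (Suc r) = insert j (S r)" "corr i \<le> corr j + slack"
        by blast
      then have "j \<in> strong \<tau>" using i by (auto simp: strong_def)
      moreover have "finite (S r)" using Sp finite_subset by blast
      ultimately show ?case using j Suc by auto
    qed (simp add: S0)
    from card_le[of "Suc m"] this[of "Suc m"] show False by simp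
  qed
  then show "\<exists>T\<in>insert {} \<S>. strong (\<tau> + slack) \<subseteq> T \<and> T \<subseteq> strong \<tau>"
    unfolding \<S> by blast
qed

lemma least_squares_l1_norm:
  assumes A: "A \<subseteq> {..<p}" "card A \<le> m"
    and min: "is_arg_min (lasso_objective n p X y 0) (vanishes_off A) b"
  shows "(\<Sum>j<p. \<bar>b j\<bar>) \<le> 2 * real m * Q"
  using restricted_minimizer_kkt(1)[OF A(1) _ min] min
  by (intro l1_norm_le[OF A]) (simp_all add: is_arg_min_linorder)

subsection \<open>Forward stepwise regression\<close>

lemma complete_square:
  assumes "0 < (c::real)"
  shows "- (g\<^sup>2 / c) \<le> - 2 * (u * g) + c * u\<^sup>2"
proof -
  have "0 \<le> c * (u - g / c)\<^sup>2" using assms by simp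
  also have "\<dots> = c * u\<^sup>2 - 2 * (u * g) + g\<^sup>2 / c"
    using assms by (simp add: power2_diff power2_eq_square field_simps)
  finally show ?thesis by simp
qed

abbreviation \<delta> :: real where "\<delta> \<equiv> w + (real m + 1) * \<eta>"

lemma rss_residual:
  assumes "S \<subseteq> {..<p}"
  shows "(\<lambda>i. y i - (\<Sum>j\<in>S. X i j * b j)) = residual p X y (\<lambda>j. if j \<in> S then b j else 0)"
proof (rule ext)
  fix i
  have "(\<Sum>j<p. X i j * (if j \<in> S then b j else 0)) = (\<Sum>j\<in>S. X i j * b j)"
    using assms by (intro sum.mono_neutral_cong_right) auto
  then show "y i - (\<Sum>j\<in>S. X i j * b j) = residual p X y (\<lambda>j. if j \<in> S then b j else 0) i"
    by (simp add: residual_def)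
qed

text \<open>
  Moving the coefficient of \<open>i\<close> alone, from any fit \<open>b\<close> on \<open>S\<close>, already achieves this decrease.
\<close>

lemma rss_insert_le:
  assumes S: "S \<subseteq> {..<p}" and b: "vanishes_off S b" and i: "i < p"
  shows "rss n X y (insert i S) \<le> sq_norm n (residual p X y b) - (res_corr b i)\<^sup>2 / (1 + w)"
proof -
  let ?g = "res_corr b i" and ?t = "res_corr b i / gram n X i i"
  let ?d = "\<lambda>j. if j = i then ?t else 0"
  have gr: "0 < gram n X i i" "gram n X i i \<le> 1 + w" using gram_diag[OF i] w_le by linarith+
  have "bdd_below (range (\<lambda>b. sq_norm n (\<lambda>r. y r - (\<Sum>j\<in>insert i S. X r j * b j))))"
    by (intro bdd_belowI[of _ 0]) (auto simp: sq_norm_def sum_nonneg)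
  then have "rss n X y (insert i S) \<le> sq_norm n (\<lambda>r. y r - (\<Sum>j\<in>insert i S. X r j * (b j + ?d j)))"
    unfolding rss_def by (rule cINF_lower) simp
  also have "\<dots> = sq_norm n (residual p X y (\<lambda>j. b j + ?d j))"
  proof -
    have eq: "(\<lambda>j. if j \<in> insert i S then b j + ?d j else 0) = (\<lambda>j. b j + ?d j)"
      using b by (auto simp: vanishes_off_def fun_eq_iff)
    show ?thesis using S i by (subst rss_residual) (simp_all only: eq insert_subset lessThan_iff simp_thms)
  qed
  also have "\<dots> = sq_norm n (residual p X y b) - 2 * (?g * ?t) + gram n X i i * ?t\<^sup>2"
  proof -
    have "sq_norm n (\<lambda>r. \<Sum>k<p. X r k * ?d k) = gram n X i i * ?t\<^sup>2"
      by (rule sq_norm_single_column[OF i])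
    moreover have "(\<Sum>k<p. ?d k * res_corr b k) = ?g * ?t"
      using sum_single_coordinate[OF i, of "res_corr b" ?t] by (simp only: mult.commute)
    ultimately show ?thesis by (simp only: sq_norm_residual_add)
  qed
  also have "\<dots> = sq_norm n (residual p X y b) - ?g\<^sup>2 / gram n X i i"
  proof -
    have "- 2 * (g * (g / c)) + c * (g / c)\<^sup>2 = - (g\<^sup>2 / c)" if "c > 0" for g c :: real
      using that by (simp add: power2_eq_square field_simps)
    from this[OF gr(1), of ?g] show ?thesis by linarith
  qed
  also have "\<dots> \<le> sq_norm n (residual p X y b) - ?g\<^sup>2 / (1 + w)"
    using gr by (intro diff_left_mono divide_left_mono) auto
  finally show ?thesis .
qed

text \<open>
  Refitting the variables in \<open>S\<close> as well cannot gain much more than moving the coefficient of \<open>j\<close>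
  alone, because the fitted values of near-orthonormal columns cannot cancel.
\<close>

lemma rss_insert_ge:
  assumes S: "S \<subseteq> {..<p}" "card S \<le> m" and j: "j < p" "j \<notin> S"
    and min: "is_arg_min (lasso_objective n p X y 0) (vanishes_off S) b"
  shows "sq_norm n (residual p X y b) - (res_corr b j)\<^sup>2 / (1 - \<delta>) \<le> rss n X y (insert j S)"
  unfolding rss_def
proof (rule cINF_greatest)
  fix b' :: "nat \<Rightarrow> real"
  let ?c = "\<lambda>i. if i \<in> insert j S then b' i else 0" and ?g = "res_corr b j"
  define u where "u i = ?c i - b i" for i
  have b: "vanishes_off S b" using min by (auto simp: is_arg_min_linorder)
  have zero: "res_corr b i = 0" if "i \<in> S" for i
    using restricted_minimizer_kkt(1)[OF S(1) _ min that] by simp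
  have u: "vanishes_off (insert j S) u" using b by (auto simp: u_def vanishes_off_def)
  have "(\<lambda>i. b i + u i) = ?c" by (auto simp: u_def)
  then have eq: "sq_norm n (\<lambda>i. y i - (\<Sum>j\<in>insert j S. X i j * b' j)) =
      sq_norm n (residual p X y (\<lambda>i. b i + u i))"
    using S j by (subst rss_residual) auto
  have fin: "finite S" using S finite_subset by blast
  have "(\<Sum>i<p. u i * res_corr b i) = (\<Sum>i\<in>insert j S. u i * res_corr b i)"
    using S j by (intro sum_vanishes_off[OF u]) auto
  also have "\<dots> = u j * ?g" using fin j zero by simp
  finally have cross: "(\<Sum>i<p. u i * res_corr b i) = u j * ?g" .
  have d: "0 < 1 - \<delta>" using small by linarith
  have "(1 - \<delta>) * (u j)\<^sup>2 \<le> (1 - \<delta>) * (\<Sum>i<p. (u i)\<^sup>2)"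
    using d j member_le_sum[of j "{..<p}" "\<lambda>i. (u i)\<^sup>2"] by (intro mult_left_mono) auto
  also have "\<dots> \<le> (1 - (w + real (card (insert j S)) * \<eta>)) * (\<Sum>i<p. (u i)\<^sup>2)"
    using fin S j \<eta>_nonneg by (intro mult_right_mono sum_nonneg) (auto simp: algebra_simps intro!: mult_left_mono)
  also have "\<dots> \<le> sq_norm n (\<lambda>r. \<Sum>i<p. X r i * u i)"
    using S j by (intro sq_norm_fit_ge u) auto
  finally have "sq_norm n (residual p X y b) - 2 * (u j * ?g) + (1 - \<delta>) * (u j)\<^sup>2 \<le>
      sq_norm n (residual p X y (\<lambda>i. b i + u i))"
    by (simp add: sq_norm_residual_add cross)
  moreover have "- (?g\<^sup>2 / (1 - \<delta>)) \<le> - 2 * (u j * ?g) + (1 - \<delta>) * (u j)\<^sup>2"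
    by (rule complete_square[OF d])
  ultimately show "sq_norm n (residual p X y b) - ?g\<^sup>2 / (1 - \<delta>) \<le>
      sq_norm n (\<lambda>i. y i - (\<Sum>j\<in>insert j S. X i j * b' j))"
    unfolding eq by linarith
qed simp

text \<open>
  The two preceding bounds compare the squared residual correlations of \<open>i\<close> and \<open>j\<close> up to the factor
  \<open>(1 + w) / (1 - \<delta>)\<close>, which is at most \<open>(1 + 2 * \<delta>)\<^sup>2\<close>.
\<close>

lemma forward_step_picks_strong:
  assumes S: "S \<subseteq> {..<p}" "card S \<le> m" and i: "i \<in> {..<p} - S" and j: "j \<in> {..<p} - S"
    and le: "rss n X y (insert j S) \<le> rss n X y (insert i S)"
  shows "corr i \<le> corr j + slack"
proof -
  obtain b where min: "is_arg_min (lasso_objective n p X y 0) (vanishes_off S) b"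
    using restricted_minimizer_exists[OF S(1)] S(2) by fastforce
  have b: "vanishes_off S b" using min by (auto simp: is_arg_min_linorder)
  note l1 = least_squares_l1_norm[OF S min]
  let ?gi = "\<bar>res_corr b i\<bar>" and ?gj = "\<bar>res_corr b j\<bar>"
  have "0 \<le> (real m + 1) * \<eta>" using \<eta>_nonneg by simp
  then have d: "0 < \<delta>" "\<delta> \<le> 1 / 2" "w \<le> \<delta>" using small w_pos by linarith+
  have pos: "0 \<le> 1 + 2 * \<delta>"
    using d(1) by (intro add_nonneg_nonneg mult_nonneg_nonneg less_imp_le) simp_all
  have "(res_corr b i)\<^sup>2 / (1 + w) \<le> (res_corr b j)\<^sup>2 / (1 - \<delta>)"
    using rss_insert_le[OF S(1) b, of i] rss_insert_ge[OF S _ _ min, of j] i j le by auto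
  then have "?gi\<^sup>2 \<le> (1 + w) / (1 - \<delta>) * ?gj\<^sup>2"
    using d w_pos by (simp add: field_simps)
  also have "\<dots> \<le> (1 + 2 * \<delta>)\<^sup>2 * ?gj\<^sup>2"
  proof (rule mult_right_mono)
    have "\<delta> * (\<delta> * \<delta>) \<le> 1 / 2 * (1 / 2 * \<delta>)"
      using d by (intro mult_mono) auto
    then have "1 + \<delta> \<le> (1 + 2 * \<delta>)\<^sup>2 * (1 - \<delta>)"
      using d by (simp add: power2_eq_square algebra_simps)
    with d show "(1 + w) / (1 - \<delta>) \<le> (1 + 2 * \<delta>)\<^sup>2" by (simp add: pos_divide_le_eq)
  qed simp
  finally have "?gi\<^sup>2 \<le> ((1 + 2 * \<delta>) * ?gj)\<^sup>2" by (simp only: power_mult_distrib)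
  then have "?gi \<le> (1 + 2 * \<delta>) * ?gj"
    by (rule power2_le_imp_le) (rule mult_nonneg_nonneg[OF pos abs_ge_zero])
  moreover have "corr i \<le> ?gi + tiny" "?gj \<le> corr j + tiny"
    using res_corr_inactive[OF _ l1] b i j by (auto simp: vanishes_off_def)
  moreover have "2 * \<delta> * ?gj \<le> 2 * \<delta> * (2 * Q)"
    using \<open>?gj \<le> corr j + tiny\<close> corr_le[of j] tiny_le(2) j d by (intro mult_left_mono) auto
  moreover have "2 * \<delta> * (2 * Q) = slack / 2" by (simp add: slack_def)
  ultimately show ?thesis using tiny_le(1) by (simp add: distrib_right)
qed

lemma fs_selected_Suc:
  assumes "S = fs_selected n p X y r" "{..<p} - S \<noteq> {}"
  obtains j where "j \<in> {..<p} - S" "fs_selected n p X y (Suc r) = insert j S"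
    "\<And>i. i \<in> {..<p} - S \<Longrightarrow> rss n X y (insert j S) \<le> rss n X y (insert i S)"
proof -
  let ?j = "arg_min_on (\<lambda>j. rss n X y (insert j S)) ({..<p} - S)"
  show ?thesis
    using arg_min_if_finite[of "{..<p} - S" "\<lambda>j. rss n X y (insert j S)"] assms
    by (intro that[of ?j]) (auto simp: Let_def not_less)
qed

lemma fs_selected_card:
  "r \<le> p \<Longrightarrow> fs_selected n p X y r \<subseteq> {..<p} \<and> card (fs_selected n p X y r) = r"
proof (induction r)
  case (Suc r)
  let ?S = "fs_selected n p X y r"
  have IH: "?S \<subseteq> {..<p}" "card ?S = r" using Suc by auto
  have ne: "{..<p} - ?S \<noteq> {}"
  proof
    assume "{..<p} - ?S = {}"
    then have "?S = {..<p}" using IH by auto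
    then have "card ?S = p" by simp
    with IH Suc show False by simp
  qed
  obtain j where "j \<in> {..<p} - ?S" "fs_selected n p X y (Suc r) = insert j ?S"
    using fs_selected_Suc[OF refl ne] by metis
  with IH finite_subset[OF IH(1)] show ?case by auto
qed simp

theorem tracks_forward_stepwise: "tracks (fs_selected n p X y ` {..p})"
proof (rule tracks_greedy[where S = "\<lambda>r. fs_selected n p X y (min r p)"])
  show "fs_selected n p X y (min r p) \<subseteq> {..<p}" for r using fs_selected_card by simp
  have full: "fs_selected n p X y p = {..<p}"
    using fs_selected_card[of p] by (simp add: card_subset_eq)
  show "fs_selected n p X y (min r p) \<subseteq> fs_selected n p X y (min (Suc r) p)" for r
    by (cases "r < p") (auto simp: min_def Let_def)
  fix r assume le: "card (fs_selected n p X y (min r p)) \<le> m"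
  show "(\<exists>j\<in>{..<p} - fs_selected n p X y (min r p).
        fs_selected n p X y (min (Suc r) p) = insert j (fs_selected n p X y (min r p)) \<and>
        (\<forall>i\<in>{..<p} - fs_selected n p X y (min r p). corr i \<le> corr j + slack)) \<or>
      (\<forall>i\<in>{..<p} - fs_selected n p X y (min r p). corr i \<le> slack)"
  proof (cases "r < p")
    case True
    let ?S = "fs_selected n p X y r"
    have S: "?S \<subseteq> {..<p}" "card ?S = r" using fs_selected_card[of r] True by auto
    have ne: "{..<p} - ?S \<noteq> {}"
    proof
      assume "{..<p} - ?S = {}"
      then have "?S = {..<p}" using S by auto
      then have "card ?S = p" by simp
      with S True show False by simp
    qed
    obtain j where j: "j \<in> {..<p} - ?S" "fs_selected n p X y (Suc r) = insert j ?S"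
        "\<And>i. i \<in> {..<p} - ?S \<Longrightarrow> rss n X y (insert j ?S) \<le> rss n X y (insert i ?S)"
      using fs_selected_Suc[OF refl ne] by metis
    have "\<forall>i\<in>{..<p} - ?S. corr i \<le> corr j + slack"
      using le True by (intro ballI forward_step_picks_strong[OF S(1) _ _ j(1) j(3)]) auto
    with j(1,2) have "\<exists>j\<in>{..<p} - ?S. fs_selected n p X y (Suc r) = insert j ?S \<and>
        (\<forall>i\<in>{..<p} - ?S. corr i \<le> corr j + slack)" by blast
    with True show ?thesis by (simp add: min_def del: fs_selected.simps)
  next
    case False
    then show ?thesis using full by (simp add: min_def)
  qed
next
  have "range (\<lambda>r. min r p) = {..p}" by (auto simp: image_iff) (metis min.absorb1)
  moreover have "{} \<in> fs_selected n p X y ` {..p}" by (force simp: image_iff intro: bexI[of _ 0])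
  ultimately show "insert {} (fs_selected n p X y ` {..p}) = range (\<lambda>r. fs_selected n p X y (min r p))"
    by (metis image_image insert_absorb)
qed simp


subsection \<open>Lasso\<close>

text \<open>
  A primal-dual witness argument. The minimizer on \<open>A\<close> satisfies the optimality conditions of the full
  problem, with strict inequality off \<open>A\<close>. By convexity it is a global minimizer, and any other global
  minimizer must vanish where the inequality is strict. This is valid also when \<open>p > n\<close> and the
  minimizer may fail to be unique.
\<close>

lemma lasso_minimizer_support:
  assumes A: "A \<subseteq> {..<p}" "card A \<le> m" and lam: "lam \<ge> 0"
    and strict: "\<And>i. i \<in> {..<p} - A \<Longrightarrow> corr i + tiny < lam"
  shows "\<exists>b. is_arg_min (lasso_objective n p X y lam) (vanishes_off {..<p}) b"
    and "is_arg_min (lasso_objective n p X y lam) (vanishes_off {..<p}) b' \<Longrightarrow> vanishes_off A b'"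
proof -
  let ?f = "lasso_objective n p X y lam"
  obtain b where min: "is_arg_min ?f (vanishes_off A) b"
    using restricted_minimizer_exists[OF A(1) _ lam] A(2) by fastforce
  have b: "vanishes_off A b" using min by (simp add: is_arg_min_linorder)
  note kkt = restricted_minimizer_kkt[OF A(1) lam min]
  have l1: "(\<Sum>j<p. \<bar>b j\<bar>) \<le> 2 * real m * Q"
    using kkt(2) lam by (intro l1_norm_le[OF A b]) simp
  have off: "\<bar>res_corr b i\<bar> < lam" if "i \<in> {..<p} - A" for i
    using res_corr_inactive(2)[OF _ l1, of i] strict[OF that] that b by (simp add: vanishes_off_def)
  have gap: "?f b + (\<Sum>j<p. lam * \<bar>c j\<bar> - res_corr b j * c j) \<le> ?f c" for c
  proof -
    define d where "d j = c j - b j" for j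
    have c: "c = (\<lambda>j. b j + d j)" by (simp add: d_def fun_eq_iff)
    have bb: "(\<Sum>j<p. res_corr b j * b j) = (\<Sum>j<p. lam * \<bar>b j\<bar>)"
      using kkt(2) b by (intro sum.cong refl) (metis abs_0 mult_zero_right vanishes_off_def)
    have "(\<Sum>j<p. d j * res_corr b j) = (\<Sum>j<p. res_corr b j * c j) - (\<Sum>j<p. lam * \<bar>b j\<bar>)"
      unfolding bb[symmetric] sum_subtractf[symmetric] by (intro sum.cong refl) (simp add: d_def algebra_simps)
    moreover have "sq_norm n (residual p X y c) = sq_norm n (residual p X y b)
        - 2 * (\<Sum>j<p. d j * res_corr b j) + sq_norm n (\<lambda>r. \<Sum>i<p. X r i * d i)"
      unfolding c by (rule sq_norm_residual_add)
    moreover have "sq_norm n (\<lambda>r. \<Sum>i<p. X r i * d i) \<ge> 0" by (simp add: sq_norm_def sum_nonneg)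
    moreover have "lam * (\<Sum>j<p. \<bar>e j\<bar>) = (\<Sum>j<p. lam * \<bar>e j\<bar>)" for e :: "nat \<Rightarrow> real"
      by (rule sum_distrib_left)
    ultimately show ?thesis
      unfolding lasso_objective_def sum_subtractf by (simp only:) argo
  qed
  have term_nonneg: "0 \<le> lam * \<bar>c j\<bar> - res_corr b j * c j" if "j < p" for c :: "nat \<Rightarrow> real" and j
  proof -
    have "\<bar>res_corr b j\<bar> \<le> lam" using kkt(1)[of j] off[of j] that by (cases "j \<in> A") auto
    then have "\<bar>res_corr b j * c j\<bar> \<le> lam * \<bar>c j\<bar>"
      unfolding abs_mult by (rule mult_right_mono) simp
    then show ?thesis by simp
  qed
  have opt: "?f b \<le> ?f c" for c
  proof -
    have "0 \<le> (\<Sum>j<p. lam * \<bar>c j\<bar> - res_corr b j * c j)"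
      by (intro sum_nonneg term_nonneg) simp
    with gap[of c] show ?thesis by linarith
  qed
  have offp: "vanishes_off {..<p} b" using b A by (auto simp: vanishes_off_def)
  with opt show "\<exists>b. is_arg_min ?f (vanishes_off {..<p}) b"
    by (intro exI[of _ b]) (simp add: is_arg_min_linorder)
  assume min': "is_arg_min ?f (vanishes_off {..<p}) b'"
  then have le: "?f b' \<le> ?f b" using offp by (simp add: is_arg_min_linorder)
  show "vanishes_off A b'"
    unfolding vanishes_off_def
  proof (intro allI impI)
    fix j assume j: "j \<notin> A"
    show "b' j = 0"
    proof (cases "j < p")
      case True
      have "lam * \<bar>b' j\<bar> - res_corr b j * b' j \<le> (\<Sum>j<p. lam * \<bar>b' j\<bar> - res_corr b j * b' j)"
        using True by (intro member_le_sum term_nonneg) auto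
      with gap[of b'] le have "lam * \<bar>b' j\<bar> \<le> res_corr b j * b' j" by linarith
      also have "\<dots> \<le> \<bar>res_corr b j\<bar> * \<bar>b' j\<bar>" by (simp flip: abs_mult)
      finally have "(lam - \<bar>res_corr b j\<bar>) * \<bar>b' j\<bar> \<le> 0" by (simp add: left_diff_distrib)
      with off[of j] j True show ?thesis by (simp add: mult_le_0_iff)
    next
      case False
      with min' show ?thesis by (simp add: is_arg_min_linorder vanishes_off_def)
    qed
  qed
qed

lemma lasso_path_minimizes:
  assumes "\<exists>b. is_arg_min (lasso_objective n p X y lam) (vanishes_off {..<p}) b"
  shows "is_arg_min (lasso_objective n p X y lam) (vanishes_off {..<p}) (lasso_path n p X y lam)"
proof -
  have eq: "(\<lambda>b::nat \<Rightarrow> real. \<forall>j\<ge>p. b j = 0) = vanishes_off {..<p}"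
    by (auto simp: vanishes_off_def fun_eq_iff)
  show ?thesis
    unfolding lasso_path_def arg_min_def eq by (rule someI_ex[OF assms])
qed

text \<open>
  At the penalty \<open>\<tau> + tiny\<close>, variables with correlation below \<open>\<tau>\<close> are still inactive, and variables with
  correlation above \<open>\<tau> + 2 * tiny\<close> can no longer be inactive.
\<close>

lemma lasso_selected_bounds:
  assumes \<tau>: "\<tau> > 0" "card (strong \<tau>) \<le> m"
  shows "lasso_selected n p X y (\<tau> + tiny) \<subseteq> strong \<tau>"
    "strong (\<tau> + slack) \<subseteq> lasso_selected n p X y (\<tau> + tiny)"
proof -
  have sub: "strong \<tau> \<subseteq> {..<p}" by (auto simp: strong_def)
  have strict: "corr i + tiny < lam" if "\<tau> + tiny \<le> lam" "i \<in> {..<p} - strong \<tau>" for i lam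
    using that by (auto simp: strong_def)
  have min: "is_arg_min (lasso_objective n p X y lam) (vanishes_off {..<p}) (lasso_path n p X y lam)"
    and supp: "vanishes_off (strong \<tau>) (lasso_path n p X y lam)" if "\<tau> + tiny \<le> lam" for lam
  proof -
    have "lam \<ge> 0" using that \<tau>(1) tiny_nonneg by linarith
    note support = lasso_minimizer_support[OF sub \<tau>(2) this strict[OF that]]
    show min: "is_arg_min (lasso_objective n p X y lam) (vanishes_off {..<p}) (lasso_path n p X y lam)"
      by (rule lasso_path_minimizes) (rule support(1))
    show "vanishes_off (strong \<tau>) (lasso_path n p X y lam)"
      by (rule support(2)) (assumption, rule min)
  qed
  show "lasso_selected n p X y (\<tau> + tiny) \<subseteq> strong \<tau>"
    using supp unfolding lasso_selected_def vanishes_off_def by blast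
  let ?lam = "\<tau> + tiny" let ?b = "lasso_path n p X y ?lam"
  have lam: "?lam \<ge> 0" using \<tau>(1) tiny_nonneg by linarith
  note kkt = restricted_minimizer_kkt[OF order_refl lam min[OF order_refl]]
  have l1: "(\<Sum>j<p. \<bar>?b j\<bar>) \<le> 2 * real m * Q"
    using kkt(2) sub lam by (intro l1_norm_le[OF sub \<tau>(2) supp]) auto
  show "strong (\<tau> + slack) \<subseteq> lasso_selected n p X y ?lam"
  proof
    fix j assume j: "j \<in> strong (\<tau> + slack)"
    then have jp: "j < p" by (simp add: strong_def)
    have "?b j \<noteq> 0"
    proof
      assume "?b j = 0"
      then have "corr j \<le> ?lam + tiny"
        using res_corr_inactive(1)[OF jp l1] kkt(1)[of j] jp by simp
      with j tiny_le(1) tiny_nonneg show False by (simp add: strong_def)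
    qed
    with jp show "j \<in> lasso_selected n p X y ?lam" by (auto simp: lasso_selected_def)
  qed
qed

theorem tracks_lasso: "tracks (lasso_selected n p X y ` {0<..})"
  unfolding tracks_def
proof (intro conjI ballI allI impI)
  fix S assume "S \<in> lasso_selected n p X y ` {0<..}"
  then show "S \<subseteq> {..<p}" by (auto simp: lasso_selected_def)
next
  fix S S' assume "S \<in> lasso_selected n p X y ` {0<..}" "S' \<in> lasso_selected n p X y ` {0<..}"
  then obtain lam lam' where *: "S = lasso_selected n p X y lam" "S' = lasso_selected n p X y lam'"
    by auto
  show "S \<subseteq> S' \<or> S' \<subseteq> S"
    unfolding * lasso_selected_def using linear[of lam lam'] by (auto intro: order_trans)
next
  fix \<tau> :: real assume \<tau>: "\<tau> > 0" "card (strong \<tau>) \<le> m"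
  have "\<tau> + tiny \<in> {0<..}" using \<tau>(1) tiny_nonneg by simp
  then show "\<exists>S\<in>insert {} (lasso_selected n p X y ` {0<..}). strong (\<tau> + slack) \<subseteq> S \<and> S \<subseteq> strong \<tau>"
    using lasso_selected_bounds[OF \<tau>] by blast
qed

subsection \<open>Least angle regression\<close>

text \<open>
  The vector \<open>b + d\<close> is the least-squares fit of \<open>y\<close> itself on the columns in \<open>A\<close>, so its size is
  bounded independently of \<open>b\<close>.
\<close>

lemma ls_direction_normal_equations:
  assumes A: "A \<subseteq> {..<p}" "card A \<le> m" and b: "vanishes_off A b"
  defines "d \<equiv> ls_direction n p X (residual p X y b) A"
  shows "vanishes_off A d" "(\<Sum>j<p. \<bar>b j + d j\<bar>) \<le> 2 * real m * Q"
proof -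
  let ?r = "residual p X y b"
  have eq: "(\<lambda>d::nat \<Rightarrow> real. \<forall>j. j \<notin> A \<longrightarrow> d j = 0) = vanishes_off A"
    by (auto simp: vanishes_off_def fun_eq_iff)
  have iff: "is_arg_min (\<lambda>d. sq_norm n (residual p X ?r d)) (vanishes_off A) e \<longleftrightarrow>
      is_arg_min (lasso_objective n p X ?r 0) (vanishes_off A) e" for e
    by (simp add: is_arg_min_linorder lasso_objective_def)
  have "\<exists>e. is_arg_min (\<lambda>d. sq_norm n (residual p X ?r d)) (vanishes_off A) e"
    unfolding iff using restricted_minimizer_exists[OF A(1), of 0 ?r] A(2) by simp
  then have "is_arg_min (\<lambda>d. sq_norm n (residual p X ?r d)) (vanishes_off A) d"
    unfolding d_def ls_direction_def arg_min_def eq by (rule someI_ex)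
  then have min: "is_arg_min (lasso_objective n p X ?r 0) (vanishes_off A) d"
    unfolding iff .
  then show d: "vanishes_off A d" by (simp add: is_arg_min_linorder)
  have "res_corr (\<lambda>j. b j + d j) j = 0" if "j \<in> A" for j
    using restricted_minimizer_kkt(1)[OF A(1) _ min that] by (simp add: residual_residual)
  then show "(\<Sum>j<p. \<bar>b j + d j\<bar>) \<le> 2 * real m * Q"
    using b d by (intro l1_norm_le[OF A]) (simp_all add: vanishes_off_def)
qed

text \<open>
  The step length lies in \<open>[0, 1]\<close>, so the new coefficients are a convex combination of the old ones and
  of a least-squares fit, and the bound on the \<open>\<ell>\<^sub>1\<close> norm persists.
\<close>

lemma lar_step_cases:
  assumes A: "A \<subseteq> {..<p}" "card A \<le> m" and b: "vanishes_off A b" "(\<Sum>j<p. \<bar>b j\<bar>) \<le> 2 * real m * Q"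
    and step: "lar_step n p X y (A, b) = (A', b')"
  shows "vanishes_off A b'" "(\<Sum>j<p. \<bar>b' j\<bar>) \<le> 2 * real m * Q"
    "(A' = A \<and> (A = {..<p} \<or> (\<forall>i<n. residual p X y b' i = 0))) \<or>
     (\<exists>j\<in>{..<p} - A. A' = insert j A \<and> (\<forall>i\<in>{..<p} - A. \<bar>res_corr b' i\<bar> \<le> \<bar>res_corr b' j\<bar>))"
proof -
  define d where "d = ls_direction n p X (residual p X y b) A"
  define move where "move t j = b j + t * d j" for t j
  define times where "times = {t \<in> {0..1}. t = 1 \<or> (\<exists>j \<in> {..<p} - A. \<forall>i\<in>A.
     \<bar>res_corr (move t) i\<bar> \<le> \<bar>res_corr (move t) j\<bar>)}"
  define t where "t = Inf times"
  have t1: "1 \<in> times" and t01: "times \<subseteq> {0..1}" by (auto simp: times_def)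
  have t: "0 \<le> t" "t \<le> 1"
    unfolding t_def using t1 t01
    by (auto intro!: cInf_greatest cInf_lower bdd_belowI[of _ 0])
  have step': "(A', b') = (if A = {..<p} \<or> (\<forall>i<n. residual p X y (move t) i = 0) then (A, move t)
      else (insert (arg_max_on (\<lambda>j. \<bar>res_corr (move t) j\<bar>) ({..<p} - A)) A, move t))"
    unfolding step[symmetric] lar_step_def Let_def prod.case t_def times_def move_def d_def by simp
  then have b': "b' = move t" by (auto split: if_splits)
  note d = ls_direction_normal_equations[OF A b(1), folded d_def]
  show "vanishes_off A b'" using b d(1) by (simp add: b' move_def vanishes_off_def)
  have "(\<Sum>j<p. \<bar>b' j\<bar>) \<le> (\<Sum>j<p. (1 - t) * \<bar>b j\<bar> + t * \<bar>b j + d j\<bar>)"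
  proof (rule sum_mono)
    fix j
    have "b' j = (1 - t) * b j + t * (b j + d j)" by (simp add: b' move_def algebra_simps)
    then have "\<bar>b' j\<bar> \<le> \<bar>(1 - t) * b j\<bar> + \<bar>t * (b j + d j)\<bar>" by (simp only: abs_triangle_ineq)
    then show "\<bar>b' j\<bar> \<le> (1 - t) * \<bar>b j\<bar> + t * \<bar>b j + d j\<bar>" using t by (simp add: abs_mult)
  qed
  also have "\<dots> = (1 - t) * (\<Sum>j<p. \<bar>b j\<bar>) + t * (\<Sum>j<p. \<bar>b j + d j\<bar>)"
    by (simp add: sum.distrib sum_distrib_left)
  also have "\<dots> \<le> (1 - t) * (2 * real m * Q) + t * (2 * real m * Q)"
    using t by (intro add_mono mult_left_mono b d) auto
  also have "\<dots> = 2 * real m * Q" by (simp add: algebra_simps)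
  finally show "(\<Sum>j<p. \<bar>b' j\<bar>) \<le> 2 * real m * Q" .
  let ?c = "\<lambda>j. \<bar>res_corr b' j\<bar>"
  show "(A' = A \<and> (A = {..<p} \<or> (\<forall>i<n. residual p X y b' i = 0))) \<or>
     (\<exists>j\<in>{..<p} - A. A' = insert j A \<and> (\<forall>i\<in>{..<p} - A. ?c i \<le> ?c j))"
  proof (cases "A = {..<p} \<or> (\<forall>i<n. residual p X y b' i = 0)")
    case True
    then show ?thesis using step' b' by simp
  next
    case False
    then have "A' = insert (arg_max_on ?c ({..<p} - A)) A"
      using step' b' by (auto split: if_splits)
    moreover have "{..<p} - A \<noteq> {}" using False A by auto
    ultimately show ?thesis using arg_max_on_finite[where S = "{..<p} - A" and f = ?c] by blast
  qed
qed

lemma lar_state_Suc: "lar_state n p X y (Suc r) = lar_step n p X y (lar_state n p X y r)"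
  by (simp add: lar_state_def)

lemma lar_step_increasing:
  "fst s \<subseteq> fst (lar_step n p X y s)"
  by (cases s) (auto simp: lar_step_def Let_def)

lemma lar_step_subset:
  assumes "A \<subseteq> {..<p}"
  shows "fst (lar_step n p X y (A, b)) \<subseteq> {..<p}"
  using assms arg_max_on_finite(1)[of "{..<p} - A"]
  unfolding lar_step_def Let_def by (auto split: if_splits)

lemma lar_state_bounds:
  assumes p: "p > 0"
  shows "fst (lar_state n p X y r) \<subseteq> {..<p} \<and>
    (card (fst (lar_state n p X y r)) \<le> m \<longrightarrow> vanishes_off (fst (lar_state n p X y r)) (snd (lar_state n p X y r)) \<and>
      (\<Sum>j<p. \<bar>snd (lar_state n p X y r) j\<bar>) \<le> 2 * real m * Q)"
proof (induction r)
  case 0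
  have "arg_max_on corr {..<p} \<in> {..<p}" using p by (intro arg_max_on_finite) auto
  then show ?case using Q_pos by (simp add: lar_state_def vanishes_off_def)
next
  case (Suc r)
  obtain A b where st: "lar_state n p X y r = (A, b)" by fastforce
  obtain A' b' where st': "lar_step n p X y (A, b) = (A', b')" by fastforce
  have A: "A \<subseteq> {..<p}" using Suc st by simp
  have sub: "A' \<subseteq> {..<p}" "A \<subseteq> A'"
    using lar_step_subset[OF A, of b] lar_step_increasing[of "(A, b)"] st' by auto
  have "vanishes_off A' b' \<and> (\<Sum>j<p. \<bar>b' j\<bar>) \<le> 2 * real m * Q" if "card A' \<le> m"
  proof -
    have "card A \<le> m" using card_mono[OF finite_subset[OF sub(1) finite_lessThan] sub(2)] that by simp
    with Suc st have "vanishes_off A b" "(\<Sum>j<p. \<bar>b j\<bar>) \<le> 2 * real m * Q" by auto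
    from lar_step_cases(1,2)[OF A \<open>card A \<le> m\<close> this st'] sub(2)
    show ?thesis by (auto simp: vanishes_off_def)
  qed
  with sub(1) show ?case by (simp add: lar_state_Suc st st')
qed

theorem tracks_lar:
  assumes p: "p > 0"
  shows "tracks (range (\<lambda>r. fst (lar_state n p X y r)))"
proof (rule tracks_greedy[where S = "\<lambda>r. case r of 0 \<Rightarrow> {} | Suc r \<Rightarrow> fst (lar_state n p X y r)"])
  let ?S = "\<lambda>r. case r of 0 \<Rightarrow> {} | Suc r \<Rightarrow> fst (lar_state n p X y r)"
  show "?S r \<subseteq> {..<p}" for r using lar_state_bounds[OF p] by (cases r) auto
  show "?S r \<subseteq> ?S (Suc r)" for r
    by (cases r) (simp_all add: lar_state_Suc lar_step_increasing)
  show "insert {} (range (\<lambda>r. fst (lar_state n p X y r))) = range ?S"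
    by (subst UNIV_nat_eq) (simp add: image_image)
  fix r assume card: "card (?S r) \<le> m"
  show "(\<exists>j\<in>{..<p} - ?S r. ?S (Suc r) = insert j (?S r) \<and> (\<forall>i\<in>{..<p} - ?S r. corr i \<le> corr j + slack)) \<or>
      (\<forall>i\<in>{..<p} - ?S r. corr i \<le> slack)"
  proof (cases r)
    case 0
    have slack: "slack \<ge> 0" using tiny_le(1) tiny_nonneg by linarith
    have "arg_max_on corr {..<p} \<in> {..<p}" "\<And>i. i < p \<Longrightarrow> corr i \<le> corr (arg_max_on corr {..<p})"
      using arg_max_on_finite[where S = "{..<p}" and f = corr] p by auto
    with slack show ?thesis
      by (intro disjI1 bexI[of _ "arg_max_on corr {..<p}"]) (auto simp: 0 lar_state_def intro: add_increasing2)
  next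
    case (Suc q)
    obtain A b where st: "lar_state n p X y q = (A, b)" by fastforce
    obtain A' b' where st': "lar_step n p X y (A, b) = (A', b')" by fastforce
    have S: "?S r = A" "?S (Suc r) = A'" by (simp_all add: Suc lar_state_Suc st st')
    have A: "A \<subseteq> {..<p}" "card A \<le> m" "vanishes_off A b" "(\<Sum>j<p. \<bar>b j\<bar>) \<le> 2 * real m * Q"
      using lar_state_bounds[OF p, of q] card S(1) st by auto
    note step = lar_step_cases[OF A st']
    have inact: "corr i \<le> \<bar>res_corr b' i\<bar> + tiny" "\<bar>res_corr b' i\<bar> \<le> corr i + tiny" if "i \<in> {..<p} - A" for i
      using res_corr_inactive[OF _ step(2), of i] step(1) that by (auto simp: vanishes_off_def)
    show ?thesis using step(3)
    proof (elim disjE)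
      assume *: "A' = A \<and> (A = {..<p} \<or> (\<forall>i<n. residual p X y b' i = 0))"
      have "corr i \<le> slack" if i: "i \<in> {..<p} - A" for i
      proof -
        have "\<forall>i<n. residual p X y b' i = 0" using * i by auto
        then have "res_corr b' i = 0" by (simp add: col_inner_def)
        with inact(1)[OF i] tiny_le(1) tiny_nonneg show ?thesis by simp
      qed
      then show ?thesis unfolding S by blast
    next
      assume "\<exists>j\<in>{..<p} - A. A' = insert j A \<and> (\<forall>i\<in>{..<p} - A. \<bar>res_corr b' i\<bar> \<le> \<bar>res_corr b' j\<bar>)"
      then obtain j where j: "j \<in> {..<p} - A" "A' = insert j A"
          "\<And>i. i \<in> {..<p} - A \<Longrightarrow> \<bar>res_corr b' i\<bar> \<le> \<bar>res_corr b' j\<bar>" by blast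
      have "corr i \<le> corr j + slack" if "i \<in> {..<p} - A" for i
        using inact(1)[OF that] inact(2)[OF j(1)] j(3)[OF that] tiny_le(1) tiny_nonneg by linarith
      with j show ?thesis unfolding S by blast
    qed
  qed
qed simp

end

section \<open>Sums of independent normal variables\<close>

lemma normal_rv_measurable: "normal_rv P Z s \<Longrightarrow> Z \<in> borel_measurable P"
  by (auto simp: normal_rv_def distributed_def split: if_splits)

lemma normal_rv_cong_AE:
  assumes Z: "normal_rv P Z s" and Z': "Z' \<in> borel_measurable P" and eq: "AE \<omega> in P. Z' \<omega> = Z \<omega>"
  shows "normal_rv P Z' s"
proof (cases "s = 0")
  case True
  then show ?thesis using assms by (auto simp: normal_rv_def)
next
  case False
  then have d: "distributed P lborel Z (normal_density 0 s)" using Z by (simp add: normal_rv_def)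
  have "distr P lborel Z' = distr P lborel Z"
    using eq Z' d by (intro distr_cong_AE) (auto simp: distributed_def)
  then show ?thesis using False d Z' by (auto simp: normal_rv_def distributed_def)
qed

context prob_space
begin

lemma normal_rv_scale:
  assumes Z: "normal_rv M Z s" and s: "s \<ge> 0"
  shows "normal_rv M (\<lambda>\<omega>. c * Z \<omega>) (\<bar>c\<bar> * s)"
proof (cases "s = 0 \<or> c = 0")
  case True
  then show ?thesis using Z normal_rv_measurable[OF Z]
    by (auto simp: normal_rv_def split: if_splits)
next
  case False
  then show ?thesis
    using normal_density_affine[of Z 0 s c 0] Z s by (auto simp: normal_rv_def)
qed

text \<open>
  Summands of variance zero vanish almost surely, so the sum is almost surely equal to the sum of the
  non-degenerate ones.
\<close>

lemma normal_rv_sum: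
  assumes I: "finite I" and ind: "indep_vars (\<lambda>_. borel) Z I"
    and Z: "\<And>i. i \<in> I \<Longrightarrow> normal_rv M (Z i) (s i)" and s: "\<And>i. i \<in> I \<Longrightarrow> s i \<ge> 0"
  shows "normal_rv M (\<lambda>\<omega>. \<Sum>i\<in>I. Z i \<omega>) (sqrt (\<Sum>i\<in>I. (s i)\<^sup>2))"
proof -
  define K where "K = {i\<in>I. s i \<noteq> 0}"
  have K: "K \<subseteq> I" "finite K" using I by (auto simp: K_def)
  have meas: "(\<lambda>\<omega>. \<Sum>i\<in>I. Z i \<omega>) \<in> borel_measurable M"
    using normal_rv_measurable[OF Z] by (intro borel_measurable_sum) auto
  have "AE \<omega> in M. \<forall>i\<in>I - K. Z i \<omega> = 0"
    using I Z by (intro AE_finite_allI) (auto simp: K_def normal_rv_def)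
  then have eq: "AE \<omega> in M. (\<Sum>i\<in>I. Z i \<omega>) = (\<Sum>i\<in>K. Z i \<omega>)"
    by eventually_elim (intro sum.mono_neutral_right I K)
  have var: "(\<Sum>i\<in>I. (s i)\<^sup>2) = (\<Sum>i\<in>K. (s i)\<^sup>2)"
    using I K by (intro sum.mono_neutral_right) (auto simp: K_def)
  have "normal_rv M (\<lambda>\<omega>. \<Sum>i\<in>K. Z i \<omega>) (sqrt (\<Sum>i\<in>K. (s i)\<^sup>2))"
  proof (cases "K = {}")
    case True
    then show ?thesis by (simp add: normal_rv_def)
  next
    case False
    have "distributed M lborel (\<lambda>\<omega>. \<Sum>i\<in>K. Z i \<omega>) (normal_density (\<Sum>i\<in>K. 0) (sqrt (\<Sum>i\<in>K. (s i)\<^sup>2)))"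
    proof (rule sum_indep_normal[OF K(2) False indep_vars_subset[OF ind K(1)]])
      fix i assume i: "i \<in> K"
      then show "0 < s i" using s[of i] by (auto simp: K_def less_le)
      show "distributed M lborel (Z i) (normal_density 0 (s i))"
        using Z[of i] i by (auto simp: K_def normal_rv_def)
    qed
    moreover have "(\<Sum>i\<in>K. (s i)\<^sup>2) > 0"
      using False K by (intro sum_pos) (auto simp: K_def)
    ultimately show ?thesis by (simp add: normal_rv_def)
  qed
  from normal_rv_cong_AE[OF this meas eq] show ?thesis by (simp add: var)
qed

text \<open>
  For \<open>x \<ge> u \<ge> 0\<close> one has \<open>x\<^sup>2 \<ge> u\<^sup>2 + (x - u)\<^sup>2\<close>, so that on the tail the density is at most the claimed
  bound times a normal density centred at \<open>u\<close>.
\<close>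

lemma normal_rv_upper_tail_aux:
  assumes Z: "normal_rv M Z s" and s: "s > 0" and u: "u \<ge> 0"
  shows "prob {\<omega>\<in>space M. u \<le> Z \<omega>} \<le> exp (- (u\<^sup>2 / (2 * s\<^sup>2)))"
proof -
  have d: "distributed M lborel Z (normal_density 0 s)" using Z s by (simp add: normal_rv_def)
  have "emeasure M (Z -` {u..} \<inter> space M) = (\<integral>\<^sup>+x. ennreal (normal_density 0 s x) * indicator {u..} x \<partial>lborel)"
    by (rule distributed_emeasure[OF d]) simp
  also have "\<dots> \<le> (\<integral>\<^sup>+x. ennreal (exp (- (u\<^sup>2 / (2 * s\<^sup>2)))) * ennreal (normal_density u s x) \<partial>lborel)"
  proof (rule nn_integral_mono)
    fix x :: real
    have "normal_density 0 s x \<le> exp (- (u\<^sup>2 / (2 * s\<^sup>2))) * normal_density u s x" if "u \<le> x"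
    proof -
      have "u * u \<le> u * x" using that u by (rule mult_left_mono)
      then have "u\<^sup>2 + (x - u)\<^sup>2 \<le> x\<^sup>2" by (simp add: power2_eq_square algebra_simps)
      then have "(u\<^sup>2 + (x - u)\<^sup>2) / (2 * s\<^sup>2) \<le> x\<^sup>2 / (2 * s\<^sup>2)"
        by (intro divide_right_mono) auto
      then have "exp (- (x\<^sup>2 / (2 * s\<^sup>2))) \<le> exp (- (u\<^sup>2 / (2 * s\<^sup>2)) + - ((x - u)\<^sup>2 / (2 * s\<^sup>2)))"
        by (simp add: add_divide_distrib)
      then show ?thesis
        unfolding normal_density_def exp_add using s by (simp add: divide_right_mono)
    qed
    then show "ennreal (normal_density 0 s x) * indicator {u..} x \<le>
        ennreal (exp (- (u\<^sup>2 / (2 * s\<^sup>2)))) * ennreal (normal_density u s x)"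
      by (auto simp: indicator_def ennreal_mult[symmetric] intro!: ennreal_leI)
  qed
  also have "\<dots> = ennreal (exp (- (u\<^sup>2 / (2 * s\<^sup>2)))) * (\<integral>\<^sup>+x. ennreal (normal_density u s x) \<partial>lborel)"
    by (intro nn_integral_cmult) simp
  also have "(\<integral>\<^sup>+x. ennreal (normal_density u s x) \<partial>lborel) = 1"
    using prob_space.emeasure_space_1[OF prob_space_normal_density[OF s, of u]]
    by (simp add: emeasure_density)
  also have "Z -` {u..} \<inter> space M = {\<omega>\<in>space M. u \<le> Z \<omega>}" by auto
  finally show ?thesis by (simp add: emeasure_eq_measure)
qed

lemma normal_rv_upper_tail:
  assumes Z: "normal_rv M Z s" and s: "0 \<le> s" "s \<le> R" "0 < R" and u: "u \<ge> 0"
  shows "prob {\<omega>\<in>space M. u \<le> \<bar>Z \<omega>\<bar>} \<le> 2 * exp (- (u\<^sup>2 / (2 * R\<^sup>2)))"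
proof (cases "s = 0")
  case True
  then have "AE \<omega> in M. Z \<omega> = 0" using Z by (simp add: normal_rv_def)
  show ?thesis
  proof (cases "u = 0")
    case True
    have "prob {\<omega>\<in>space M. u \<le> \<bar>Z \<omega>\<bar>} \<le> 1" by (rule prob_le_1)
    also have "1 \<le> 2 * exp (- (u\<^sup>2 / (2 * R\<^sup>2)))" using True by simp
    finally show ?thesis .
  next
    case False
    have "prob {\<omega>\<in>space M. u \<le> \<bar>Z \<omega>\<bar>} = 0"
    proof (rule measure_eq_0_null_sets, rule AE_iff_null_sets[THEN iffD2])
      show "{\<omega>\<in>space M. u \<le> \<bar>Z \<omega>\<bar>} \<in> sets M"
        using normal_rv_measurable[OF Z] by measurable
      show "AE \<omega> in M. \<omega> \<notin> {\<omega>\<in>space M. u \<le> \<bar>Z \<omega>\<bar>}"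
        using \<open>AE \<omega> in M. Z \<omega> = 0\<close> by eventually_elim (use False u in auto)
    qed
    then show ?thesis by simp
  qed
next
  case False
  then have pos: "s > 0" using s by simp
  have neg: "normal_rv M (\<lambda>\<omega>. - Z \<omega>) s" using normal_rv_scale[OF Z s(1), of "-1"] by simp
  have [measurable]: "Z \<in> borel_measurable M" by (rule normal_rv_measurable[OF Z])
  have "prob {\<omega>\<in>space M. u \<le> \<bar>Z \<omega>\<bar>} \<le>
      prob ({\<omega>\<in>space M. u \<le> Z \<omega>} \<union> {\<omega>\<in>space M. u \<le> - Z \<omega>})"
    by (intro finite_measure_mono) auto
  also have "\<dots> \<le> prob {\<omega>\<in>space M. u \<le> Z \<omega>} + prob {\<omega>\<in>space M. u \<le> - Z \<omega>}"
    by (intro measure_Un_le) auto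
  also have "\<dots> \<le> exp (- (u\<^sup>2 / (2 * s\<^sup>2))) + exp (- (u\<^sup>2 / (2 * s\<^sup>2)))"
    by (intro add_mono normal_rv_upper_tail_aux[OF Z pos u] normal_rv_upper_tail_aux[OF neg pos u])
  also have "\<dots> \<le> 2 * exp (- (u\<^sup>2 / (2 * R\<^sup>2)))"
    using s pos by (auto intro!: divide_left_mono power_mono)
  finally show ?thesis .
qed

text \<open>
  On \<open>[u, u + \<delta> * s]\<close> the density is at least its value at the right end point. A width \<open>\<delta>\<close> of order
  \<open>R / u\<close> loses only polynomial factors.
\<close>

lemma normal_rv_lower_tail:
  assumes Z: "normal_rv M Z s" and s: "0 < R" "R \<le> s" and u: "u \<ge> 0" and \<delta>: "\<delta> > 0"
  shows "\<delta> / sqrt (2 * pi) * exp (- ((u / R + \<delta>)\<^sup>2 / 2)) \<le> prob {\<omega>\<in>space M. u \<le> Z \<omega>}"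
proof -
  have pos: "s > 0" using s by simp
  have d: "distributed M lborel Z (normal_density 0 s)" using Z pos by (simp add: normal_rv_def)
  let ?c = "exp (- ((u / R + \<delta>)\<^sup>2 / 2)) / (sqrt (2 * pi) * s)"
  have dens: "?c \<le> normal_density 0 s x" if x: "u \<le> x" "x \<le> u + \<delta> * s" for x
  proof -
    have "x / s \<le> u / s + \<delta>" using x pos by (simp add: field_simps)
    also have "u / s \<le> u / R" using s u pos by (intro divide_left_mono) auto
    finally have "(x / s)\<^sup>2 \<le> (u / R + \<delta>)\<^sup>2" using x u pos by (intro power_mono) auto
    then have "exp (- ((u / R + \<delta>)\<^sup>2 / 2)) \<le> exp (- (x\<^sup>2 / (2 * s\<^sup>2)))"
      by (simp add: power_divide)
    then show ?thesis
      unfolding normal_density_def using pos by (simp add: real_sqrt_mult divide_right_mono)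
  qed
  have "ennreal (\<delta> / sqrt (2 * pi) * exp (- ((u / R + \<delta>)\<^sup>2 / 2))) = ennreal ?c * ennreal (\<delta> * s)"
    using pos \<delta> by (simp add: ennreal_mult[symmetric])
  also have "\<dots> = ennreal ?c * emeasure lborel {u..u + \<delta> * s}"
    using pos \<delta> by simp
  also have "\<dots> = (\<integral>\<^sup>+x. ennreal ?c * indicator {u..u + \<delta> * s} x \<partial>lborel)"
    by (simp add: nn_integral_cmult_indicator)
  also have "\<dots> \<le> (\<integral>\<^sup>+x. ennreal (normal_density 0 s x) * indicator {u..} x \<partial>lborel)"
    by (intro nn_integral_mono) (auto simp: indicator_def intro!: ennreal_leI dens)
  also have "\<dots> = emeasure M (Z -` {u..} \<inter> space M)"
    by (rule distributed_emeasure[OF d, symmetric]) simp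
  also have "Z -` {u..} \<inter> space M = {\<omega>\<in>space M. u \<le> Z \<omega>}" by auto
  finally show ?thesis by (simp add: emeasure_eq_measure)
qed

text \<open>
  The product of \<open>exp (\<theta> * x\<^sup>2)\<close> and a centred normal density is a multiple of a centred normal density
  with another variance.
\<close>

lemma normal_rv_exp_square:
  assumes Z: "normal_rv M Z s" and s: "s \<ge> 0" and \<theta>: "2 * \<theta> * s\<^sup>2 < 1"
  shows "(\<integral>\<^sup>+\<omega>. ennreal (exp (\<theta> * (Z \<omega>)\<^sup>2)) \<partial>M) = ennreal (1 / sqrt (1 - 2 * \<theta> * s\<^sup>2))"
proof (cases "s = 0")
  case True
  then have "AE \<omega> in M. Z \<omega> = 0" using Z by (simp add: normal_rv_def)
  then have "(\<integral>\<^sup>+\<omega>. ennreal (exp (\<theta> * (Z \<omega>)\<^sup>2)) \<partial>M) = (\<integral>\<^sup>+\<omega>. 1 \<partial>M)"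
    by (intro nn_integral_cong_AE) auto
  with True show ?thesis by (simp add: emeasure_space_1)
next
  case False
  then have pos: "s > 0" using s by simp
  have d: "distributed M lborel Z (normal_density 0 s)" using Z pos by (simp add: normal_rv_def)
  define c where "c = sqrt (1 - 2 * \<theta> * s\<^sup>2)"
  have c: "c > 0" "c\<^sup>2 = 1 - 2 * \<theta> * s\<^sup>2" using \<theta> by (simp_all add: c_def)
  have "(\<integral>\<^sup>+\<omega>. ennreal (exp (\<theta> * (Z \<omega>)\<^sup>2)) \<partial>M) =
      (\<integral>\<^sup>+x. normal_density 0 s x * ennreal (exp (\<theta> * x\<^sup>2)) \<partial>lborel)"
    by (rule distributed_nn_integral[OF d, symmetric]) simp
  also have "\<dots> = (\<integral>\<^sup>+x. ennreal (1 / c) * ennreal (normal_density 0 (s / c) x) \<partial>lborel)"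
  proof (rule nn_integral_cong)
    fix x :: real
    have "- (x\<^sup>2 / (2 * s\<^sup>2)) + \<theta> * x\<^sup>2 = - (x\<^sup>2 * c\<^sup>2 / (2 * s\<^sup>2))"
      unfolding c(2) using pos by (simp add: field_simps)
    then have "exp (- (x\<^sup>2 / (2 * s\<^sup>2))) * exp (\<theta> * x\<^sup>2) = exp (- (x\<^sup>2 * c\<^sup>2 / (2 * s\<^sup>2)))"
      by (simp only: exp_add[symmetric])
    then have "normal_density 0 s x * exp (\<theta> * x\<^sup>2) = 1 / c * normal_density 0 (s / c) x"
      unfolding normal_density_def using pos c(1)
      by (simp add: real_sqrt_mult real_sqrt_divide power_divide field_simps)
    then show "ennreal (normal_density 0 s x) * ennreal (exp (\<theta> * x\<^sup>2)) =
        ennreal (1 / c) * ennreal (normal_density 0 (s / c) x)"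
      using c(1) pos by (simp add: ennreal_mult[symmetric])
  qed
  also have "\<dots> = ennreal (1 / c) * (\<integral>\<^sup>+x. ennreal (normal_density 0 (s / c) x) \<partial>lborel)"
    by (intro nn_integral_cmult) simp
  also have "(\<integral>\<^sup>+x. ennreal (normal_density 0 (s / c) x) \<partial>lborel) = 1"
    using prob_space.emeasure_space_1[OF prob_space_normal_density[of "s / c" 0]] pos c(1)
    by (simp add: emeasure_density)
  finally show ?thesis by (simp add: c_def)
qed

text \<open>
  The exponential Markov inequality. Both signs of \<open>\<theta>\<close> are used, for upper and for lower deviations.
\<close>

lemma exp_sum_squares_bound:
  assumes ind: "indep_vars (\<lambda>_. borel) V {..<n::nat}"
    and V: "\<And>i. i < n \<Longrightarrow> normal_rv M (V i) t" and t: "t \<ge> 0" "2 * \<theta> * t\<^sup>2 < 1"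
    and e: "1 / sqrt (1 - 2 * \<theta> * t\<^sup>2) \<le> exp e"
  shows "prob {\<omega>\<in>space M. c \<le> \<theta> * (\<Sum>i<n. (V i \<omega>)\<^sup>2)} \<le> exp (real n * e - c)"
proof -
  have [measurable]: "\<And>i. i < n \<Longrightarrow> V i \<in> borel_measurable M" using V normal_rv_measurable by blast
  let ?Y = "\<lambda>\<omega>. \<Prod>i\<in>{..<n}. ennreal (exp (\<theta> * (V i \<omega>)\<^sup>2))"
  have Y: "?Y \<omega> = ennreal (exp (\<theta> * (\<Sum>i<n. (V i \<omega>)\<^sup>2)))" for \<omega>
    by (simp add: prod_ennreal sum_distrib_left exp_sum)
  have "emeasure M {\<omega>\<in>space M. c \<le> \<theta> * (\<Sum>i<n. (V i \<omega>)\<^sup>2)} \<le>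
      emeasure M {\<omega>\<in>space M. 1 \<le> ennreal (exp (- c)) * ?Y \<omega>}"
    unfolding Y by (intro emeasure_mono) (auto simp: ennreal_mult[symmetric] exp_add[symmetric])
  also have "\<dots> \<le> ennreal (exp (- c)) * (\<integral>\<^sup>+\<omega>. ?Y \<omega> * indicator (space M) \<omega> \<partial>M)"
    by (intro nn_integral_Markov_inequality) auto
  also have "(\<integral>\<^sup>+\<omega>. ?Y \<omega> * indicator (space M) \<omega> \<partial>M) = (\<integral>\<^sup>+\<omega>. ?Y \<omega> \<partial>M)"
    by (intro nn_integral_cong) (simp add: indicator_def)
  also have "\<dots> = (\<Prod>i\<in>{..<n}. (\<integral>\<^sup>+\<omega>. ennreal (exp (\<theta> * (V i \<omega>)\<^sup>2)) \<partial>M))"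
    by (intro indep_vars_nn_integral indep_vars_compose2[OF ind]) auto
  also have "\<dots> = (\<Prod>i\<in>{..<n}. ennreal (1 / sqrt (1 - 2 * \<theta> * t\<^sup>2)))"
    using normal_rv_exp_square[OF V t] by (intro prod.cong) auto
  also have "\<dots> \<le> (\<Prod>i\<in>{..<n}. ennreal (exp e))"
    by (intro prod_mono_ennreal ennreal_leI e)
  also have "\<dots> = ennreal (exp (real n * e))"
    by (simp add: ennreal_power exp_of_nat_mult)
  also have "ennreal (exp (- c)) * ennreal (exp (real n * e)) = ennreal (exp (real n * e - c))"
    by (simp add: ennreal_mult[symmetric] exp_add[symmetric])
  finally have "emeasure M {\<omega>\<in>space M. c \<le> \<theta> * (\<Sum>i<n. (V i \<omega>)\<^sup>2)} \<le> ennreal (exp (real n * e - c))"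
    by (simp add: mult_left_mono)
  then show ?thesis by (simp add: emeasure_eq_measure)
qed

lemma sum_squares_upper:
  assumes ind: "indep_vars (\<lambda>_. borel) V {..<n::nat}"
    and V: "\<And>i. i < n \<Longrightarrow> normal_rv M (V i) t" and t: "0 \<le> t" "t \<le> R" "R > 0" and w: "0 < w" "w \<le> 1"
  shows "prob {\<omega>\<in>space M. (1 + w) * (real n * R\<^sup>2) \<le> (\<Sum>i<n. (V i \<omega>)\<^sup>2)} \<le> exp (- (real n * w\<^sup>2 / 16))"
proof -
  \<comment> \<open>with this \<open>\<theta>\<close> the linear terms \<open>w / 8\<close> cancel, and half of the quadratic gain is left\<close>
  let ?\<theta> = "w / (8 * R\<^sup>2)" let ?e = "w / 8 + w\<^sup>2 / 16"
  have "t\<^sup>2 \<le> R\<^sup>2" using t by (intro power_mono) auto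
  then have x: "2 * ?\<theta> * t\<^sup>2 \<le> w / 4"
    using t w by (simp add: field_simps)
  have x1: "2 * ?\<theta> * t\<^sup>2 < 1" using x w by linarith
  have "- (w / 4) - 2 * (w / 4)\<^sup>2 \<le> ln (1 - w / 4)"
    using w by (intro ln_one_minus_pos_lower_bound) auto
  also have "\<dots> \<le> ln (1 - 2 * ?\<theta> * t\<^sup>2)" using x w by (intro ln_mono) linarith+
  finally have "- 2 * ?e \<le> ln (1 - 2 * ?\<theta> * t\<^sup>2)" by (simp add: power2_eq_square)
  then have "exp (- 2 * ?e) \<le> 1 - 2 * ?\<theta> * t\<^sup>2" using x1 by (subst (asm) ln_ge_iff) auto
  then have "(exp (- ?e))\<^sup>2 \<le> 1 - 2 * ?\<theta> * t\<^sup>2" by (simp add: exp_double[symmetric])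
  then have "exp (- ?e) \<le> sqrt (1 - 2 * ?\<theta> * t\<^sup>2)" by (rule real_le_rsqrt)
  then have "1 / sqrt (1 - 2 * ?\<theta> * t\<^sup>2) \<le> 1 / exp (- ?e)"
    using x1 by (intro divide_left_mono mult_pos_pos) auto
  then have e: "1 / sqrt (1 - 2 * ?\<theta> * t\<^sup>2) \<le> exp ?e" by (simp add: exp_minus field_simps)
  have [measurable]: "\<And>i. i < n \<Longrightarrow> V i \<in> borel_measurable M" using V normal_rv_measurable by blast
  have "prob {\<omega>\<in>space M. (1 + w) * (real n * R\<^sup>2) \<le> (\<Sum>i<n. (V i \<omega>)\<^sup>2)} \<le>
      prob {\<omega>\<in>space M. w / 8 * (1 + w) * real n \<le> ?\<theta> * (\<Sum>i<n. (V i \<omega>)\<^sup>2)}"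
  proof (intro finite_measure_mono subsetI)
    fix \<omega> assume \<omega>: "\<omega> \<in> {\<omega>\<in>space M. (1 + w) * (real n * R\<^sup>2) \<le> (\<Sum>i<n. (V i \<omega>)\<^sup>2)}"
    have "w / 8 * (1 + w) * real n = ?\<theta> * ((1 + w) * (real n * R\<^sup>2))" using t by simp
    also have "\<dots> \<le> ?\<theta> * (\<Sum>i<n. (V i \<omega>)\<^sup>2)"
      using w \<omega> by (intro mult_left_mono) auto
    finally show "\<omega> \<in> {\<omega>\<in>space M. w / 8 * (1 + w) * real n \<le> ?\<theta> * (\<Sum>i<n. (V i \<omega>)\<^sup>2)}"
      using \<omega> by simp
  qed measurable
  also have "\<dots> \<le> exp (real n * ?e - w / 8 * (1 + w) * real n)"
    using exp_sum_squares_bound[OF ind V t(1) x1 e, where c = "w / 8 * (1 + w) * real n"] by simp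
  also have "real n * ?e - w / 8 * (1 + w) * real n = - (real n * w\<^sup>2 / 16)"
    by (simp add: algebra_simps power2_eq_square)
  finally show ?thesis .
qed

lemma sum_squares_lower:
  assumes ind: "indep_vars (\<lambda>_. borel) V {..<n::nat}"
    and V: "\<And>i. i < n \<Longrightarrow> normal_rv M (V i) t" and t: "0 < R" "R \<le> t" and w: "0 < w" "w \<le> 1"
  shows "prob {\<omega>\<in>space M. (\<Sum>i<n. (V i \<omega>)\<^sup>2) \<le> (1 - w) * (real n * R\<^sup>2)} \<le> exp (- (real n * w\<^sup>2 / 16))"
proof -
  let ?\<theta> = "w / (4 * t\<^sup>2)" let ?e = "- (w / 4) + w\<^sup>2 / 8"
  have pos: "t > 0" using t by simp
  have [measurable]: "\<And>i. i < n \<Longrightarrow> V i \<in> borel_measurable M" using V normal_rv_measurable by blast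
  have x: "2 * ?\<theta> * t\<^sup>2 = w / 2" using pos by simp
  have "w / 2 - (w / 2)\<^sup>2 \<le> ln (1 + w / 2)"
    using w by (intro ln_one_plus_pos_lower_bound) auto
  then have "exp (- 2 * ?e) \<le> 1 + w / 2" using w by (subst (asm) ln_ge_iff) (auto simp: power2_eq_square)
  then have "(exp (- ?e))\<^sup>2 \<le> 1 + w / 2" by (simp add: exp_double[symmetric])
  then have "exp (- ?e) \<le> sqrt (1 + w / 2)" by (rule real_le_rsqrt)
  then have "1 / sqrt (1 + w / 2) \<le> 1 / exp (- ?e)"
    using w by (intro divide_left_mono) (auto simp: zero_less_mult_iff)
  also have "1 + w / 2 = 1 - 2 * - ?\<theta> * t\<^sup>2" using x by simp
  also have "1 / exp (- ?e) = exp ?e" by (simp add: exp_minus field_simps)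
  finally have e: "1 / sqrt (1 - 2 * - ?\<theta> * t\<^sup>2) \<le> exp ?e" .
  have "R\<^sup>2 \<le> t\<^sup>2" using t by (intro power_mono) auto
  then have "(1 - w) * (real n * R\<^sup>2) \<le> (1 - w) * (real n * t\<^sup>2)"
    using w by (intro mult_left_mono) auto
  then have "prob {\<omega>\<in>space M. (\<Sum>i<n. (V i \<omega>)\<^sup>2) \<le> (1 - w) * (real n * R\<^sup>2)} \<le>
      prob {\<omega>\<in>space M. (\<Sum>i<n. (V i \<omega>)\<^sup>2) \<le> (1 - w) * (real n * t\<^sup>2)}"
    by (intro finite_measure_mono) auto
  also have "\<dots> \<le> prob {\<omega>\<in>space M. - (w / 4 * (1 - w) * real n) \<le> - ?\<theta> * (\<Sum>i<n. (V i \<omega>)\<^sup>2)}"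
  proof (intro finite_measure_mono subsetI)
    fix \<omega> assume \<omega>: "\<omega> \<in> {\<omega>\<in>space M. (\<Sum>i<n. (V i \<omega>)\<^sup>2) \<le> (1 - w) * (real n * t\<^sup>2)}"
    then have "?\<theta> * (\<Sum>i<n. (V i \<omega>)\<^sup>2) \<le> ?\<theta> * ((1 - w) * (real n * t\<^sup>2))"
      using w by (intro mult_left_mono) auto
    also have "\<dots> = w / 4 * (1 - w) * real n" using pos by simp
    finally show "\<omega> \<in> {\<omega>\<in>space M. - (w / 4 * (1 - w) * real n) \<le> - ?\<theta> * (\<Sum>i<n. (V i \<omega>)\<^sup>2)}"
      using \<omega> by simp
  qed measurable
  also have "\<dots> \<le> exp (real n * ?e - - (w / 4 * (1 - w) * real n))"
    using w x by (intro exp_sum_squares_bound[OF ind V _ _ e]) (use pos in auto)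
  also have "real n * ?e - - (w / 4 * (1 - w) * real n) = - (real n * w\<^sup>2 / 8)"
    by (simp add: field_simps power2_eq_square)
  also have "exp \<dots> \<le> exp (- (real n * w\<^sup>2 / 16))" by simp
  finally show ?thesis .
qed

text \<open>
  Fubini's theorem: to bound the probability of an event that depends on independent \<open>W\<close> and \<open>V\<close>, it
  suffices to bound it for every fixed value of \<open>V\<close>.
\<close>

lemma prob_freeze:
  assumes iv: "indep_var M1 W M2 V" and C: "C \<in> sets (M1 \<Otimes>\<^sub>M M2)"
    and c: "\<And>v. v \<in> space M2 \<Longrightarrow> prob {\<omega>\<in>space M. (W \<omega>, v) \<in> C} \<le> c"
  shows "prob {\<omega>\<in>space M. (W \<omega>, V \<omega>) \<in> C} \<le> c"
proof -
  have W[measurable]: "W \<in> measurable M M1" and V[measurable]: "V \<in> measurable M M2"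
    using indep_var_rv1[OF iv] indep_var_rv2[OF iv] by auto
  interpret D1: prob_space "distr M M1 W" by (rule prob_space_distr) simp
  interpret D2: prob_space "distr M M2 V" by (rule prob_space_distr) simp
  interpret D: pair_prob_space "distr M M1 W" "distr M M2 V" ..
  have "emeasure M {\<omega>\<in>space M. (W \<omega>, V \<omega>) \<in> C} = emeasure (distr M (M1 \<Otimes>\<^sub>M M2) (\<lambda>\<omega>. (W \<omega>, V \<omega>))) C"
    using C by (subst emeasure_distr) (auto intro!: arg_cong[of _ _ "emeasure M"])
  also have "distr M (M1 \<Otimes>\<^sub>M M2) (\<lambda>\<omega>. (W \<omega>, V \<omega>)) = distr M M1 W \<Otimes>\<^sub>M distr M M2 V"
    by (rule indep_var_distribution_eq[THEN iffD1, OF iv, THEN conjunct2, THEN conjunct2, symmetric])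
  also have "emeasure \<dots> C = (\<integral>\<^sup>+v. emeasure (distr M M1 W) ((\<lambda>w. (w, v)) -` C) \<partial>distr M M2 V)"
    using C by (intro D.emeasure_pair_measure_alt2) simp
  also have "\<dots> \<le> (\<integral>\<^sup>+v. ennreal c \<partial>distr M M2 V)"
  proof (rule nn_integral_mono)
    fix v assume "v \<in> space (distr M M2 V)"
    then have v: "v \<in> space M2" by simp
    have "(\<lambda>w. (w, v)) -` C \<in> sets M1" using C by (rule sets_Pair2)
    then have "emeasure (distr M M1 W) ((\<lambda>w. (w, v)) -` C) = emeasure M {\<omega>\<in>space M. (W \<omega>, v) \<in> C}"
      by (subst emeasure_distr) (auto intro!: arg_cong[of _ _ "emeasure M"])
    with c[OF v] show "emeasure (distr M M1 W) ((\<lambda>w. (w, v)) -` C) \<le> ennreal c"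
      by (simp add: emeasure_eq_measure ennreal_leI)
  qed
  also have "\<dots> = ennreal c" by (simp add: D2.emeasure_space_1[simplified])
  finally have "ennreal (prob {\<omega>\<in>space M. (W \<omega>, V \<omega>) \<in> C}) \<le> ennreal c" by (simp add: emeasure_eq_measure)
  moreover have "c \<ge> 0"
  proof -
    obtain \<omega> where "\<omega> \<in> space M" using not_empty by auto
    then have "V \<omega> \<in> space M2" using V by (rule measurable_space[rotated])
    from c[OF this] show ?thesis using measure_nonneg order_trans by blast
  qed
  ultimately show ?thesis by simp
qed

end

section \<open>Inner products with the columns of a Gaussian design\<close>

locale gaussian_design = prob_space M for M :: "'a measure" +
  fixes n p :: nat and X :: "'a \<Rightarrow> nat \<Rightarrow> nat \<Rightarrow> real" and z :: "'a \<Rightarrow> nat \<Rightarrow> real" and \<sigma> :: real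
  assumes n_pos: "n > 0" and \<sigma>_nonneg: "\<sigma> \<ge> 0"
    and X_normal: "\<And>i j. i < n \<Longrightarrow> j < p \<Longrightarrow> normal_rv M (\<lambda>\<omega>. X \<omega> i j) (1 / sqrt (real n))"
    and z_normal: "\<And>i. i < n \<Longrightarrow> normal_rv M (\<lambda>\<omega>. z \<omega> i) \<sigma>"
    and indep: "indep_vars (\<lambda>_. borel) (\<lambda>q \<omega>. case q of Inl (i, j) \<Rightarrow> X \<omega> i j | Inr i \<Rightarrow> z \<omega> i)
      (({..<n} \<times> {..<p}) <+> {..<n})"
begin

abbreviation entry :: "(nat \<times> nat) + nat \<Rightarrow> 'a \<Rightarrow> real" where
  "entry \<equiv> \<lambda>q \<omega>. case q of Inl (i, j) \<Rightarrow> X \<omega> i j | Inr i \<Rightarrow> z \<omega> i"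

text \<open>
  All vectors that are paired with a column below are of this form: the response, the response
  without the contribution of some columns, a single column, and sums of columns. The entries are
  independent centred normal variables with standard deviation \<open>sd a b\<close>.
\<close>

definition lin_comb :: "(nat \<Rightarrow> real) \<Rightarrow> real \<Rightarrow> nat \<Rightarrow> 'a \<Rightarrow> real" where
  "lin_comb a b i \<omega> = (\<Sum>j<p. X \<omega> i j * a j) + z \<omega> i * b"

definition sd :: "(nat \<Rightarrow> real) \<Rightarrow> real \<Rightarrow> real" where
  "sd a b = sqrt ((\<Sum>j<p. (a j)\<^sup>2) / real n + b\<^sup>2 * \<sigma>\<^sup>2)"

lemma sd_nonneg: "sd a b \<ge> 0"
  by (simp add: sd_def sum_nonneg)

lemma X_measurable [measurable]: "i < n \<Longrightarrow> j < p \<Longrightarrow> (\<lambda>\<omega>. X \<omega> i j) \<in> borel_measurable M"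
  by (rule normal_rv_measurable[OF X_normal])

lemma z_measurable [measurable]: "i < n \<Longrightarrow> (\<lambda>\<omega>. z \<omega> i) \<in> borel_measurable M"
  by (rule normal_rv_measurable[OF z_normal])

lemma lin_comb_measurable [measurable]: "i < n \<Longrightarrow> lin_comb a b i \<in> borel_measurable M"
  unfolding lin_comb_def
  by (intro borel_measurable_add borel_measurable_sum borel_measurable_times) auto

lemma lin_comb_normal:
  assumes i: "i < n"
  shows "normal_rv M (lin_comb a b i) (sd a b)"
proof -
  let ?K = "({i} \<times> {..<p}) <+> {i}"
  define c where "c q = (case q of Inl (i, j) \<Rightarrow> a j | Inr i \<Rightarrow> b)" for q :: "(nat \<times> nat) + nat"
  define s where "s q = (case q of Inl (i, j) \<Rightarrow> \<bar>a j\<bar> * (1 / sqrt (real n)) | Inr i \<Rightarrow> \<bar>b\<bar> * \<sigma>)"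
    for q :: "(nat \<times> nat) + nat"
  have "indep_vars (\<lambda>_. borel) entry ?K"
    using i by (intro indep_vars_subset[OF indep]) auto
  then have ind: "indep_vars (\<lambda>_. borel) (\<lambda>q \<omega>. c q * entry q \<omega>) ?K"
    by (rule indep_vars_compose2) simp
  have "normal_rv M (\<lambda>\<omega>. \<Sum>q\<in>?K. c q * entry q \<omega>) (sqrt (\<Sum>q\<in>?K. (s q)\<^sup>2))"
  proof (rule normal_rv_sum[OF _ ind])
    fix q assume q: "q \<in> ?K"
    show "normal_rv M (\<lambda>\<omega>. c q * entry q \<omega>) (s q)"
    proof (cases q)
      case (Inl r)
      then obtain j where "r = (i, j)" "j < p" using q by auto
      with Inl show ?thesis
        using normal_rv_scale[OF X_normal[OF i, of j], of "a j"] by (simp add: c_def s_def)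
    next
      case (Inr r)
      then have "r = i" using q by auto
      with Inr show ?thesis
        using normal_rv_scale[OF z_normal[OF i] \<sigma>_nonneg, of b] by (simp add: c_def s_def)
    qed
    show "s q \<ge> 0" using \<sigma>_nonneg by (auto simp: s_def split: sum.split)
  qed auto
  moreover have "(\<Sum>q\<in>?K. c q * entry q \<omega>) = lin_comb a b i \<omega>" for \<omega>
  proof -
    have "{i} \<times> {..<p} = Pair i ` {..<p}" by auto
    then show ?thesis
      by (simp add: sum.Plus c_def lin_comb_def sum.reindex inj_on_def mult.commute)
  qed
  moreover have "(\<Sum>q\<in>?K. (s q)\<^sup>2) = (\<Sum>j<p. (a j)\<^sup>2) / real n + b\<^sup>2 * \<sigma>\<^sup>2"
  proof -
    have "{i} \<times> {..<p} = Pair i ` {..<p}" by auto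
    then show ?thesis
      by (simp add: sum.Plus s_def sum.reindex inj_on_def power_mult_distrib power_divide sum_divide_distrib)
  qed
  ultimately show ?thesis by (simp add: sd_def)
qed

lemma lin_comb_indep: "indep_vars (\<lambda>_. borel) (lin_comb a b) {..<n}"
proof -
  let ?K = "\<lambda>i. ({i} \<times> {..<p}) <+> {i}"
  let ?f = "\<lambda>i (x :: (nat \<times> nat) + nat \<Rightarrow> real). (\<Sum>j<p. x (Inl (i, j)) * a j) + x (Inr i) * b"
  have "indep_vars (\<lambda>i. PiM (?K i) (\<lambda>_. borel)) (\<lambda>i \<omega>. restrict (\<lambda>q. entry q \<omega>) (?K i)) {..<n}"
    by (rule indep_vars_restrict[OF indep]) (auto simp: disjoint_family_on_def)
  then have "indep_vars (\<lambda>_. borel) (\<lambda>i \<omega>. ?f i (restrict (\<lambda>q. entry q \<omega>) (?K i))) {..<n}"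
  proof (rule indep_vars_compose2)
    fix i
    show "?f i \<in> borel_measurable (PiM (?K i) (\<lambda>_. borel))"
      by (intro borel_measurable_add borel_measurable_sum borel_measurable_times
          borel_measurable_const measurable_component_singleton) auto
  qed
  moreover have "?f i (restrict (\<lambda>q. entry q \<omega>) (?K i)) = lin_comb a b i \<omega>" for i \<omega>
  proof -
    have "Inr i \<in> ?K i" "\<And>j. j < p \<Longrightarrow> Inl (i, j) \<in> ?K i" by auto
    then show ?thesis by (simp add: lin_comb_def)
  qed
  ultimately show ?thesis by simp
qed

lemma lin_comb_norm_upper:
  assumes "sd a b \<le> R" "R > 0" "0 < w" "w \<le> 1"
  shows "prob {\<omega>\<in>space M. (1 + w) * (real n * R\<^sup>2) \<le> (\<Sum>i<n. (lin_comb a b i \<omega>)\<^sup>2)} \<le> exp (- (real n * w\<^sup>2 / 16))"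
  by (rule sum_squares_upper[OF lin_comb_indep lin_comb_normal sd_nonneg assms])

lemma lin_comb_norm_lower:
  assumes "0 < R" "R \<le> sd a b" "0 < w" "w \<le> 1"
  shows "prob {\<omega>\<in>space M. (\<Sum>i<n. (lin_comb a b i \<omega>)\<^sup>2) \<le> (1 - w) * (real n * R\<^sup>2)} \<le> exp (- (real n * w\<^sup>2 / 16))"
  by (rule sum_squares_lower[OF lin_comb_indep lin_comb_normal assms])

lemma col_inner_normal:
  assumes j: "j < p"
  shows "normal_rv M (\<lambda>\<omega>. col_inner n (X \<omega>) j v) (sqrt ((\<Sum>i<n. (v i)\<^sup>2) / real n))"
proof -
  let ?K = "\<lambda>i. {Inl (i, j)} :: ((nat \<times> nat) + nat) set"
  have "indep_vars (\<lambda>i. PiM (?K i) (\<lambda>_. borel)) (\<lambda>i \<omega>. restrict (\<lambda>q. entry q \<omega>) (?K i)) {..<n}"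
    using j by (intro indep_vars_restrict[OF indep]) (auto simp: disjoint_family_on_def)
  then have "indep_vars (\<lambda>_. borel) (\<lambda>i \<omega>. v i * restrict (\<lambda>q. entry q \<omega>) (?K i) (Inl (i, j))) {..<n}"
    by (rule indep_vars_compose2) (intro borel_measurable_times borel_measurable_const
        measurable_component_singleton, simp)
  then have ind: "indep_vars (\<lambda>_. borel) (\<lambda>i \<omega>. v i * entry (Inl (i, j)) \<omega>) {..<n}"
    by simp
  have "normal_rv M (\<lambda>\<omega>. \<Sum>i<n. v i * entry (Inl (i, j)) \<omega>) (sqrt (\<Sum>i<n. (\<bar>v i\<bar> * (1 / sqrt (real n)))\<^sup>2))"
  proof (rule normal_rv_sum[OF _ ind])
    fix i assume "i \<in> {..<n}"
    then show "normal_rv M (\<lambda>\<omega>. v i * entry (Inl (i, j)) \<omega>) (\<bar>v i\<bar> * (1 / sqrt (real n)))"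
      using normal_rv_scale[OF X_normal[of i j], of "v i"] j by simp
  qed auto
  then show ?thesis
    by (simp add: col_inner_def mult.commute power_mult_distrib power_divide sum_divide_distrib)
qed

lemma col_inner_indep:
  assumes J: "J \<subseteq> {..<p}"
  shows "indep_vars (\<lambda>_. borel) (\<lambda>j \<omega>. col_inner n (X \<omega>) j v) J"
proof -
  let ?K = "\<lambda>j. Inl ` ({..<n} \<times> {j}) :: ((nat \<times> nat) + nat) set"
  let ?f = "\<lambda>j (x :: (nat \<times> nat) + nat \<Rightarrow> real). \<Sum>i<n. x (Inl (i, j)) * v i"
  have "indep_vars (\<lambda>j. PiM (?K j) (\<lambda>_. borel)) (\<lambda>j \<omega>. restrict (\<lambda>q. entry q \<omega>) (?K j)) J"
    using J by (intro indep_vars_restrict[OF indep]) (auto simp: disjoint_family_on_def)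
  then have "indep_vars (\<lambda>_. borel) (\<lambda>j \<omega>. ?f j (restrict (\<lambda>q. entry q \<omega>) (?K j))) J"
  proof (rule indep_vars_compose2)
    fix j
    show "?f j \<in> borel_measurable (PiM (?K j) (\<lambda>_. borel))"
      by (intro borel_measurable_sum borel_measurable_times
          borel_measurable_const measurable_component_singleton) auto
  qed
  moreover have "?f j (restrict (\<lambda>q. entry q \<omega>) (?K j)) = col_inner n (X \<omega>) j v" for j \<omega>
    by (simp add: col_inner_def)
  ultimately show ?thesis by simp
qed

text \<open>
  Columns with coefficient zero are independent of the linear combination, which can therefore be
  treated as a fixed vector; only its norm enters the bounds.
\<close>

lemma columns_given_lin_comb:
  assumes J: "J \<subseteq> {..<p}" and a: "\<And>j. j \<in> J \<Longrightarrow> a j = 0"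
    and S: "S \<in> sets (PiM J (\<lambda>_. borel))" and B: "B \<in> sets borel"
    and c: "c \<ge> 0" and bnd: "\<And>v. (\<Sum>i<n. (v i)\<^sup>2) \<in> B \<Longrightarrow>
      prob {\<omega>\<in>space M. (\<lambda>j\<in>J. col_inner n (X \<omega>) j v) \<in> S} \<le> c"
  shows "prob {\<omega>\<in>space M. (\<Sum>i<n. (lin_comb a b i \<omega>)\<^sup>2) \<in> B \<and>
    (\<lambda>j\<in>J. col_inner n (X \<omega>) j (\<lambda>i. lin_comb a b i \<omega>)) \<in> S} \<le> c"
proof -
  let ?A = "Inl ` ({..<n} \<times> J) :: ((nat \<times> nat) + nat) set"
  let ?B = "({..<n} \<times> ({..<p} - J)) <+> {..<n}"
  let ?W = "\<lambda>\<omega>. restrict (\<lambda>q. entry q \<omega>) ?A"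
  \<comment> \<open>the linear combination is indexed by \<open>Inr\<close> because \<open>indep_var\<close> requires both variables to have the same type\<close>
  let ?R = "Inr ` {..<n} :: ((nat \<times> nat) + nat) set"
  let ?N = "PiM ?R (\<lambda>_. borel :: real measure)"
  let ?g = "\<lambda>x :: (nat \<times> nat) + nat \<Rightarrow> real. \<lambda>q\<in>?R.
    (\<Sum>j\<in>{..<p}-J. x (Inl (projr q, j)) * a j) + x q * b"
  let ?V = "\<lambda>\<omega>. \<lambda>q\<in>?R. lin_comb a b (projr q) \<omega>"
  let ?u = "\<lambda>w v :: (nat \<times> nat) + nat \<Rightarrow> real. \<lambda>j\<in>J. \<Sum>i<n. w (Inl (i, j)) * v (Inr i)"
  have "indep_var (PiM ?A (\<lambda>_. borel)) ?W (PiM ?B (\<lambda>_. borel)) (\<lambda>\<omega>. restrict (\<lambda>q. entry q \<omega>) ?B)"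
    using J by (intro indep_var_restrict[OF indep]) auto
  then have "indep_var (PiM ?A (\<lambda>_. borel)) ((\<lambda>x. x) \<circ> ?W) ?N (?g \<circ> (\<lambda>\<omega>. restrict (\<lambda>q. entry q \<omega>) ?B))"
  proof (rule indep_var_compose)
    show "?g \<in> measurable (PiM ?B (\<lambda>_. borel)) ?N"
      by (intro measurable_restrict borel_measurable_add borel_measurable_sum borel_measurable_times
          borel_measurable_const measurable_component_singleton) auto
  qed simp
  moreover have "?g (restrict (\<lambda>q. entry q \<omega>) ?B) = ?V \<omega>" for \<omega>
  proof (rule restrict_ext)
    fix q assume "q \<in> ?R"
    then obtain i where q: "q = Inr i" "i < n" by auto
    have "(\<Sum>j\<in>{..<p}-J. (restrict (\<lambda>q. entry q \<omega>) ?B) (Inl (i, j)) * a j) = (\<Sum>j\<in>{..<p}-J. X \<omega> i j * a j)"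
      using q by (intro sum.cong) auto
    also have "\<dots> = (\<Sum>j<p. X \<omega> i j * a j)"
      using J a by (intro sum.mono_neutral_left) auto
    moreover have "Inr i \<in> ?B" using q by auto
    ultimately show "(\<Sum>j\<in>{..<p}-J. (restrict (\<lambda>q. entry q \<omega>) ?B) (Inl (projr q, j)) * a j) +
        (restrict (\<lambda>q. entry q \<omega>) ?B) q * b = lin_comb a b (projr q) \<omega>"
      by (simp only: q sum.sel lin_comb_def restrict_apply if_True sum.case)
  qed
  ultimately have iv: "indep_var (PiM ?A (\<lambda>_. borel)) ?W ?N ?V" by (simp only: o_def)
  define C where "C = {x \<in> space (PiM ?A (\<lambda>_. borel) \<Otimes>\<^sub>M ?N).
      (\<Sum>i<n. (snd x (Inr i))\<^sup>2) \<in> B \<and> ?u (fst x) (snd x) \<in> S}"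
  have m1: "(\<lambda>x. \<Sum>i<n. (snd x (Inr i))\<^sup>2) \<in> borel_measurable (PiM ?A (\<lambda>_. borel) \<Otimes>\<^sub>M ?N)"
    by (intro borel_measurable_sum borel_measurable_power
        measurable_compose[OF measurable_snd measurable_component_singleton]) auto
  have m2: "(\<lambda>x. ?u (fst x) (snd x)) \<in> measurable (PiM ?A (\<lambda>_. borel) \<Otimes>\<^sub>M ?N) (PiM J (\<lambda>_. borel))"
    by (intro measurable_restrict borel_measurable_sum borel_measurable_times
        measurable_compose[OF measurable_snd measurable_component_singleton]
        measurable_compose[OF measurable_fst measurable_component_singleton]) auto
  have C: "C \<in> sets (PiM ?A (\<lambda>_. borel) \<Otimes>\<^sub>M ?N)"
    unfolding C_def
    using sets.Int[OF measurable_sets[OF m1 B] measurable_sets[OF m2 S]]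
    by (rule back_subst[of "\<lambda>x. x \<in> sets _"]) auto
  have W: "?W \<omega> \<in> space (PiM ?A (\<lambda>_. borel))" for \<omega> by (simp add: space_PiM)
  have V: "?V \<omega> \<in> space ?N" for \<omega> by (simp add: space_PiM)
  have u: "?u (?W \<omega>) v = (\<lambda>j\<in>J. col_inner n (X \<omega>) j (\<lambda>i. v (Inr i)))" for \<omega> v
    by (rule restrict_ext) (simp add: col_inner_def image_iff)
  have mem: "(?W \<omega>, v) \<in> C \<longleftrightarrow> (\<Sum>i<n. (v (Inr i))\<^sup>2) \<in> B \<and> (\<lambda>j\<in>J. col_inner n (X \<omega>) j (\<lambda>i. v (Inr i))) \<in> S"
    if "v \<in> space ?N" for \<omega> v
    using W[of \<omega>] that unfolding C_def mem_Collect_eq fst_conv snd_conv u space_pair_measure by blast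
  have "prob {\<omega>\<in>space M. (?W \<omega>, ?V \<omega>) \<in> C} \<le> c"
  proof (rule prob_freeze[OF iv C])
    fix v assume v: "v \<in> space ?N"
    show "prob {\<omega>\<in>space M. (?W \<omega>, v) \<in> C} \<le> c"
      using bnd[of "\<lambda>i. v (Inr i)"] c unfolding mem[OF v]
      by (cases "(\<Sum>i<n. (v (Inr i))\<^sup>2) \<in> B") auto
  qed
  also have "{\<omega>\<in>space M. (?W \<omega>, ?V \<omega>) \<in> C} = {\<omega>\<in>space M. (\<Sum>i<n. (lin_comb a b i \<omega>)\<^sup>2) \<in> B \<and>
    (\<lambda>j\<in>J. col_inner n (X \<omega>) j (\<lambda>i. lin_comb a b i \<omega>)) \<in> S}"
  proof -
    have "?V \<omega> (Inr i) = lin_comb a b i \<omega>" if "i < n" for \<omega> i using that by simp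
    then show ?thesis unfolding mem[OF V] by (simp add: col_inner_def image_iff)
  qed
  finally show ?thesis .
qed

lemma col_inner_measurable [measurable]:
  "j < p \<Longrightarrow> (\<lambda>\<omega>. col_inner n (X \<omega>) j (\<lambda>i. lin_comb a b i \<omega>)) \<in> borel_measurable M"
  unfolding col_inner_def by (intro borel_measurable_sum borel_measurable_times) auto

text \<open>
  Given the linear combination, the inner product is normal with standard deviation at most
  \<open>sqrt (1 + w) * R\<close>, except when the norm is unusually large, which has the probability in the second term.
\<close>

lemma col_inner_upper_tail:
  assumes j: "j < p" and a: "a j = 0" and R: "sd a b \<le> R" "R > 0" and w: "0 < w" "w \<le> 1" and u: "u \<ge> 0"
  shows "prob {\<omega>\<in>space M. u \<le> \<bar>col_inner n (X \<omega>) j (\<lambda>i. lin_comb a b i \<omega>)\<bar>} \<le>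
    2 * exp (- (u\<^sup>2 / (2 * ((1 + w) * R\<^sup>2)))) + exp (- (real n * w\<^sup>2 / 16))"
proof -
  let ?U = "\<lambda>\<omega>. col_inner n (X \<omega>) j (\<lambda>i. lin_comb a b i \<omega>)" and ?Q = "\<lambda>\<omega>. \<Sum>i<n. (lin_comb a b i \<omega>)\<^sup>2"
  let ?T = "(1 + w) * (real n * R\<^sup>2)"
  let ?S = "{x \<in> space (PiM {j} (\<lambda>_. borel :: real measure)). u \<le> \<bar>x j\<bar>}"
  have [measurable]: "?U \<in> borel_measurable M" using j by (rule col_inner_measurable)
  have [measurable]: "?Q \<in> borel_measurable M" by (intro borel_measurable_sum borel_measurable_power) auto
  have R': "sqrt ((1 + w) * R\<^sup>2) > 0" using R w by simp
  have "prob {\<omega>\<in>space M. ?Q \<omega> \<in> {..?T} \<and> (\<lambda>i\<in>{j}. col_inner n (X \<omega>) i (\<lambda>i. lin_comb a b i \<omega>)) \<in> ?S}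
      \<le> 2 * exp (- (u\<^sup>2 / (2 * ((1 + w) * R\<^sup>2))))"
  proof (rule columns_given_lin_comb)
    show "?S \<in> sets (PiM {j} (\<lambda>_. borel))" by measurable
    fix v :: "nat \<Rightarrow> real" assume "(\<Sum>i<n. (v i)\<^sup>2) \<in> {..?T}"
    then have "sqrt ((\<Sum>i<n. (v i)\<^sup>2) / real n) \<le> sqrt ((1 + w) * R\<^sup>2)"
      using n_pos by (intro real_sqrt_le_mono) (simp add: field_simps)
    from normal_rv_upper_tail[OF col_inner_normal[OF j] _ this R' u]
    show "prob {\<omega>\<in>space M. (\<lambda>i\<in>{j}. col_inner n (X \<omega>) i v) \<in> ?S} \<le> 2 * exp (- (u\<^sup>2 / (2 * ((1 + w) * R\<^sup>2))))"
      using R w by (simp add: space_PiM sum_nonneg)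
  qed (use j a in auto)
  then have b1: "prob {\<omega>\<in>space M. ?Q \<omega> \<le> ?T \<and> u \<le> \<bar>?U \<omega>\<bar>} \<le> 2 * exp (- (u\<^sup>2 / (2 * ((1 + w) * R\<^sup>2))))"
    by (simp add: space_PiM)
  have b2: "prob {\<omega>\<in>space M. ?T \<le> ?Q \<omega>} \<le> exp (- (real n * w\<^sup>2 / 16))"
    by (rule lin_comb_norm_upper[OF R w])
  have "prob {\<omega>\<in>space M. u \<le> \<bar>?U \<omega>\<bar>} \<le>
      prob ({\<omega>\<in>space M. ?Q \<omega> \<le> ?T \<and> u \<le> \<bar>?U \<omega>\<bar>} \<union> {\<omega>\<in>space M. ?T \<le> ?Q \<omega>})"
    by (intro finite_measure_mono) auto
  also have "\<dots> \<le> prob {\<omega>\<in>space M. ?Q \<omega> \<le> ?T \<and> u \<le> \<bar>?U \<omega>\<bar>} + prob {\<omega>\<in>space M. ?T \<le> ?Q \<omega>}"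
    by (intro measure_Un_le) auto
  finally show ?thesis using b1 b2 by linarith
qed

text \<open>
  Given the linear combination, the inner products with different columns are independent, and each of
  them exceeds \<open>u\<close> with probability at least \<open>q\<close>. The sign \<open>\<theta>\<close> selects one of the two tails.
\<close>

lemma all_col_inners_small:
  assumes J: "J \<subseteq> {..<p}" and a: "\<And>j. j \<in> J \<Longrightarrow> a j = 0" and R: "0 < R" "R \<le> sd a b"
    and w: "0 < w" "w < 1" and u: "u \<ge> 0" and \<delta>: "\<delta> > 0" and \<theta>: "\<bar>\<theta>\<bar> = 1"
  defines "q \<equiv> \<delta> / sqrt (2 * pi) * exp (- ((u / (sqrt (1 - w) * R) + \<delta>)\<^sup>2 / 2))"
  shows "prob {\<omega>\<in>space M. \<forall>j\<in>J. \<theta> * col_inner n (X \<omega>) j (\<lambda>i. lin_comb a b i \<omega>) < u} \<le>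
    exp (- (real (card J) * q)) + exp (- (real n * w\<^sup>2 / 16))"
proof -
  let ?U = "\<lambda>j \<omega>. col_inner n (X \<omega>) j (\<lambda>i. lin_comb a b i \<omega>)" and ?Q = "\<lambda>\<omega>. \<Sum>i<n. (lin_comb a b i \<omega>)\<^sup>2"
  let ?T = "(1 - w) * (real n * R\<^sup>2)"
  let ?S = "{x \<in> space (PiM J (\<lambda>_. borel :: real measure)). \<forall>j\<in>J. \<theta> * x j < u}"
  have fin: "finite J" using J finite_subset by blast
  have [measurable]: "?Q \<in> borel_measurable M" by (intro borel_measurable_sum borel_measurable_power) auto
  have E[measurable]: "{\<omega>\<in>space M. \<forall>j\<in>J. \<theta> * ?U j \<omega> < u} \<in> sets M"
  proof -
    have "?U j \<in> borel_measurable M" if "j \<in> J" for j using J that by (intro col_inner_measurable) auto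
    then have "{\<omega>\<in>space M. \<theta> * ?U j \<omega> < u} \<in> sets M" if "j \<in> J" for j
      using that by (intro borel_measurable_less borel_measurable_times) auto
    then show ?thesis by (intro sets.sets_Collect_finite_All fin)
  qed
  have R': "sqrt (1 - w) * R > 0" using R w by simp
  have "prob {\<omega>\<in>space M. ?Q \<omega> \<in> {?T..} \<and> (\<lambda>j\<in>J. ?U j \<omega>) \<in> ?S} \<le> exp (- (real (card J) * q))"
  proof (rule columns_given_lin_comb[OF J a])
    show "?S \<in> sets (PiM J (\<lambda>_. borel))"
      using fin by (intro sets.sets_Collect_finite_All) measurable
    fix v :: "nat \<Rightarrow> real" assume v: "(\<Sum>i<n. (v i)\<^sup>2) \<in> {?T..}"
    let ?u = "\<lambda>j \<omega>. \<theta> * col_inner n (X \<omega>) j v"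
    have Rv: "sqrt (1 - w) * R \<le> sqrt ((\<Sum>i<n. (v i)\<^sup>2) / real n)"
      using v n_pos w R by (intro real_le_rsqrt) (simp add: power_mult_distrib field_simps)
    have each: "prob {\<omega>\<in>space M. ?u j \<omega> < u} \<le> exp (- q)" if "j \<in> J" for j
    proof -
      have j: "j < p" using J that by auto
      have normal: "normal_rv M (?u j) (sqrt ((\<Sum>i<n. (v i)\<^sup>2) / real n))"
        using normal_rv_scale[OF col_inner_normal[OF j], of v \<theta>] \<theta> by (simp add: sum_nonneg)
      have [measurable]: "?u j \<in> borel_measurable M" by (rule normal_rv_measurable[OF normal])
      have "{\<omega>\<in>space M. ?u j \<omega> < u} = space M - {\<omega>\<in>space M. u \<le> ?u j \<omega>}" by auto
      then have "prob {\<omega>\<in>space M. ?u j \<omega> < u} = 1 - prob {\<omega>\<in>space M. u \<le> ?u j \<omega>}"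
        by (simp only: prob_compl[OF borel_measurable_le[OF borel_measurable_const \<open>?u j \<in> borel_measurable M\<close>]])
      also have "\<dots> \<le> 1 - q"
        using normal_rv_lower_tail[OF normal R' Rv u \<delta>] by (simp add: q_def)
      also have "\<dots> \<le> exp (- q)" using exp_ge_add_one_self[of "- q"] by simp
      finally show ?thesis .
    qed
    show "prob {\<omega>\<in>space M. (\<lambda>j\<in>J. col_inner n (X \<omega>) j v) \<in> ?S} \<le> exp (- (real (card J) * q))"
    proof (cases "J = {}")
      case True
      then show ?thesis by simp
    next
      case False
      have ind: "indep_vars (\<lambda>_. borel) ?u J"
        by (rule indep_vars_compose2[OF col_inner_indep[OF J]]) simp
      have "{\<omega>\<in>space M. (\<lambda>j\<in>J. col_inner n (X \<omega>) j v) \<in> ?S} = (\<Inter>j\<in>J. ?u j -` {..<u} \<inter> space M)"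
        using False by (auto simp: space_PiM)
      then have "prob {\<omega>\<in>space M. (\<lambda>j\<in>J. col_inner n (X \<omega>) j v) \<in> ?S} = (\<Prod>j\<in>J. prob (?u j -` {..<u} \<inter> space M))"
        using indep_varsD[OF ind False fin, of "\<lambda>_. {..<u}"] by simp
      also have "\<dots> \<le> (\<Prod>j\<in>J. exp (- q))"
      proof (intro prod_mono conjI)
        fix j assume "j \<in> J"
        have "?u j -` {..<u} \<inter> space M = {\<omega>\<in>space M. ?u j \<omega> < u}" by auto
        with each[OF \<open>j \<in> J\<close>] show "prob (?u j -` {..<u} \<inter> space M) \<le> exp (- q)" by simp
      qed simp
      also have "\<dots> = exp (- (real (card J) * q))" by (simp add: exp_of_nat_mult[symmetric])
      finally show ?thesis .
    qed
  qed auto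
  then have b1: "prob {\<omega>\<in>space M. ?T \<le> ?Q \<omega> \<and> (\<forall>j\<in>J. \<theta> * ?U j \<omega> < u)} \<le> exp (- (real (card J) * q))"
    by (simp add: space_PiM)
  have b2: "prob {\<omega>\<in>space M. ?Q \<omega> \<le> ?T} \<le> exp (- (real n * w\<^sup>2 / 16))"
    using w by (intro lin_comb_norm_lower[OF R]) auto
  have "prob {\<omega>\<in>space M. \<forall>j\<in>J. \<theta> * ?U j \<omega> < u} \<le>
      prob ({\<omega>\<in>space M. ?T \<le> ?Q \<omega> \<and> (\<forall>j\<in>J. \<theta> * ?U j \<omega> < u)} \<union> {\<omega>\<in>space M. ?Q \<omega> \<le> ?T})"
    using E by (intro finite_measure_mono) auto
  also have "\<dots> \<le> prob {\<omega>\<in>space M. ?T \<le> ?Q \<omega> \<and> (\<forall>j\<in>J. \<theta> * ?U j \<omega> < u)} + prob {\<omega>\<in>space M. ?Q \<omega> \<le> ?T}"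
    using E by (intro measure_Un_le) auto
  finally show ?thesis using b1 b2 by linarith
qed

end

section \<open>Marginal correlations in the linear model\<close>

context prob_space
begin

lemma prob_UN_le:
  assumes "finite I" "\<And>i. i \<in> I \<Longrightarrow> E i \<in> events" "\<And>i. i \<in> I \<Longrightarrow> prob (E i) \<le> c"
  shows "prob (\<Union>i\<in>I. E i) \<le> real (card I) * c"
proof -
  have "prob (\<Union>i\<in>I. E i) \<le> (\<Sum>i\<in>I. prob (E i))"
    using assms by (intro finite_measure_subadditive_finite) auto
  also have "\<dots> \<le> (\<Sum>i\<in>I. c)" by (intro sum_mono assms)
  finally show ?thesis by simp
qed

text \<open>
  Markov's inequality for the number of events that occur; it makes no assumption on their
  dependence.
\<close>

lemma prob_many_events_le:
  assumes I: "finite I" and E: "\<And>i. i \<in> I \<Longrightarrow> E i \<in> events" and c: "\<And>i. i \<in> I \<Longrightarrow> prob (E i) \<le> c"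
  shows "{\<omega>\<in>space M. m < card {i\<in>I. \<omega> \<in> E i}} \<in> events"
    "prob {\<omega>\<in>space M. m < card {i\<in>I. \<omega> \<in> E i}} \<le> real (card I) * c / (real m + 1)"
proof -
  define N where "N \<omega> = (\<Sum>i\<in>I. indicator (E i) \<omega> :: real)" for \<omega>
  have N: "N \<omega> = real (card {i\<in>I. \<omega> \<in> E i})" for \<omega>
    using I by (simp add: N_def indicator_def sum.If_cases Int_def)
  have [measurable]: "N \<in> borel_measurable M"
    unfolding N_def using E by (intro borel_measurable_sum borel_measurable_indicator)
  have eq: "{\<omega>\<in>space M. m < card {i\<in>I. \<omega> \<in> E i}} = {\<omega>\<in>space M. real m + 1 \<le> N \<omega>}"
    unfolding N by auto
  show "{\<omega>\<in>space M. m < card {i\<in>I. \<omega> \<in> E i}} \<in> events" unfolding eq by measurable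
  have int: "integrable M N"
    unfolding N_def using E by (intro Bochner_Integration.integrable_sum integrable_real_indicator) (auto simp: emeasure_eq_measure)
  have "prob {\<omega>\<in>space M. real m + 1 \<le> N \<omega>} \<le> (\<integral>\<omega>. N \<omega> \<partial>M) / (real m + 1)"
    by (rule integral_Markov_inequality_measure[OF int]) (auto simp: N_def sum_nonneg)
  also have "(\<integral>\<omega>. N \<omega> \<partial>M) = (\<Sum>i\<in>I. prob (E i))"
    unfolding N_def using E
    by (subst Bochner_Integration.integral_sum) (auto simp: emeasure_eq_measure intro!: integrable_real_indicator)
  also have "\<dots> \<le> real (card I) * c" using sum_mono[of I "\<lambda>i. prob (E i)" "\<lambda>_. c"] c by simp
  finally show "prob {\<omega>\<in>space M. m < card {i\<in>I. \<omega> \<in> E i}} \<le> real (card I) * c / (real m + 1)"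
    unfolding eq by (simp add: divide_right_mono)
qed

end

lemma disjoint_groups_exist:
  fixes S :: "'b set"
  assumes S: "finite S" and le: "G * g \<le> card S"
  obtains B where "\<And>t. t < G \<Longrightarrow> B t \<subseteq> S" "\<And>t. t < G \<Longrightarrow> card (B t) = g"
    "\<And>t t'. t < G \<Longrightarrow> t' < G \<Longrightarrow> t \<noteq> t' \<Longrightarrow> B t \<inter> B t' = {}"
proof -
  obtain e where e: "bij_betw e {0..<card S} S" using ex_bij_betw_nat_finite[OF S] by blast
  let ?I = "\<lambda>t. {t * g..<Suc t * g}"
  have sub: "?I t \<subseteq> {0..<card S}" if "t < G" for t
  proof -
    have "Suc t * g \<le> G * g" using that by (intro mult_le_mono1) simp
    with le show ?thesis by (simp add: ivl_subset)
  qed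
  have inj: "inj_on e {0..<card S}" using e by (rule bij_betw_imp_inj_on)
  have disj: "?I t \<inter> ?I t' = {}" if "t < t'" for t t'
  proof -
    have "Suc t * g \<le> t' * g" using that by (intro mult_le_mono1) simp
    then show ?thesis by auto
  qed
  show ?thesis
  proof (rule that[of "\<lambda>t. e ` ?I t"])
    show "e ` ?I t \<subseteq> S" if "t < G" for t
      using image_mono[OF sub[OF that], of e] bij_betw_imp_surj_on[OF e] by simp
    show "card (e ` ?I t) = g" if "t < G" for t
      using card_image[OF inj_on_subset[OF inj sub[OF that]]] by simp
    show "e ` ?I t \<inter> e ` ?I t' = {}" if "t < G" "t' < G" "t \<noteq> t'" for t t'
    proof -
      have "?I t \<inter> ?I t' = {}" using disj[of t t'] disj[of t' t] that(3) by (metis Int_commute linorder_neqE_nat)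
      then have "e ` (?I t \<inter> ?I t') = {}" by (simp only: image_empty)
      then show ?thesis
        using inj_on_image_Int[OF inj sub[OF that(1)] sub[OF that(2)]] by (simp only:)
    qed
  qed
qed

text \<open>
  The linear model with response \<open>X \<beta> + z\<close>, whose nonzero coefficients are all equal to \<open>amp\<close>. The
  standard deviation of the entries of the response is \<open>s\<close>.
\<close>

locale spurious_model = gaussian_design +
  fixes \<beta> :: "nat \<Rightarrow> real" and amp :: real
  assumes \<beta>_vals: "\<And>j. j < p \<Longrightarrow> \<beta> j = amp \<or> \<beta> j = 0" and amp_nz: "amp \<noteq> 0"
begin

definition signal :: "nat set" where "signal = {j. j < p \<and> \<beta> j \<noteq> 0}"

definition k :: nat where "k = card signal"

definition s :: real where "s = sd \<beta> 1"

definition response :: "'a \<Rightarrow> nat \<Rightarrow> real" where "response \<omega> i = lin_comb \<beta> 1 i \<omega>"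

lemma signal_subset: "signal \<subseteq> {..<p}" and finite_signal: "finite signal"
  by (auto simp: signal_def)

lemma \<beta>_signal: "j \<in> signal \<Longrightarrow> \<beta> j = amp"
  using \<beta>_vals by (auto simp: signal_def)

lemma \<beta>_abs_le: "j < p \<Longrightarrow> \<bar>\<beta> j\<bar> \<le> \<bar>amp\<bar>"
  using \<beta>_vals[of j] by auto

lemma sum_\<beta>_square:
  assumes "B \<subseteq> {..<p}"
  shows "(\<Sum>j<p. (if j \<in> B then 0 else \<beta> j)\<^sup>2) = real (card (signal - B)) * amp\<^sup>2"
proof -
  have "(\<Sum>j<p. (if j \<in> B then 0 else \<beta> j)\<^sup>2) = (\<Sum>j\<in>signal - B. amp\<^sup>2)"
  proof (rule sum.mono_neutral_cong_right)
    show "signal - B \<subseteq> {..<p}" using signal_subset by blast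
    show "\<forall>j\<in>{..<p} - (signal - B). (if j \<in> B then 0 else \<beta> j)\<^sup>2 = 0"
      by (auto simp: signal_def)
    fix j assume j: "j \<in> signal - B"
    then have "\<beta> j = amp" using \<beta>_signal by blast
    with j show "(if j \<in> B then 0 else \<beta> j)\<^sup>2 = amp\<^sup>2" by simp
  qed simp
  then show ?thesis by simp
qed

lemma s_eq: "s = sqrt (real k * amp\<^sup>2 / real n + \<sigma>\<^sup>2)"
  using sum_\<beta>_square[of "{}"] by (simp add: s_def sd_def k_def)

lemma s_pos: "k > 0 \<Longrightarrow> s > 0"
  unfolding s_eq using amp_nz n_pos by (auto intro!: add_pos_nonneg)

lemma sd_without_le: "B \<subseteq> {..<p} \<Longrightarrow> sd (\<lambda>j. if j \<in> B then 0 else \<beta> j) 1 \<le> s"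
proof -
  assume B: "B \<subseteq> {..<p}"
  have "real (card (signal - B)) * amp\<^sup>2 \<le> real k * amp\<^sup>2"
    unfolding k_def by (intro mult_right_mono) (auto simp: finite_signal card_mono)
  then show "sd (\<lambda>j. if j \<in> B then 0 else \<beta> j) 1 \<le> s"
    unfolding s_eq sd_def sum_\<beta>_square[OF B]
    by (intro real_sqrt_le_mono) (simp add: divide_right_mono)
qed

text \<open>
  The variance of the response is the sum of the noise variance and of equal contributions of the
  signals, so it is reduced at most by the fraction of the signals that are left out.
\<close>

lemma sd_without_ge:
  assumes B: "B \<subseteq> signal" and w: "real (card B) \<le> w * real k" "w \<ge> 0"
  shows "sqrt (1 - w) * s \<le> sd (\<lambda>j. if j \<in> B then 0 else \<beta> j) 1"
proof -
  have "card (signal - B) = k - card B" "card B \<le> k"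
    unfolding k_def using B finite_signal by (auto simp: card_Diff_subset finite_subset card_mono)
  then have "(1 - w) * real k \<le> real (card (signal - B))"
    using w by (simp add: algebra_simps)
  then have "(1 - w) * real k * amp\<^sup>2 \<le> real (card (signal - B)) * amp\<^sup>2"
    by (intro mult_right_mono) auto
  then have "(1 - w) * real k * amp\<^sup>2 / real n \<le> real (card (signal - B)) * amp\<^sup>2 / real n"
    by (rule divide_right_mono) simp
  moreover have "(1 - w) * \<sigma>\<^sup>2 \<le> \<sigma>\<^sup>2"
    using w by (simp add: mult_left_le_one_le algebra_simps)
  ultimately have "(1 - w) * (real k * amp\<^sup>2 / real n + \<sigma>\<^sup>2) \<le> real (card (signal - B)) * amp\<^sup>2 / real n + \<sigma>\<^sup>2"
    by (simp add: distrib_left mult.assoc)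
  then show ?thesis
    unfolding s_eq sd_def real_sqrt_mult[symmetric]
    using sum_\<beta>_square[of B] B signal_subset by (intro real_sqrt_le_mono) auto
qed

definition ind :: "nat \<Rightarrow> nat \<Rightarrow> real" where "ind j i = (if i = j then 1 else 0)"

lemma lin_comb_ind: "j < p \<Longrightarrow> lin_comb (ind j) 0 i \<omega> = X \<omega> i j"
  by (simp add: lin_comb_def ind_def if_distrib[of "\<lambda>x. _ * x"] cong: if_cong)

lemma sd_sum_ind:
  assumes B: "B \<subseteq> {..<p}"
  shows "sd (\<lambda>i. if i \<in> B then 1 else 0) 0 = sqrt (real (card B) / real n)"
proof -
  have "(\<Sum>j<p. (if j \<in> B then 1 else (0::real))\<^sup>2) = (\<Sum>j\<in>B. 1)"
    using B by (intro sum.mono_neutral_cong_right) auto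
  then show ?thesis by (simp add: sd_def)
qed

lemma sd_ind: "j < p \<Longrightarrow> sd (ind j) 0 = 1 / sqrt (real n)"
  using sd_sum_ind[of "{j}"] by (simp add: ind_def[abs_def] real_sqrt_divide)

lemma gram_ind: "j < p \<Longrightarrow> gram n (X \<omega>) i j = col_inner n (X \<omega>) i (\<lambda>r. lin_comb (ind j) 0 r \<omega>)"
  by (simp add: lin_comb_ind)

lemma gram_measurable [measurable]: "i < p \<Longrightarrow> j < p \<Longrightarrow> (\<lambda>\<omega>. gram n (X \<omega>) i j) \<in> borel_measurable M"
  unfolding gram_ind by (rule col_inner_measurable)

lemma column_norm_concentrates:
  assumes j: "j < p" and w: "0 < w" "w \<le> 1"
  shows "prob {\<omega>\<in>space M. w < \<bar>gram n (X \<omega>) j j - 1\<bar>} \<le> 2 * exp (- (real n * w\<^sup>2 / 16))"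
proof -
  let ?Q = "\<lambda>\<omega>. \<Sum>i<n. (lin_comb (ind j) 0 i \<omega>)\<^sup>2"
  have Q: "gram n (X \<omega>) j j = ?Q \<omega>" for \<omega>
    using j by (simp add: lin_comb_ind col_inner_def power2_eq_square)
  have R: "real n * (1 / sqrt (real n))\<^sup>2 = 1" "1 / sqrt (real n) > 0" using n_pos by (simp_all add: power_divide)
  have [measurable]: "?Q \<in> borel_measurable M" by (intro borel_measurable_sum borel_measurable_power) auto
  have "prob {\<omega>\<in>space M. w < \<bar>?Q \<omega> - 1\<bar>} \<le>
      prob ({\<omega>\<in>space M. 1 + w \<le> ?Q \<omega>} \<union> {\<omega>\<in>space M. ?Q \<omega> \<le> 1 - w})"
    by (intro finite_measure_mono) auto
  also have "\<dots> \<le> prob {\<omega>\<in>space M. 1 + w \<le> ?Q \<omega>} + prob {\<omega>\<in>space M. ?Q \<omega> \<le> 1 - w}"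
    by (intro measure_Un_le) auto
  also have "\<dots> \<le> exp (- (real n * w\<^sup>2 / 16)) + exp (- (real n * w\<^sup>2 / 16))"
    using lin_comb_norm_upper[of "ind j" 0 "1 / sqrt (real n)" w]
      lin_comb_norm_lower[of "1 / sqrt (real n)" "ind j" 0 w] sd_ind[OF j] R w
    by (intro add_mono) simp_all
  finally show ?thesis unfolding Q by simp
qed

lemma incoherence:
  assumes i: "i < p" and j: "j < p" and ne: "i \<noteq> j" and w: "0 < w" "w \<le> 1" and \<eta>: "\<eta> \<ge> 0"
  shows "prob {\<omega>\<in>space M. \<eta> \<le> \<bar>gram n (X \<omega>) i j\<bar>} \<le>
    2 * exp (- (\<eta>\<^sup>2 * real n / (2 * (1 + w)))) + exp (- (real n * w\<^sup>2 / 16))"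
proof -
  have "prob {\<omega>\<in>space M. \<eta> \<le> \<bar>col_inner n (X \<omega>) i (\<lambda>r. lin_comb (ind j) 0 r \<omega>)\<bar>} \<le>
    2 * exp (- (\<eta>\<^sup>2 / (2 * ((1 + w) * (1 / sqrt (real n))\<^sup>2)))) + exp (- (real n * w\<^sup>2 / 16))"
    using ne n_pos sd_ind[OF j] by (intro col_inner_upper_tail[OF i _ _ _ w \<eta>]) (auto simp: ind_def)
  then show ?thesis using n_pos by (simp add: gram_ind[OF j] power_divide)
qed

abbreviation without :: "nat set \<Rightarrow> nat \<Rightarrow> real" where
  "without B \<equiv> \<lambda>j. if j \<in> B then 0 else \<beta> j"

lemma response_split:
  assumes B: "B \<subseteq> {..<p}"
  shows "response \<omega> i = lin_comb (without B) 1 i \<omega> + (\<Sum>j\<in>B. X \<omega> i j * \<beta> j)"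
proof -
  have fin: "finite B" using B finite_subset by blast
  have "(\<Sum>j<p. X \<omega> i j * \<beta> j) = (\<Sum>j<p. X \<omega> i j * without B j) + (\<Sum>j<p. if j \<in> B then X \<omega> i j * \<beta> j else 0)"
    unfolding sum.distrib[symmetric] by (intro sum.cong) auto
  also have "(\<Sum>j<p. if j \<in> B then X \<omega> i j * \<beta> j else 0) = (\<Sum>j\<in>B. X \<omega> i j * \<beta> j)"
    using B by (intro sum.mono_neutral_cong_right) auto
  finally show ?thesis by (simp add: response_def lin_comb_def)
qed

lemma col_inner_add:
  "col_inner n Y j (\<lambda>i. f i + h i) = col_inner n Y j f + col_inner n Y j h"
  by (simp add: col_inner_def distrib_left sum.distrib)

lemma col_inner_scale: "col_inner n Y j (\<lambda>i. c * f i) = c * col_inner n Y j f"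
  by (simp add: col_inner_def sum_distrib_left mult_ac)

text \<open>
  The first summand is centred given column \<open>j\<close>; the second is the shift that distinguishes signals
  from noise.
\<close>

lemma corr_split_single:
  assumes j: "j < p"
  shows "col_inner n (X \<omega>) j (response \<omega>) =
    col_inner n (X \<omega>) j (\<lambda>i. lin_comb (without {j}) 1 i \<omega>) + \<beta> j * gram n (X \<omega>) j j"
proof -
  have "response \<omega> = (\<lambda>i. lin_comb (without {j}) 1 i \<omega> + X \<omega> i j * \<beta> j)"
    using response_split[of "{j}"] j by (intro ext) simp
  then show ?thesis by (simp only: col_inner_add col_inner_scale mult.commute[of _ "\<beta> j"])
qed

text \<open>
  The vector in the first summand is independent of all the columns in \<open>B\<close>. The last summand, the
  interference within the group, is small when the group is a small fraction of the signals.
\<close>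

lemma corr_split_group:
  assumes B: "B \<subseteq> signal" and j: "j \<in> B"
  shows "col_inner n (X \<omega>) j (response \<omega>) =
    col_inner n (X \<omega>) j (\<lambda>i. lin_comb (without B) 1 i \<omega>) + amp * gram n (X \<omega>) j j
     + amp * col_inner n (X \<omega>) j (\<lambda>i. lin_comb (\<lambda>l. if l \<in> B - {j} then 1 else 0) 0 i \<omega>)"
proof -
  have Bp: "B \<subseteq> {..<p}" using B signal_subset by (rule order_trans)
  then have fin: "finite B" by (rule finite_subset) simp
  have "(\<Sum>l\<in>B. X \<omega> i l * \<beta> l) = X \<omega> i j * amp + amp * lin_comb (\<lambda>l. if l \<in> B - {j} then 1 else 0) 0 i \<omega>" for i
  proof -
    have "(\<Sum>l\<in>B. X \<omega> i l * \<beta> l) = (\<Sum>l\<in>B. X \<omega> i l * amp)"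
    proof (intro sum.cong refl)
      fix l assume "l \<in> B"
      then have "\<beta> l = amp" using B \<beta>_signal by blast
      then show "X \<omega> i l * \<beta> l = X \<omega> i l * amp" by simp
    qed
    also have "\<dots> = X \<omega> i j * amp + (\<Sum>l\<in>B-{j}. X \<omega> i l * amp)" using fin j by (rule sum.remove)
    also have "(\<Sum>l\<in>B-{j}. X \<omega> i l * amp) = amp * (\<Sum>l<p. X \<omega> i l * (if l \<in> B - {j} then 1 else 0))"
      unfolding sum_distrib_left using Bp by (intro sum.mono_neutral_cong_left) auto
    finally show ?thesis by (simp add: lin_comb_def)
  qed
  then have "response \<omega> = (\<lambda>i. (lin_comb (without B) 1 i \<omega> + X \<omega> i j * amp)
      + amp * lin_comb (\<lambda>l. if l \<in> B - {j} then 1 else 0) 0 i \<omega>)"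
    using response_split[OF Bp] by (intro ext) simp
  then have "col_inner n (X \<omega>) j (response \<omega>) =
      col_inner n (X \<omega>) j (\<lambda>i. lin_comb (without B) 1 i \<omega>) + col_inner n (X \<omega>) j (\<lambda>i. X \<omega> i j * amp)
      + col_inner n (X \<omega>) j (\<lambda>i. amp * lin_comb (\<lambda>l. if l \<in> B - {j} then 1 else 0) 0 i \<omega>)"
    by (simp only: col_inner_add)
  then show ?thesis by (simp only: col_inner_scale mult.commute[of _ amp])
qed

end

section \<open>Nonasymptotic bounds on the rank\<close>

context spurious_model
begin

lemma scaled_col_inner_tail:
  assumes j: "j < p" and a: "a j = 0" and R: "sd a b \<le> R" "R > 0" and w: "0 < w" "w < 1" and x: "x \<ge> 0"
  shows "prob {\<omega>\<in>space M. R * x \<le> \<bar>col_inner n (X \<omega>) j (\<lambda>i. lin_comb a b i \<omega>)\<bar>} \<le>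
    2 * exp (- (x\<^sup>2 / (2 * (1 + w)))) + exp (- (real n * w\<^sup>2 / 16))"
proof -
  have "(R * x)\<^sup>2 / (2 * ((1 + w) * R\<^sup>2)) = x\<^sup>2 / (2 * (1 + w))"
    using R w by (simp add: power_mult_distrib)
  then show ?thesis
    using col_inner_upper_tail[OF j a R, of w "R * x"] R w x by simp
qed

text \<open>
  All thresholds are in units of \<open>s\<close>. The threshold \<open>x1\<close> is chosen below the largest noise correlation and
  \<open>x2\<close> above it; \<open>x3\<close> is the threshold for the part of a signal's correlation that comes from outside its
  group, \<open>x0\<close> is a crude bound on the part of a correlation that comes from the other variables, \<open>e\<close> covers
  the slack of the procedures and \<open>D\<close> the interference within a group. At most \<open>m\<close> variables have
  correlation above \<open>x1\<close>, and some noise variable exceeds \<open>x1 + e\<close>; this bounds the rank from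
  above. No noise variable exceeds \<open>x2\<close>, while each of the \<open>G\<close> groups of \<open>g\<close> signals contains one that exceeds \<open>x2 + e\<close>; this bounds the rank from below. The summands
  of the bound on \<open>prob B\<close> belong, in this order, to the column norms, the inner products of distinct
  columns, the bound \<open>x0\<close>, the count above \<open>x1\<close>, the noise above \<open>x2\<close>, the noise above \<open>x1 + e\<close>, the
  groups, and the interference.
\<close>

lemma rank_bounds:
  fixes w \<eta> \<delta> e D x0 x1 x2 x3 :: real and m g G :: nat
  assumes w: "0 < w" "w < 1" and \<eta>: "\<eta> \<ge> 0" and small: "w + (real m + 1) * \<eta> \<le> 1 / 2"
    and \<delta>: "\<delta> > 0" and k: "k > 0" and D: "D \<ge> 0"
    and x: "0 \<le> x0" "0 < x1" "x1 \<le> x2" "0 \<le> x3" "0 \<le> e"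
  defines "\<mu> \<equiv> \<bar>amp\<bar> / s"
    and "rare \<equiv> exp (- (real n * w\<^sup>2 / 16))"
    and "tail \<equiv> \<lambda>x. 2 * exp (- (x\<^sup>2 / (2 * (1 + w)))) + exp (- (real n * w\<^sup>2 / 16))"
    and "hit \<equiv> \<lambda>x. \<delta> / sqrt (2 * pi) * exp (- ((x / (1 - w) + \<delta>)\<^sup>2 / 2))"
  assumes slack: "8 * (w + (real m + 1) * \<eta>) * (x0 + \<mu> * (1 + w)) \<le> e"
    and gap: "x2 + e \<le> x3 + \<mu> * (1 - w - D)" and pos: "\<mu> * (1 + w) \<le> x1"
    and groups: "G * g \<le> k" "real g \<le> w * real k"
  shows "\<exists>B\<in>events. prob B \<le>
      real p * (2 * rare) + (real p)\<^sup>2 * tail (\<eta> * sqrt (real n)) + real p * tail x0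
      + real p * tail (x1 - \<mu> * (1 + w)) / (real m + 1) + real p * tail x2
      + (exp (- (real (p - k) * hit (x1 + e))) + rare)
      + real G * (exp (- (real g * hit x3)) + rare) + real p * tail (D * sqrt (real n / (w * real k))) \<and>
    (\<forall>\<omega>\<in>space M - B. \<forall>y. (\<forall>i<n. y i = response \<omega> i) \<longrightarrow>
      (\<forall>rank\<in>{forward_stepwise_rank, lasso_rank, lar_rank}.
        G + 1 \<le> rank n p (X \<omega>) y signal \<and> rank n p (X \<omega>) y signal \<le> m + 1))"
proof -
  define U where "U j \<omega> = col_inner n (X \<omega>) j (\<lambda>i. lin_comb (without {j}) 1 i \<omega>)" for j \<omega>
  define noise where "noise = {..<p} - signal"
  define \<theta> where "\<theta> = sgn amp"
  have \<theta>: "\<bar>\<theta>\<bar> = 1" "\<theta> * amp = \<bar>amp\<bar>" using amp_nz by (auto simp: \<theta>_def sgn_if)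
  have s: "s > 0" by (rule s_pos[OF k])
  have amp: "\<bar>amp\<bar> = s * \<mu>" using s by (simp add: \<mu>_def)
  have \<mu>: "\<mu> \<ge> 0" using s by (simp add: \<mu>_def)
  obtain B where B: "\<And>t. t < G \<Longrightarrow> B t \<subseteq> signal" "\<And>t. t < G \<Longrightarrow> card (B t) = g"
    "\<And>t t'. t < G \<Longrightarrow> t' < G \<Longrightarrow> t \<noteq> t' \<Longrightarrow> B t \<inter> B t' = {}"
    using disjoint_groups_exist[OF finite_signal groups(1)[unfolded k_def]] by metis
  have Bp: "B t \<subseteq> {..<p}" if "t < G" for t using B(1)[OF that] signal_subset by (rule order_trans)
  have Bfin: "finite (B t)" if "t < G" for t using Bp[OF that] by (rule finite_subset) simp

  define rest where "rest t j \<omega> = col_inner n (X \<omega>) j (\<lambda>i. lin_comb (\<lambda>l. if l \<in> B t - {j} then 1 else 0) 0 i \<omega>)" for t j \<omega>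
  define indep_part where "indep_part t j \<omega> = col_inner n (X \<omega>) j (\<lambda>i. lin_comb (without (B t)) 1 i \<omega>)" for t j \<omega>
  have U_meas[measurable]: "U j \<in> borel_measurable M" if "j < p" for j
    unfolding U_def using that by (rule col_inner_measurable)
  have rest_meas[measurable]: "rest t j \<in> borel_measurable M" if "j < p" for t j
    unfolding rest_def using that by (rule col_inner_measurable)
  have part_meas[measurable]: "indep_part t j \<in> borel_measurable M" if "j < p" for t j
    unfolding indep_part_def using that by (rule col_inner_measurable)

  define E1 where "E1 j = {\<omega>\<in>space M. w < \<bar>gram n (X \<omega>) j j - 1\<bar>}" for j
  have E1: "E1 j \<in> events" "prob (E1 j) \<le> 2 * rare" if "j \<in> {..<p}" for j
  proof -
    have "(\<lambda>\<omega>. gram n (X \<omega>) j j) \<in> borel_measurable M" using that by (intro gram_measurable) auto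
    then show "E1 j \<in> events" unfolding E1_def by measurable
    show "prob (E1 j) \<le> 2 * rare"
      unfolding E1_def rare_def using that w by (intro column_norm_concentrates) auto
  qed
  define I2 where "I2 = {..<p} \<times> {..<p} - Id"
  define E2 where "E2 q = {\<omega>\<in>space M. \<eta> \<le> \<bar>gram n (X \<omega>) (fst q) (snd q)\<bar>}" for q
  have E2: "E2 q \<in> events" "prob (E2 q) \<le> tail (\<eta> * sqrt (real n))" if "q \<in> I2" for q
  proof -
    have "(\<lambda>\<omega>. gram n (X \<omega>) (fst q) (snd q)) \<in> borel_measurable M"
      using that by (intro gram_measurable) (auto simp: I2_def)
    then show "E2 q \<in> events" unfolding E2_def by measurable
    show "prob (E2 q) \<le> tail (\<eta> * sqrt (real n))"
    proof -
      have "fst q < p" "snd q < p" "fst q \<noteq> snd q" using that by (auto simp: I2_def)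
      from incoherence[OF this, of w \<eta>] w \<eta> show ?thesis
        by (simp add: E2_def tail_def power_mult_distrib)
    qed
  qed
  have sd1: "sd (without {j}) 1 \<le> s" if "j < p" for j
    using that by (intro sd_without_le) auto
  have U_tail: "prob {\<omega>\<in>space M. s * v \<le> \<bar>U j \<omega>\<bar>} \<le> tail v" if "j < p" "v \<ge> 0" for j v
    unfolding U_def tail_def using that
    by (intro scaled_col_inner_tail[OF that(1) _ sd1 s w]) auto
  have U_event: "{\<omega>\<in>space M. v \<le> \<bar>U j \<omega>\<bar>} \<in> events" if "j < p" for j v
    using U_meas[OF that] by measurable
  define E3 where "E3 j = {\<omega>\<in>space M. s * x0 \<le> \<bar>U j \<omega>\<bar>}" for j
  have E3: "E3 j \<in> events" "prob (E3 j) \<le> tail x0" if "j \<in> {..<p}" for j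
    using U_event U_tail that x by (auto simp: E3_def)
  \<comment> \<open>a correlation above \<open>x1\<close> forces its independent part above \<open>v1\<close>, whatever the sign of the shift\<close>
  define v1 where "v1 = x1 - \<mu> * (1 + w)"
  define E5 where "E5 j = {\<omega>\<in>space M. s * v1 \<le> \<bar>U j \<omega>\<bar>}" for j
  have E5: "E5 j \<in> events" "prob (E5 j) \<le> tail v1" if "j \<in> {..<p}" for j
    using U_event U_tail that pos by (auto simp: E5_def v1_def)
  define F5 where "F5 = {\<omega>\<in>space M. m < card {j\<in>{..<p}. \<omega> \<in> E5 j}}"
  have F5: "F5 \<in> events" "prob F5 \<le> real p * tail v1 / (real m + 1)"
    using prob_many_events_le[of "{..<p}" E5 "tail v1" m] E5 by (auto simp: F5_def)
  define E6 where "E6 j = {\<omega>\<in>space M. s * x2 \<le> \<bar>U j \<omega>\<bar>}" for j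
  have E6: "E6 j \<in> events" "prob (E6 j) \<le> tail x2" if "j \<in> {..<p}" for j
    using U_event U_tail that x by (auto simp: E6_def)
  \<comment> \<open>one factor \<open>sqrt (1 - w)\<close> is for the random norm and one for the signals left out; together they give the \<open>1 - w\<close> in \<open>hit\<close>\<close>
  have R: "0 < sqrt (1 - w) * s" using s w by simp
  have hit: "\<delta> / sqrt (2 * pi) * exp (- ((s * v / (sqrt (1 - w) * (sqrt (1 - w) * s)) + \<delta>)\<^sup>2 / 2)) = hit v" for v
  proof -
    have "sqrt (1 - w) * (sqrt (1 - w) * s) = (1 - w) * s" using w by (simp add: mult.assoc[symmetric])
    then show ?thesis using s by (simp add: hit_def)
  qed
  define F4 where "F4 = {\<omega>\<in>space M. \<forall>j\<in>noise. 1 * col_inner n (X \<omega>) j (\<lambda>i. lin_comb \<beta> 1 i \<omega>) < s * (x1 + e)}"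
  have F4: "F4 \<in> events" "prob F4 \<le> exp (- (real (p - k) * hit (x1 + e))) + rare"
  proof -
    have "(\<lambda>\<omega>. col_inner n (X \<omega>) j (\<lambda>i. lin_comb \<beta> 1 i \<omega>)) \<in> borel_measurable M" if "j \<in> noise" for j
      using that by (intro col_inner_measurable) (auto simp: noise_def)
    then show "F4 \<in> events" unfolding F4_def mult_1
      by (intro sets.sets_Collect_finite_All borel_measurable_less) (auto simp: noise_def)
    have card: "card noise = p - k"
      unfolding noise_def k_def using signal_subset by (simp add: card_Diff_subset finite_signal)
    have "sqrt (1 - w) * s \<le> 1 * s" using w s by (intro mult_right_mono) auto
    then have "sqrt (1 - w) * s \<le> sd \<beta> 1" by (simp add: s_def)
    moreover have "noise \<subseteq> {..<p}" by (auto simp: noise_def)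
    moreover have "0 \<le> s * (x1 + e)" using x s by simp
    moreover have "\<beta> j = 0" if "j \<in> noise" for j using that by (auto simp: noise_def signal_def)
    ultimately show "prob F4 \<le> exp (- (real (p - k) * hit (x1 + e))) + rare"
      unfolding F4_def rare_def hit[symmetric] card[symmetric]
      by (intro all_col_inners_small R w \<delta>) simp_all
  qed
  define E7 where "E7 t = {\<omega>\<in>space M. \<forall>j\<in>B t. \<theta> * indep_part t j \<omega> < s * x3}" for t
  have E7: "E7 t \<in> events" "prob (E7 t) \<le> exp (- (real g * hit x3)) + rare" if "t \<in> {..<G}" for t
  proof -
    have t: "t < G" using that by simp
    have "indep_part t j \<in> borel_measurable M" if "j \<in> B t" for j
      using that Bp[OF t] by (intro part_meas) auto
    then show "E7 t \<in> events" unfolding E7_def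
      by (intro sets.sets_Collect_finite_All borel_measurable_less Bfin[OF t] borel_measurable_times) auto
    have "sqrt (1 - w) * s \<le> sd (without (B t)) 1"
      using groups(2) w B(2)[OF t] by (intro sd_without_ge[OF B(1)[OF t]]) auto
    moreover have "0 \<le> s * x3" using x s by simp
    ultimately show "prob (E7 t) \<le> exp (- (real g * hit x3)) + rare"
      unfolding E7_def indep_part_def rare_def hit[symmetric] B(2)[OF t, symmetric]
      by (intro all_col_inners_small R w \<delta> \<theta>(1) Bp[OF t]) simp_all
  qed
  define I8 where "I8 = Sigma {..<G} B"
  have I8: "finite I8" "card I8 \<le> p"
  proof -
    show "finite I8" unfolding I8_def using Bfin by auto
    have "card I8 = (\<Sum>t\<in>{..<G}. card (B t))" unfolding I8_def using Bfin by (intro card_SigmaI) auto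
    also have "\<dots> = G * g" using B(2) by simp
    also have "\<dots> \<le> k" by (rule groups)
    also have "k \<le> p" unfolding k_def using card_mono[OF finite_lessThan signal_subset] by simp
    finally show "card I8 \<le> p" .
  qed
  define E8 where "E8 q = {\<omega>\<in>space M. D \<le> \<bar>rest (fst q) (snd q) \<omega>\<bar>}" for q
  have E8: "E8 q \<in> events" "prob (E8 q) \<le> tail (D * sqrt (real n / (w * real k)))" if q8: "q \<in> I8" for q
  proof -
    obtain t j where q: "q = (t, j)" "t < G" "j \<in> B t" using q8 by (auto simp: I8_def)
    then have j: "j < p" using Bp by auto
    show "E8 q \<in> events" unfolding E8_def q fst_conv snd_conv using rest_meas[OF j, of t] by measurable
    let ?R = "sqrt (w * real k / real n)"
    have "card (B t - {j}) \<le> card (B t)" using Bfin[OF q(2)] by (intro card_mono) auto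
    then have "real (card (B t - {j})) \<le> w * real k" using B(2)[OF q(2)] groups(2) by simp
    moreover have "B t - {j} \<subseteq> {..<p}" using Bp[OF q(2)] by auto
    ultimately have R: "sd (\<lambda>l. if l \<in> B t - {j} then 1 else 0) 0 \<le> ?R"
      by (subst sd_sum_ind) (auto intro!: real_sqrt_le_mono divide_right_mono)
    have Rpos: "?R > 0" using w k n_pos by simp
    have "?R * (D * sqrt (real n / (w * real k))) = D"
      using w k n_pos by (simp add: real_sqrt_divide)
    with scaled_col_inner_tail[OF j _ R Rpos w, of "D * sqrt (real n / (w * real k))"] w D
    show "prob (E8 q) \<le> tail (D * sqrt (real n / (w * real k)))"
      unfolding E8_def q fst_conv snd_conv rest_def tail_def by simp
  qed

  define Bad where "Bad = (\<Union>j\<in>{..<p}. E1 j) \<union> (\<Union>q\<in>I2. E2 q) \<union> (\<Union>j\<in>{..<p}. E3 j) \<union> F5 \<union>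
    (\<Union>j\<in>{..<p}. E6 j) \<union> F4 \<union> (\<Union>t\<in>{..<G}. E7 t) \<union> (\<Union>q\<in>I8. E8 q)"
  have I2: "finite I2" "real (card I2) \<le> (real p)\<^sup>2"
  proof -
    show "finite I2" by (simp add: I2_def)
    have "card I2 \<le> card ({..<p} \<times> {..<p})" unfolding I2_def by (intro card_mono) auto
    then have "card I2 \<le> p * p" by simp
    then show "real (card I2) \<le> (real p)\<^sup>2" by (metis of_nat_le_iff of_nat_mult power2_eq_square)
  qed
  have tail_nonneg: "tail v \<ge> 0" for v by (simp add: tail_def)
  have u1: "prob (\<Union>j\<in>{..<p}. E1 j) \<le> real p * (2 * rare)"
    using prob_UN_le[of "{..<p}" E1 "2 * rare"] E1 by simp
  have u2: "prob (\<Union>q\<in>I2. E2 q) \<le> (real p)\<^sup>2 * tail (\<eta> * sqrt (real n))"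
    using order_trans[OF prob_UN_le[OF I2(1) E2] mult_right_mono[OF I2(2) tail_nonneg]] .
  have u3: "prob (\<Union>j\<in>{..<p}. E3 j) \<le> real p * tail x0"
    using prob_UN_le[of "{..<p}" E3 "tail x0"] E3 by simp
  have u6: "prob (\<Union>j\<in>{..<p}. E6 j) \<le> real p * tail x2"
    using prob_UN_le[of "{..<p}" E6 "tail x2"] E6 by simp
  have u7: "prob (\<Union>t\<in>{..<G}. E7 t) \<le> real G * (exp (- (real g * hit x3)) + rare)"
    using prob_UN_le[of "{..<G}" E7 "exp (- (real g * hit x3)) + rare"] E7 by simp
  have u8: "prob (\<Union>q\<in>I8. E8 q) \<le> real p * tail (D * sqrt (real n / (w * real k)))"
    using order_trans[OF prob_UN_le[OF I8(1) E8] mult_right_mono[OF _ tail_nonneg]] I8(2) by simp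
  have ev: "(\<Union>j\<in>{..<p}. E1 j) \<in> events" "(\<Union>q\<in>I2. E2 q) \<in> events" "(\<Union>j\<in>{..<p}. E3 j) \<in> events"
    "(\<Union>j\<in>{..<p}. E6 j) \<in> events" "(\<Union>t\<in>{..<G}. E7 t) \<in> events" "(\<Union>q\<in>I8. E8 q) \<in> events"
    using E1(1) E2(1) E3(1) E6(1) E7(1) E8(1) I2(1) I8(1) by (auto intro!: sets.finite_UN)
  have Bad_event: "Bad \<in> events" unfolding Bad_def using ev F4(1) F5(1) by simp
  have un: "prob (A \<union> A') \<le> a + a'" if "A \<in> events" "A' \<in> events" "prob A \<le> a" "prob A' \<le> a'" for A A' a a'
    using measure_Un_le[OF that(1,2)] that(3,4) by linarith
  have Bad_prob: "prob Bad \<le> real p * (2 * rare) + (real p)\<^sup>2 * tail (\<eta> * sqrt (real n)) + real p * tail x0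
      + real p * tail v1 / (real m + 1) + real p * tail x2
      + (exp (- (real (p - k) * hit (x1 + e))) + rare)
      + real G * (exp (- (real g * hit x3)) + rare) + real p * tail (D * sqrt (real n / (w * real k)))"
    unfolding Bad_def using ev F4(1) F5(1)
    by (intro un u1 u2 u3 F5(2) u6 F4(2) u7 u8 sets.Un)

  have good: "G + 1 \<le> rank n p (X \<omega>) y signal \<and> rank n p (X \<omega>) y signal \<le> m + 1"
    if \<omega>: "\<omega> \<in> space M - Bad" and y: "\<And>i. i < n \<Longrightarrow> y i = response \<omega> i"
      and rank: "rank \<in> {forward_stepwise_rank, lasso_rank, lar_rank}" for \<omega> y rank
  proof -
    have sp: "\<omega> \<in> space M" using \<omega> by simp
    have g1: "\<bar>gram n (X \<omega>) j j - 1\<bar> \<le> w" if "j < p" for j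
      using \<omega> that by (force simp: Bad_def E1_def)
    have g2: "\<bar>gram n (X \<omega>) i j\<bar> \<le> \<eta>" if "i < p" "j < p" "i \<noteq> j" for i j
    proof -
      have "\<omega> \<notin> E2 (i, j)" using \<omega> that by (auto simp: Bad_def I2_def)
      then show ?thesis using sp by (simp add: E2_def)
    qed
    have g3: "\<bar>U j \<omega>\<bar> < s * x0" if "j < p" for j
      using \<omega> that by (force simp: Bad_def E3_def)
    have yc: "col_inner n (X \<omega>) j y = col_inner n (X \<omega>) j (response \<omega>)" for j
      unfolding col_inner_def using y by (intro sum.cong) auto
    have split: "col_inner n (X \<omega>) j y = U j \<omega> + \<beta> j * gram n (X \<omega>) j j" if "j < p" for j
      unfolding yc U_def by (rule corr_split_single[OF that])
    have shift: "\<bar>\<beta> j * gram n (X \<omega>) j j\<bar> \<le> s * (\<mu> * (1 + w))" if "j < p" for j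
    proof -
      have "\<bar>\<beta> j * gram n (X \<omega>) j j\<bar> \<le> \<bar>amp\<bar> * (1 + w)"
        unfolding abs_mult using \<beta>_abs_le[OF that] g1[OF that] by (intro mult_mono) auto
      then show ?thesis by (simp add: amp mult.assoc)
    qed
    define Q where "Q = s * (x0 + \<mu> * (1 + w))"
    have "near_orthonormal_response n p (X \<omega>) w \<eta> m y Q"
    proof
      show "\<bar>col_inner n (X \<omega>) j y\<bar> \<le> Q" if "j < p" for j
        using split[OF that] shift[OF that] g3[OF that] unfolding Q_def distrib_left by linarith
      have "x0 + \<mu> * (1 + w) > 0"
      proof -
        have "\<mu> > 0" using s amp_nz by (simp add: \<mu>_def)
        then show ?thesis using x w by (intro add_nonneg_pos) auto
      qed
      then show "Q > 0" using s by (simp add: Q_def)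
    qed (use g1 g2 w \<eta> small in auto)
    then interpret D: near_orthonormal_response n p "X \<omega>" w \<eta> m y Q .
    have slack_le: "D.slack \<le> s * e"
    proof -
      have "D.slack = s * (8 * (w + (real m + 1) * \<eta>) * (x0 + \<mu> * (1 + w)))"
        unfolding D.slack_def unfolding Q_def by (simp only: mult_ac)
      also have "\<dots> \<le> s * e" using slack s by (intro mult_left_mono) auto
      finally show ?thesis .
    qed
    have "p > 0"
    proof -
      have "signal \<noteq> {}" using k by (auto simp: k_def)
      then show ?thesis using signal_subset by auto
    qed
    obtain \<S> where \<S>: "rank n p (X \<omega>) y signal = first_noise_rank signal \<S>" "D.tracks \<S>"
      using rank D.tracks_forward_stepwise D.tracks_lasso D.tracks_lar[OF \<open>p > 0\<close>]
      unfolding forward_stepwise_rank_def lasso_rank_def lar_rank_def by (auto simp: fun_eq_iff)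
    have few: "card (D.strong (s * v)) \<le> m" if "x1 \<le> v" for v
    proof -
      have "D.strong (s * v) \<subseteq> {j\<in>{..<p}. \<omega> \<in> E5 j}"
      proof
        fix j assume "j \<in> D.strong (s * v)"
        then have j: "j < p" "s * v \<le> \<bar>col_inner n (X \<omega>) j y\<bar>" by (auto simp: D.strong_def)
        have "s * x1 \<le> s * v" using that s by (intro mult_left_mono) auto
        then have "s * v1 \<le> \<bar>U j \<omega>\<bar>"
          using split[OF j(1)] shift[OF j(1)] j(2) unfolding v1_def right_diff_distrib by linarith
        with j(1) sp show "j \<in> {j\<in>{..<p}. \<omega> \<in> E5 j}" by (simp add: E5_def)
      qed
      then have "card (D.strong (s * v)) \<le> card {j\<in>{..<p}. \<omega> \<in> E5 j}" by (intro card_mono) auto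
      also have "\<dots> \<le> m" using \<omega> by (auto simp: Bad_def F5_def)
      finally show ?thesis .
    qed
    have "rank n p (X \<omega>) y signal \<le> m + 1"
    proof -
      obtain j where j: "j \<in> noise" "s * (x1 + e) \<le> col_inner n (X \<omega>) j (\<lambda>i. lin_comb \<beta> 1 i \<omega>)"
        using \<omega> by (force simp: Bad_def F4_def)
      have "col_inner n (X \<omega>) j y = col_inner n (X \<omega>) j (\<lambda>i. lin_comb \<beta> 1 i \<omega>)"
        unfolding yc by (simp add: response_def[abs_def])
      then have "j \<in> D.strong (s * x1 + D.slack)" "j \<notin> signal"
        using j slack_le unfolding distrib_left by (auto simp: D.strong_def noise_def)
      then show ?thesis
        unfolding \<S>(1) using s x by (intro D.first_noise_rank_le[OF \<S>(2) _ few]) auto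
    qed
    moreover have "G + 1 \<le> rank n p (X \<omega>) y signal"
    proof -
      have sub: "D.strong (s * x2) \<subseteq> signal"
      proof
        fix j assume "j \<in> D.strong (s * x2)"
        then have j: "j < p" "s * x2 \<le> \<bar>col_inner n (X \<omega>) j y\<bar>" by (auto simp: D.strong_def)
        have "\<bar>U j \<omega>\<bar> < s * x2" using \<omega> j(1) by (force simp: Bad_def E6_def)
        with j split[OF j(1)] show "j \<in> signal" by (auto simp: signal_def)
      qed
      have "\<exists>j\<in>B t. j \<in> D.strong (s * x2 + D.slack)" if t: "t < G" for t
      proof -
        have "\<omega> \<notin> E7 t" using \<omega> t by (auto simp: Bad_def)
        then obtain j where j: "j \<in> B t" "s * x3 \<le> \<theta> * indep_part t j \<omega>"
          using sp by (auto simp: E7_def not_less)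
        have jp: "j < p" using j Bp[OF t] by auto
        have "\<omega> \<notin> E8 (t, j)" using \<omega> t j(1) by (auto simp: Bad_def I8_def)
        then have rest: "\<bar>rest t j \<omega>\<bar> \<le> D" using sp by (simp add: E8_def)
        have "col_inner n (X \<omega>) j y = indep_part t j \<omega> + amp * gram n (X \<omega>) j j + amp * rest t j \<omega>"
          unfolding yc indep_part_def rest_def by (rule corr_split_group[OF B(1)[OF t] j(1)])
        then have "\<theta> * col_inner n (X \<omega>) j y =
            \<theta> * indep_part t j \<omega> + (\<theta> * amp) * gram n (X \<omega>) j j + (\<theta> * amp) * rest t j \<omega>"
          by (simp add: distrib_left mult.assoc)
        also have "\<dots> = \<theta> * indep_part t j \<omega> + \<bar>amp\<bar> * (gram n (X \<omega>) j j + rest t j \<omega>)"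
          by (simp add: \<theta>(2) distrib_left)
        also have "\<dots> \<ge> s * x3 + \<bar>amp\<bar> * (1 - w - D)"
          using j(2) g1[OF jp] rest by (intro add_mono mult_left_mono) auto
        also have "s * x3 + \<bar>amp\<bar> * (1 - w - D) = s * (x3 + \<mu> * (1 - w - D))"
          unfolding amp by (simp add: distrib_left mult.assoc)
        also have "\<dots> \<ge> s * (x2 + e)" using gap s by (intro mult_left_mono) auto
        finally have "s * (x2 + e) \<le> \<theta> * col_inner n (X \<omega>) j y" .
        also have "\<dots> \<le> \<bar>\<theta> * col_inner n (X \<omega>) j y\<bar>" by (rule abs_ge_self)
        also have "\<dots> = \<bar>col_inner n (X \<omega>) j y\<bar>" unfolding abs_mult \<theta>(1) by simp
        finally have "s * x2 + D.slack \<le> \<bar>col_inner n (X \<omega>) j y\<bar>"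
          using slack_le unfolding distrib_left by linarith
        with j(1) jp show ?thesis by (auto simp: D.strong_def)
      qed
      then obtain pick where pick: "\<And>t. t < G \<Longrightarrow> pick t \<in> B t" "\<And>t. t < G \<Longrightarrow> pick t \<in> D.strong (s * x2 + D.slack)"
        by metis
      have "inj_on pick {..<G}"
      proof (rule inj_onI)
        fix t t' assume "t \<in> {..<G}" "t' \<in> {..<G}" "pick t = pick t'"
        then have "pick t \<in> B t \<inter> B t'" "t < G" "t' < G" using pick(1)[of t] pick(1)[of t'] by auto
        then show "t = t'" using B(3)[of t t'] by auto
      qed
      then have "G = card (pick ` {..<G})" by (simp add: card_image)
      also have "\<dots> \<le> card (D.strong (s * x2 + D.slack))"
        using pick(2) by (intro card_mono D.finite_strong) auto
      finally have "G + 1 \<le> card (D.strong (s * x2 + D.slack)) + 1" by simp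
      also have "\<dots> \<le> first_noise_rank signal \<S>"
        using s x by (intro D.first_noise_rank_ge[OF \<S>(2) _ few sub]) auto
      finally show ?thesis unfolding \<S>(1) .
    qed
    ultimately show ?thesis by blast
  qed
  show ?thesis
    using Bad_event Bad_prob good unfolding v1_def by blast
qed

end

section \<open>Choice of the thresholds\<close>

text \<open>
  The perturbations of the threshold that come with \<open>w\<close> and with the width \<open>1 / sqrt u\<close> cost only a
  constant in the exponent, since \<open>y\<^sup>2 * w\<close> and \<open>y / sqrt u\<close> are bounded.
\<close>

lemma hit_exponent_le:
  fixes u y w :: real
  assumes u: "u \<ge> 1" and y: "0 \<le> y" "y \<le> sqrt (2 * u)" and w: "0 \<le> w" "w \<le> 1 / 2" "w * u \<le> 1 / 6"
  shows "(y / (1 - w) + 1 / sqrt u)\<^sup>2 / 2 \<le> y\<^sup>2 / 2 + 5"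
proof -
  let ?d = "1 / sqrt u"
  have inv: "1 / (1 - w) \<le> 1 + 2 * w"
  proof -
    have "w * w \<le> w * (1 / 2)" using w by (intro mult_left_mono) auto
    then have "1 \<le> (1 + 2 * w) * (1 - w)" by (simp add: algebra_simps)
    then show ?thesis using w by (simp add: pos_divide_le_eq)
  qed
  have "y / (1 - w) \<le> y * (1 + 2 * w)"
    using mult_left_mono[OF inv y(1)] by simp
  then have "(y / (1 - w) + ?d)\<^sup>2 \<le> (y * (1 + 2 * w) + ?d)\<^sup>2"
    using y w u by (intro power_mono add_mono add_nonneg_nonneg) auto
  also have "\<dots> = y\<^sup>2 + y\<^sup>2 * w * (4 + 4 * w) + 2 * (y * ?d) * (1 + 2 * w) + ?d\<^sup>2"
  proof -
    have "(y * (1 + 2 * w) + d)\<^sup>2 = y\<^sup>2 + y\<^sup>2 * w * (4 + 4 * w) + 2 * (y * d) * (1 + 2 * w) + d\<^sup>2" for d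
      by (simp add: power2_eq_square algebra_simps)
    then show ?thesis .
  qed
  also have "\<dots> \<le> y\<^sup>2 + 2 + 6 + 1"
  proof (intro add_mono order_refl)
    have "y\<^sup>2 \<le> (sqrt (2 * u))\<^sup>2" using y by (intro power_mono) auto
    then have "y\<^sup>2 * w \<le> 2 * u * w" using u w by (intro mult_right_mono) auto
    also have "\<dots> \<le> 1 / 3" using w by (simp add: mult.commute)
    finally have "y\<^sup>2 * w * (4 + 4 * w) \<le> 1 / 3 * 6" using w by (intro mult_mono) auto
    then show "y\<^sup>2 * w * (4 + 4 * w) \<le> 2" by simp
    have "y * ?d \<le> sqrt (2 * u) * ?d" using y u by (intro mult_right_mono) auto
    also have "\<dots> = sqrt 2" using u by (simp add: real_sqrt_mult)
    also have "\<dots> \<le> 3 / 2" by (intro real_le_lsqrt) (auto simp: power2_eq_square)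
    finally have "y * ?d \<le> 3 / 2" .
    then have "2 * (y * ?d) * (1 + 2 * w) \<le> 3 * 2"
      using w by (intro mult_mono) linarith+
    then show "2 * (y * ?d) * (1 + 2 * w) \<le> 6" by simp
    show "?d\<^sup>2 \<le> 1" using u by (simp add: power_divide)
  qed
  finally show ?thesis by simp
qed

lemma hit_ge:
  fixes u y w :: real
  assumes u: "u \<ge> 1" and y: "0 \<le> y" "y \<le> sqrt (2 * u)" and w: "0 \<le> w" "w \<le> 1 / 2" "w * u \<le> 1 / 6"
  shows "exp (- (y\<^sup>2 / 2) - ln u / 2 - 7) \<le>
    1 / sqrt u / sqrt (2 * pi) * exp (- ((y / (1 - w) + 1 / sqrt u)\<^sup>2 / 2))"
proof -
  have "exp (ln u / 2) = sqrt u" using u by (simp add: ln_sqrt[symmetric])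
  then have su: "1 / sqrt u = exp (- (ln u / 2))" by (simp add: exp_minus field_simps)
  have "sqrt (2 * pi) \<le> 3" using pi_less_4 by (intro real_le_lsqrt) auto
  also have "3 \<le> exp (2::real)" using exp_ge_add_one_self[of 2] by simp
  finally have "exp (- 2) \<le> 1 / sqrt (2 * pi)" using pi_gt_zero by (simp add: exp_minus field_simps)
  then have A: "exp (- (ln u / 2)) * exp (- 2) \<le> exp (- (ln u / 2)) * (1 / sqrt (2 * pi))"
    by (intro mult_left_mono) auto
  have B: "exp (- (y\<^sup>2 / 2) - 5) \<le> exp (- ((y / (1 - w) + 1 / sqrt u)\<^sup>2 / 2))"
    using hit_exponent_le[OF assms] by simp
  have "exp (- (ln u / 2)) * exp (- 2) * exp (- (y\<^sup>2 / 2) - 5) \<le>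
      exp (- (ln u / 2)) * (1 / sqrt (2 * pi)) * exp (- ((y / (1 - w) + 1 / sqrt u)\<^sup>2 / 2))"
    by (rule mult_mono[OF A B]) simp_all
  moreover have "exp (- (ln u / 2)) * exp (- 2) * exp (- (y\<^sup>2 / 2) - 5) = exp (- (y\<^sup>2 / 2) - ln u / 2 - 7)"
    by (simp add: exp_add[symmetric] algebra_simps)
  ultimately show ?thesis by (simp only: su times_divide_eq_right mult_1_right)
qed

lemma gaussian_exponent_ge:
  fixes w x A u :: real
  assumes w: "0 \<le> w" and x: "2 * A \<le> x\<^sup>2" and A: "A - w * A \<ge> B"  "w \<le> 1"
  shows "B \<le> x\<^sup>2 / (2 * (1 + w))"
proof -
  have "(1 - w) * (1 + w) \<le> 1" by (simp add: algebra_simps)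
  then have "1 - w \<le> 1 / (1 + w)" using w by (simp add: pos_le_divide_eq)
  then have "(1 - w) * (x\<^sup>2 / 2) \<le> 1 / (1 + w) * (x\<^sup>2 / 2)" by (intro mult_right_mono) auto
  moreover have "(1 - w) * A \<le> (1 - w) * (x\<^sup>2 / 2)" using x A by (intro mult_left_mono) auto
  ultimately show ?thesis using A by (simp add: algebra_simps)
qed

text \<open>
  The choice of all parameters of \<open>rank_bounds\<close> for one problem of the sequence, with \<open>x0 = 3 * sqrt u\<close>,
  \<open>e = \<epsilon> * a / 2\<close>, \<open>D = \<epsilon> / 2\<close> and width \<open>1 / sqrt u\<close>. Moving a threshold near \<open>sqrt (2 * u)\<close> by \<open>\<epsilon> * a\<close> changes the
  exponent of the normal tail by about \<open>\<epsilon> * L\<close>, which is the resolution at which \<open>m\<close> and \<open>G\<close> are chosen.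
  The assumptions are the inequalities between \<open>u\<close>, \<open>L\<close> and the dimensions that hold far out in the
  sequence. The number \<open>\<kappa>\<close> measures by how much \<open>k\<close> may fall short of \<open>p\<close>, on the logarithmic scale.
\<close>

locale tuning =
  fixes u a L C \<epsilon> w \<mu> \<kappa> :: real and n p k :: nat
  assumes eps: "0 < \<epsilon>" "\<epsilon> \<le> 1 / 40"
    and p_eq: "real p = exp u" and u_ge: "u \<ge> 4" and a: "0 < a" "a \<le> C" and L_eq: "L = a * sqrt (2 * u)"
    and \<mu>: "(1 - \<epsilon>) * a \<le> \<mu>" "\<mu> \<le> a" and w_eq: "w = 1 / u ^ 3"
    and w_small: "w \<le> \<epsilon> / 2" "u * w \<le> \<epsilon> * L / 4"
    and C_small: "3 * C \<le> sqrt u" and L_ge: "L \<ge> 1"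
    and n_large: "3 * u \<le> real n * w\<^sup>2 / 16" "3 * u \<le> exp (- (u / 4)) * real n / 4"
    and m_small: "2 * exp (2 * L) * exp (- (u / 8)) \<le> w"
    and w_tiny: "64 * w * sqrt u \<le> \<epsilon> * a / 2"
    and k_le: "real k \<le> 0.99 * real p" and k_ge: "exp (u - \<kappa>) \<le> real k" and \<kappa>: "\<kappa> \<ge> 0"
    and L_large: "\<kappa> + ln u + C\<^sup>2 + 20 \<le> \<epsilon> * L / 4"
    and L_le: "\<kappa> + L + 4 \<le> u" and exp_large: "2 * L \<le> exp (4 * \<epsilon> * L)"
    and u_large: "96 \<le> \<epsilon>\<^sup>2 * u" and a_eq: "a = sqrt (real n / real k)"
begin

definition "\<eta> = exp (- (u / 8))"
definition "m = nat \<lfloor>exp ((1 + 4 * \<epsilon>) * L)\<rfloor>"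
definition "G = nat \<lceil>exp ((1 - 9 * \<epsilon>) * L)\<rceil>"
definition "g = k div G"
definition "rare = exp (- (real n * w\<^sup>2 / 16))"
definition "tail x = 2 * exp (- (x\<^sup>2 / (2 * (1 + w)))) + exp (- (real n * w\<^sup>2 / 16))"
definition "hit x = 1 / sqrt u / sqrt (2 * pi) * exp (- ((x / (1 - w) + 1 / sqrt u)\<^sup>2 / 2))"
definition "x1 = sqrt (2 * u) - \<epsilon> * a"
definition "x2 = sqrt (2 * u) + \<epsilon> * a"
definition "x3 = sqrt (2 * u) - (1 - 4 * \<epsilon>) * a"

lemma w: "0 < w" "w < 1" "w \<le> 1 / 4" "w * u \<le> 1 / 6"
proof -
  show "0 < w" using u_ge by (simp add: w_eq)
  show "w < 1" "w \<le> 1 / 4" using w_small eps by auto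
  have "w * u = 1 / u\<^sup>2" using u_ge by (simp add: w_eq power2_eq_square power3_eq_cube)
  also have "\<dots> \<le> 1 / 4\<^sup>2" using u_ge by (intro divide_left_mono power_mono) auto
  finally show "w * u \<le> 1 / 6" by simp
qed

lemma sqrt_2u: "sqrt u \<le> sqrt (2 * u)" "(sqrt (2 * u))\<^sup>2 = 2 * u" "sqrt (2 * u) * a = L" "sqrt u \<ge> 2"
proof -
  show "sqrt u \<le> sqrt (2 * u)" "(sqrt (2 * u))\<^sup>2 = 2 * u" using u_ge by auto
  show "sqrt (2 * u) * a = L" by (simp add: L_eq)
  show "sqrt u \<ge> 2" using u_ge by (intro real_le_rsqrt) auto
qed

lemma m_bounds: "exp ((1 + 4 * \<epsilon>) * L) \<le> real m + 1" "real m + 1 \<le> exp ((1 + 5 * \<epsilon>) * L)"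
  "(real m + 1) * \<eta> \<le> w"
proof -
  have m: "real m = of_int \<lfloor>exp ((1 + 4 * \<epsilon>) * L)\<rfloor>" by (simp add: m_def)
  show "exp ((1 + 4 * \<epsilon>) * L) \<le> real m + 1" unfolding m by linarith
  have le: "real m \<le> exp ((1 + 4 * \<epsilon>) * L)" unfolding m by linarith
  have "1 \<le> exp ((1 + 4 * \<epsilon>) * L)" using eps L_ge by simp
  have "0 \<le> ln u" using u_ge by simp
  then have "\<epsilon> * L \<ge> 1" using L_large \<kappa> zero_le_power2[of C] by linarith
  then have "2 \<le> exp (\<epsilon> * L)" using exp_ge_add_one_self[of "\<epsilon> * L"] by linarith
  then have "2 * exp ((1 + 4 * \<epsilon>) * L) \<le> exp (\<epsilon> * L) * exp ((1 + 4 * \<epsilon>) * L)" by (intro mult_right_mono) auto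
  also have "\<dots> = exp ((1 + 5 * \<epsilon>) * L)" by (simp add: exp_add[symmetric] algebra_simps)
  finally show up: "real m + 1 \<le> exp ((1 + 5 * \<epsilon>) * L)" using le \<open>1 \<le> exp ((1 + 4 * \<epsilon>) * L)\<close> by linarith
  have "(1 + 5 * \<epsilon>) * L \<le> 2 * L" using eps L_ge by (intro mult_right_mono) auto
  with up have "real m + 1 \<le> exp (2 * L)" using exp_le_cancel_iff order_trans by blast
  then have "(real m + 1) * \<eta> \<le> exp (2 * L) * \<eta>" by (intro mult_right_mono) (auto simp: \<eta>_def)
  also have "\<dots> \<le> 2 * exp (2 * L) * exp (- (u / 8))" by (simp add: \<eta>_def)
  also note m_small
  finally show "(real m + 1) * \<eta> \<le> w" .
qed

lemma G_bounds: "exp ((1 - 9 * \<epsilon>) * L) \<le> real G" "real G \<le> 2 * exp ((1 - 9 * \<epsilon>) * L)" "G > 0"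
proof -
  have pos: "exp ((1 - 9 * \<epsilon>) * L) > 0" by simp
  have G: "real G = of_int \<lceil>exp ((1 - 9 * \<epsilon>) * L)\<rceil>" using pos by (simp add: G_def)
  show "exp ((1 - 9 * \<epsilon>) * L) \<le> real G" unfolding G by linarith
  with pos have "real G > 0" by linarith
  then show "G > 0" by simp
  have "1 \<le> exp ((1 - 9 * \<epsilon>) * L)" using eps L_ge by simp
  then show "real G \<le> 2 * exp ((1 - 9 * \<epsilon>) * L)" unfolding G by linarith
qed

lemma ln_u: "0 \<le> ln u" "ln u \<le> \<epsilon> * L / 4"
proof -
  show "0 \<le> ln u" using u_ge by simp
  show "ln u \<le> \<epsilon> * L / 4" using L_large \<kappa> zero_le_power2[of C] by linarith
qed

lemma G_large: "1 / real G \<le> w"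
proof -
  have "\<epsilon> * L \<le> 1 / 40 * L" using eps L_ge by (intro mult_right_mono) auto
  moreover have "(1 - 9 * \<epsilon>) * L = L - 9 * (\<epsilon> * L)" by (simp add: algebra_simps)
  ultimately have "3 * ln u \<le> (1 - 9 * \<epsilon>) * L"
    using ln_u(2) L_ge by linarith
  then have "exp (3 * ln u) \<le> real G" using G_bounds(1) exp_le_cancel_iff order_trans by blast
  moreover have "exp (3 * ln u) = u ^ 3" using u_ge by (simp add: exp_of_nat_mult[of 3, simplified])
  ultimately show ?thesis
    using u_ge G_bounds(3) unfolding w_eq by (intro divide_left_mono mult_pos_pos) auto
qed

lemma groups: "G * g \<le> k" "real g \<le> w * real k"
proof -
  show "G * g \<le> k" by (simp add: g_def)
  then have "real G * real g \<le> real k" by (metis of_nat_le_iff of_nat_mult)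
  then have "real g \<le> 1 / real G * real k" using G_bounds(3) by (simp add: field_simps)
  also have "\<dots> \<le> w * real k" by (intro mult_right_mono G_large) auto
  finally show "real g \<le> w * real k" .
qed

lemma g_ge: "real k / (2 * real G) \<le> real g"
proof -
  have "exp (ln 4 + L) \<le> exp (u - \<kappa>)"
    using L_le ln_le_minus_one[of 4] by simp
  then have "4 * exp L \<le> real k" using k_ge by (simp add: exp_add)
  moreover have "exp ((1 - 9 * \<epsilon>) * L) \<le> exp L" using eps L_ge by (simp add: mult_left_le_one_le algebra_simps)
  ultimately have "2 * real G \<le> real k" using G_bounds(2) by linarith
  have "k < G * (g + 1)" using G_bounds(3) by (simp add: g_def) (metis dividend_less_times_div mult.commute)
  then have "real k \<le> real G * (real g + 1)" by (metis less_imp_le of_nat_1 of_nat_add of_nat_le_iff of_nat_mult)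
  then have "real k - real G \<le> real G * real g" by (simp add: algebra_simps)
  with \<open>2 * real G \<le> real k\<close> have "real k / 2 \<le> real G * real g" by linarith
  then show ?thesis using G_bounds(3) by (simp add: field_simps)
qed

lemma \<mu>_bounds: "0 \<le> \<mu>" "\<mu> * (1 + w) \<le> (1 + \<epsilon>) * a"
proof -
  have "0 \<le> (1 - \<epsilon>) * a" using eps a by simp
  with \<mu>(1) show "0 \<le> \<mu>" by linarith
  then have "\<mu> * (1 + w) \<le> a * (1 + \<epsilon>)" using \<mu> w w_small eps a by (intro mult_mono) auto
  then show "\<mu> * (1 + w) \<le> (1 + \<epsilon>) * a" by (simp add: mult.commute)
qed

lemma a_small: "3 * a \<le> sqrt (2 * u)" "\<epsilon> * a \<le> a / 40" "\<epsilon> * a > 0"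
proof -
  show "3 * a \<le> sqrt (2 * u)" using C_small a(2) sqrt_2u(1) by linarith
  show "\<epsilon> * a \<le> a / 40" using mult_right_mono[OF eps(2), of a] a by simp
  show "\<epsilon> * a > 0" using eps a by simp
qed

lemma thresholds: "0 < x1" "x1 \<le> x2" "0 \<le> x3" "\<mu> * (1 + w) \<le> x1"
  "x2 + \<epsilon> * a / 2 \<le> x3 + \<mu> * (1 - w - \<epsilon> / 2)"
proof -
  show "0 < x1" "x1 \<le> x2" "0 \<le> x3" using a_small a unfolding x1_def x2_def x3_def left_diff_distrib mult_1_left mult.assoc by linarith+
  show "\<mu> * (1 + w) \<le> x1"
    using \<mu>_bounds(2) a_small a unfolding x1_def distrib_right[of 1] mult_1_left by linarith
  have "(1 - \<epsilon>) * a * (1 - \<epsilon>) \<le> \<mu> * (1 - w - \<epsilon> / 2)"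
    using \<mu> w_small eps \<mu>_bounds(1) by (intro mult_mono) auto
  moreover have "(1 - \<epsilon>) * a * (1 - \<epsilon>) = a - 2 * (\<epsilon> * a) + \<epsilon> * (\<epsilon> * a)" by (simp add: algebra_simps)
  moreover have "\<epsilon> * (\<epsilon> * a) \<ge> 0" using eps a by simp
  ultimately have *: "a - 2 * (\<epsilon> * a) \<le> \<mu> * (1 - w - \<epsilon> / 2)" by linarith
  have "x3 = sqrt (2 * u) - a + 4 * (\<epsilon> * a)" by (simp add: x3_def algebra_simps)
  with * a_small(3) show "x2 + \<epsilon> * a / 2 \<le> x3 + \<mu> * (1 - w - \<epsilon> / 2)" unfolding x2_def by linarith
qed

lemma small: "w + (real m + 1) * \<eta> \<le> 1 / 2"
  using m_bounds(3) w(3) by linarith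

lemma slack: "8 * (w + (real m + 1) * \<eta>) * (3 * sqrt u + \<mu> * (1 + w)) \<le> \<epsilon> * a / 2"
proof -
  have "\<mu> * (1 + w) \<le> sqrt u" using \<mu>_bounds(2) a C_small a_small(2) unfolding distrib_right[of 1] mult_1_left by linarith
  then have "8 * (w + (real m + 1) * \<eta>) * (3 * sqrt u + \<mu> * (1 + w)) \<le> (8 * (2 * w)) * (4 * sqrt u)"
    using m_bounds(3) w \<mu>_bounds(1) u_ge by (intro mult_mono) (auto simp: \<eta>_def)
  also have "\<dots> = 64 * w * sqrt u" by simp
  also note w_tiny
  finally show ?thesis .
qed

lemma rare_le: "rare \<le> exp (- 3 * u)"
  using n_large(1) by (simp add: rare_def)

lemma p_times: "real p * exp (x - u) = exp x" "real p * exp (- 3 * u) = exp (- 2 * u)" "(real p)\<^sup>2 * exp (- 3 * u) = exp (- u)"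
  by (simp_all add: p_eq exp_add[symmetric] power2_eq_square)

lemma tail_le: "B \<le> x\<^sup>2 / (2 * (1 + w)) \<Longrightarrow> tail x \<le> 2 * exp (- B) + exp (- 3 * u)"
  unfolding tail_def using rare_le[unfolded rare_def] by (intro add_mono mult_left_mono) auto

lemma p_tail_le: "B \<le> x\<^sup>2 / (2 * (1 + w)) \<Longrightarrow> real p * tail x \<le> 2 * exp (u - B) + exp (- u)"
proof -
  assume "B \<le> x\<^sup>2 / (2 * (1 + w))"
  then have "real p * tail x \<le> real p * (2 * exp (- B) + exp (- 3 * u))"
    by (intro mult_left_mono tail_le) auto
  also have "\<dots> = 2 * exp (u - B) + exp (- 2 * u)"
    unfolding distrib_left p_times(2) by (simp add: p_eq exp_add[symmetric])
  also have "exp (- 2 * u) \<le> exp (- u)" using u_ge by simp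
  finally show ?thesis by simp
qed

lemma coherence_term: "(real p)\<^sup>2 * tail (\<eta> * sqrt (real n)) \<le> 3 * exp (- u)"
proof -
  have eq: "(\<eta> * sqrt (real n))\<^sup>2 = exp (- (u / 4)) * real n"
    by (simp add: \<eta>_def power_mult_distrib exp_double[symmetric])
  have le: "exp (- (u / 4)) * real n / 4 \<le> exp (- (u / 4)) * real n / (2 * (1 + w))"
    using w by (intro divide_left_mono) auto
  have "3 * u \<le> (\<eta> * sqrt (real n))\<^sup>2 / (2 * (1 + w))"
    unfolding eq using n_large(2) le by (rule order_trans)
  from tail_le[OF this] have "(real p)\<^sup>2 * tail (\<eta> * sqrt (real n)) \<le> (real p)\<^sup>2 * (3 * exp (- 3 * u))"
    by (intro mult_left_mono) auto
  then show ?thesis using p_times(3) by simp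
qed

lemma max_term: "real p * tail (3 * sqrt u) \<le> 3 * exp (- u)"
proof -
  have "2 * u \<le> (3 * sqrt u)\<^sup>2 / (2 * (1 + w))"
    using w u_ge by (intro gaussian_exponent_ge[where A = "9 * u / 2"]) (auto simp: power_mult_distrib mult_left_le_one_le)
  from p_tail_le[OF this] show ?thesis by simp
qed

text \<open>
  The threshold is about \<open>sqrt (2 * u) - (1 + 2 * \<epsilon>) * a\<close>, so the expected count is at most about
  \<open>exp ((1 + 3 * \<epsilon>) * L)\<close>, and \<open>m\<close> exceeds it by the factor \<open>exp (\<epsilon> * L)\<close>.
\<close>

lemma count_term: "real p * tail (x1 - \<mu> * (1 + w)) / (real m + 1) \<le> 2 * exp (- (\<epsilon> * L / 4)) + exp (- u)"
proof -
  let ?v = "x1 - \<mu> * (1 + w)" let ?A = "u - (1 + 2 * \<epsilon>) * L"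
  have v: "sqrt (2 * u) - (1 + 2 * \<epsilon>) * a \<le> ?v" using \<mu>_bounds(2) by (simp add: x1_def algebra_simps)
  have nn: "0 \<le> sqrt (2 * u) - (1 + 2 * \<epsilon>) * a"
    using a_small a unfolding distrib_right[of 1] mult_1_left mult.assoc by linarith
  have square_diff_ge: "A\<^sup>2 - 2 * c * (A * b) \<le> (A - c * b)\<^sup>2" for A b c :: real
    using zero_le_power2[of "c * b"] by (simp add: power2_diff mult_ac)
  have "(sqrt (2 * u))\<^sup>2 - 2 * (1 + 2 * \<epsilon>) * (sqrt (2 * u) * a) \<le> (sqrt (2 * u) - (1 + 2 * \<epsilon>) * a)\<^sup>2"
    by (rule square_diff_ge)
  also have "\<dots> \<le> ?v\<^sup>2" using v nn by (intro power_mono) auto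
  finally have "2 * ?A \<le> ?v\<^sup>2" unfolding sqrt_2u by (simp add: algebra_simps)
  moreover have "w * ?A \<le> w * u" using w eps L_ge by (intro mult_left_mono) auto
  moreover have "u - (1 + 3 * \<epsilon>) * L = ?A - \<epsilon> * L" by (simp add: algebra_simps)
  moreover have "0 \<le> \<epsilon> * L" "w * u = u * w" using eps L_ge by auto
  ultimately have "u - (1 + 3 * \<epsilon>) * L \<le> ?A - w * ?A" "2 * ?A \<le> ?v\<^sup>2"
    using w_small(2) by linarith+
  then have "u - (1 + 3 * \<epsilon>) * L \<le> ?v\<^sup>2 / (2 * (1 + w))"
    using w by (intro gaussian_exponent_ge[where A = ?A]) auto
  from p_tail_le[OF this] have "real p * tail ?v \<le> 2 * exp ((1 + 3 * \<epsilon>) * L) + exp (- u)" by simp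
  then have "real p * tail ?v / (real m + 1) \<le> (2 * exp ((1 + 3 * \<epsilon>) * L) + exp (- u)) / exp ((1 + 4 * \<epsilon>) * L)"
    using m_bounds(1) by (intro frac_le add_nonneg_nonneg) auto
  also have "\<dots> = 2 * exp (- (\<epsilon> * L)) + exp (- u - (1 + 4 * \<epsilon>) * L)"
  proof -
    have "exp ((1 + 3 * \<epsilon>) * L) / exp ((1 + 4 * \<epsilon>) * L) = exp (- (\<epsilon> * L))"
      by (simp only: exp_diff[symmetric]) (simp add: algebra_simps)
    then have "2 * exp ((1 + 3 * \<epsilon>) * L) / exp ((1 + 4 * \<epsilon>) * L) = 2 * exp (- (\<epsilon> * L))"
      by (simp only: times_divide_eq_right[symmetric])
    then show ?thesis by (simp only: add_divide_distrib exp_diff)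
  qed
  also have "\<dots> \<le> 2 * exp (- (\<epsilon> * L / 4)) + exp (- u)"
    using eps L_ge by (intro add_mono mult_left_mono) auto
  finally show ?thesis .
qed

lemma noise_term: "real p * tail x2 \<le> 2 * exp (- (\<epsilon> * L / 4)) + exp (- u)"
proof -
  have "(sqrt (2 * u))\<^sup>2 + 2 * \<epsilon> * (sqrt (2 * u) * a) \<le> x2\<^sup>2"
    by (simp add: x2_def power2_sum)
  then have "2 * (u + \<epsilon> * L) \<le> x2\<^sup>2" unfolding sqrt_2u by (simp add: algebra_simps)
  moreover have "w * (\<epsilon> * L) \<le> 1 / 4 * (\<epsilon> * L)" using w eps L_ge by (intro mult_right_mono) auto
  moreover have "u + x / 4 \<le> (u + x) - w * (u + x)" if "w * x \<le> 1 / 4 * x" "u * w \<le> x / 4" "0 \<le> x" for x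
  proof -
    have "w * (u + x) = u * w + w * x" by (simp add: distrib_left mult.commute)
    moreover have "w * x \<le> x / 4" using that(1) by simp
    ultimately show ?thesis using that(2,3) by simp
  qed
  moreover have "0 \<le> \<epsilon> * L" using eps L_ge by simp
  ultimately have "u + \<epsilon> * L / 4 \<le> (u + \<epsilon> * L) - w * (u + \<epsilon> * L)" "2 * (u + \<epsilon> * L) \<le> x2\<^sup>2"
    using w_small(2) by blast+
  note this(1)
  then have "u + \<epsilon> * L / 4 \<le> x2\<^sup>2 / (2 * (1 + w))"
    using w \<open>2 * (u + \<epsilon> * L) \<le> x2\<^sup>2\<close> by (intro gaussian_exponent_ge[where A = "u + \<epsilon> * L"]) auto
  from p_tail_le[OF this] show ?thesis by simp
qed

lemma square_lt_C: "a\<^sup>2 \<le> C\<^sup>2" using a by (intro power_mono) auto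

text \<open>
  Lowering the threshold by \<open>\<epsilon> * a / 2\<close> from \<open>sqrt (2 * u)\<close> raises the expected number of noise variables above it to about
  \<open>exp (\<epsilon> * L / 2)\<close>.
\<close>

lemma noise_hit_term: "exp (- (real (p - k) * hit (x1 + \<epsilon> * a / 2))) + rare \<le> exp (- (\<epsilon> * L / 4)) + exp (- u)"
proof -
  let ?y = "x1 + \<epsilon> * a / 2"
  have y: "?y = sqrt (2 * u) - \<epsilon> / 2 * a" by (simp add: x1_def)
  have range: "0 \<le> ?y" "?y \<le> sqrt (2 * u)" using a_small a unfolding y by linarith+
  have "(\<epsilon> / 2)\<^sup>2 * a\<^sup>2 \<le> 1 * C\<^sup>2" using eps square_lt_C by (intro mult_mono power_le_one) auto
  moreover have "(A - \<epsilon> / 2 * b)\<^sup>2 = A\<^sup>2 - \<epsilon> * (A * b) + (\<epsilon> / 2)\<^sup>2 * b\<^sup>2" for A b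
    by (simp only: power2_diff power_mult_distrib) simp
  then have "?y\<^sup>2 = 2 * u - \<epsilon> * L + (\<epsilon> / 2)\<^sup>2 * a\<^sup>2"
    unfolding y by (simp only: sqrt_2u)
  ultimately have "?y\<^sup>2 / 2 \<le> u - \<epsilon> * L / 2 + C\<^sup>2"
    using zero_le_power2[of C] by linarith
  then have "exp (\<epsilon> * L / 2 - u - C\<^sup>2 - ln u - 7) \<le> exp (- (?y\<^sup>2 / 2) - ln u / 2 - 7)"
    using ln_u(1) by simp
  also have "\<dots> \<le> hit ?y"
    unfolding hit_def using u_ge range w by (intro hit_ge) auto
  finally have hit: "exp (\<epsilon> * L / 2 - u - C\<^sup>2 - ln u - 7) \<le> hit ?y" .
  have "exp (- (6::real)) \<le> 1 / 100"
  proof -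
    have "(5 / 2) ^ 6 \<le> exp (1::real) ^ 6"
      using exp_lower_Taylor_quadratic[of 1] by (intro power_mono) auto
    also have "\<dots> = exp 6" by (simp add: exp_of_nat_mult[of 6 1, simplified])
    finally have "100 \<le> exp (6::real)" by (simp add: power_divide)
    then show ?thesis by (simp add: exp_minus field_simps)
  qed
  then have "exp (u - 6) \<le> 1 / 100 * exp u" by (simp add: exp_diff exp_minus field_simps)
  also have "\<dots> \<le> real (p - k)"
  proof -
    have "real k \<le> real p" using k_le by simp
    then have "k \<le> p" by simp
    then show ?thesis using k_le by (simp add: p_eq[symmetric])
  qed
  finally have "exp (u - 6) * exp (\<epsilon> * L / 2 - u - C\<^sup>2 - ln u - 7) \<le> real (p - k) * hit ?y"
    using hit by (intro mult_mono) auto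
  then have "exp (\<epsilon> * L / 2 - C\<^sup>2 - ln u - 13) \<le> real (p - k) * hit ?y"
    by (simp add: exp_add[symmetric] algebra_simps)
  moreover have "\<epsilon> * L / 4 \<le> \<epsilon> * L / 2 - C\<^sup>2 - ln u - 13" using L_large \<kappa> by linarith
  then have "exp (\<epsilon> * L / 4) \<le> exp (\<epsilon> * L / 2 - C\<^sup>2 - ln u - 13)" by simp
  moreover have "\<epsilon> * L / 4 \<le> exp (\<epsilon> * L / 4)" using exp_ge_add_one_self[of "\<epsilon> * L / 4"] by linarith
  ultimately have "\<epsilon> * L / 4 \<le> real (p - k) * hit ?y" by linarith
  then show ?thesis using rare_le u_ge by (intro add_mono) (auto intro: order_trans)
qed

text \<open>
  A group has about \<open>k / exp ((1 - 9 * \<epsilon>) * L)\<close> members, and each is large with probability about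
  \<open>exp ((1 - 4 * \<epsilon>) * L) / p\<close>, so the expected number of large members of a group is at least
  \<open>exp (4 * \<epsilon> * L)\<close>. This outweighs the number of groups in the union bound.
\<close>

lemma signal_hit_term: "real G * (exp (- (real g * hit x3)) + rare) \<le> 2 * exp (- (\<epsilon> * L / 4)) + 2 * exp (- u)"
proof -
  have range: "0 \<le> x3" "x3 \<le> sqrt (2 * u)" using thresholds(3) a eps by (auto simp: x3_def)
  have "(1 - 4 * \<epsilon>)\<^sup>2 * a\<^sup>2 \<le> 1 * C\<^sup>2" using eps square_lt_C by (intro mult_mono power_le_one) auto
  moreover have "(A - (1 - 4 * \<epsilon>) * b)\<^sup>2 = A\<^sup>2 - 2 * ((1 - 4 * \<epsilon>) * (A * b)) + (1 - 4 * \<epsilon>)\<^sup>2 * b\<^sup>2" for A b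
    unfolding power2_diff power_mult_distrib by (simp only: mult_ac)
  then have "x3\<^sup>2 = 2 * u - 2 * ((1 - 4 * \<epsilon>) * L) + (1 - 4 * \<epsilon>)\<^sup>2 * a\<^sup>2"
    unfolding x3_def by (simp only: sqrt_2u)
  ultimately have "x3\<^sup>2 / 2 \<le> u - (1 - 4 * \<epsilon>) * L + C\<^sup>2"
    using zero_le_power2[of C] by linarith
  then have "exp ((1 - 4 * \<epsilon>) * L - u - C\<^sup>2 - ln u - 7) \<le> exp (- (x3\<^sup>2 / 2) - ln u / 2 - 7)"
    using ln_u(1) by simp
  also have "\<dots> \<le> hit x3"
    unfolding hit_def using u_ge range w by (intro hit_ge) auto
  finally have hit: "exp ((1 - 4 * \<epsilon>) * L - u - C\<^sup>2 - ln u - 7) \<le> hit x3" .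
  have "exp (u - \<kappa> - 4 - (1 - 9 * \<epsilon>) * L) \<le> real g"
  proof -
    have e4: "4 \<le> exp (4::real)" using exp_ge_add_one_self[of 4] by simp
    have "2 * real G \<le> 4 * exp ((1 - 9 * \<epsilon>) * L)" using G_bounds(2) by simp
    also have "\<dots> \<le> exp 4 * exp ((1 - 9 * \<epsilon>) * L)" using e4 by (intro mult_right_mono) auto
    finally have "exp (u - \<kappa>) / (exp 4 * exp ((1 - 9 * \<epsilon>) * L)) \<le> real k / (2 * real G)"
      using k_ge G_bounds(3) by (intro frac_le) auto
    also note g_ge
    finally show ?thesis by (simp add: exp_add[symmetric] exp_diff[symmetric] algebra_simps)
  qed
  then have "exp (u - \<kappa> - 4 - (1 - 9 * \<epsilon>) * L) * exp ((1 - 4 * \<epsilon>) * L - u - C\<^sup>2 - ln u - 7) \<le> real g * hit x3"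
    using hit by (intro mult_mono) auto
  then have "exp (5 * \<epsilon> * L - \<kappa> - C\<^sup>2 - ln u - 11) \<le> real g * hit x3"
    by (simp add: exp_add[symmetric] algebra_simps)
  moreover have "4 * \<epsilon> * L \<le> 5 * \<epsilon> * L - \<kappa> - C\<^sup>2 - ln u - 11"
  proof -
    have "0 \<le> \<epsilon> * L" using eps L_ge by simp
    then show ?thesis using L_large unfolding mult.assoc by linarith
  qed
  then have "exp (4 * \<epsilon> * L) \<le> exp (5 * \<epsilon> * L - \<kappa> - C\<^sup>2 - ln u - 11)" by simp
  ultimately have "2 * L \<le> real g * hit x3" using exp_large by linarith
  then have "exp (- (real g * hit x3)) \<le> exp (- (2 * L))" by simp
  moreover have "rare \<le> exp (- 3 * u)" by (rule rare_le)
  moreover have GL: "real G \<le> 2 * exp L"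
  proof -
    have "exp ((1 - 9 * \<epsilon>) * L) \<le> exp L" using eps L_ge by (simp add: mult_left_le_one_le algebra_simps)
    then show ?thesis using G_bounds(2) by linarith
  qed
  ultimately have "real G * (exp (- (real g * hit x3)) + rare) \<le> 2 * exp L * (exp (- (2 * L)) + exp (- 3 * u))"
    by (intro mult_mono add_mono) (auto simp: rare_def)
  also have "\<dots> = 2 * exp (- L) + 2 * exp (L - 3 * u)"
  proof -
    have "exp L * exp (- (2 * L)) = exp (- L)" "exp L * exp (- 3 * u) = exp (L - 3 * u)"
      by (simp_all only: exp_add[symmetric]) simp_all
    then show ?thesis by (simp only: distrib_left mult.assoc)
  qed
  also have "\<dots> \<le> 2 * exp (- (\<epsilon> * L / 4)) + 2 * exp (- u)"
  proof (intro add_mono mult_left_mono)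
    have "\<epsilon> * L \<le> 1 * L" using eps L_ge by (intro mult_right_mono) auto
    then show "exp (- L) \<le> exp (- (\<epsilon> * L / 4))" using L_ge by simp
    show "exp (L - 3 * u) \<le> exp (- u)" using L_le \<kappa> u_ge by simp
  qed auto
  finally show ?thesis .
qed

text \<open>
  The group is a fraction at most \<open>w = 1 / u ^ 3\<close> of the signals, so that a deviation by \<open>\<epsilon> / 2\<close> is of the
  order of \<open>\<epsilon> * L * u\<close> standard deviations.
\<close>

lemma interference_term: "real p * tail (\<epsilon> / 2 * sqrt (real n / (w * real k))) \<le> 3 * exp (- u)"
proof -
  have k: "real k > 0" using k_ge exp_gt_zero less_le_trans by blast
  have "(sqrt (2 * u) * a)\<^sup>2 = L\<^sup>2" by (simp add: sqrt_2u)
  then have "a\<^sup>2 * u = L\<^sup>2 / 2" using u_ge by (simp add: power_mult_distrib mult_ac)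
  moreover have "L\<^sup>2 \<ge> 1" using L_ge by (simp add: one_le_power)
  ultimately have au: "a\<^sup>2 * u \<ge> 1 / 2" by simp
  have "(\<epsilon> / 2 * sqrt (real n / (w * real k)))\<^sup>2 = \<epsilon>\<^sup>2 / 4 * (a\<^sup>2 / w)"
    using w k by (simp add: power_mult_distrib power_divide a_eq)
  also have "a\<^sup>2 / w = (a\<^sup>2 * u) * u\<^sup>2" using u_ge by (simp add: w_eq power2_eq_square power3_eq_cube)
  finally have sq: "(\<epsilon> / 2 * sqrt (real n / (w * real k)))\<^sup>2 = \<epsilon>\<^sup>2 / 4 * ((a\<^sup>2 * u) * u\<^sup>2)" .
  have "12 * u \<le> (\<epsilon>\<^sup>2 * u) * u / 8" using mult_right_mono[OF u_large, of u] u_ge by simp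
  also have "\<dots> = \<epsilon>\<^sup>2 / 4 * (1 / 2 * u\<^sup>2)" by (simp add: power2_eq_square)
  also have "\<dots> \<le> \<epsilon>\<^sup>2 / 4 * ((a\<^sup>2 * u) * u\<^sup>2)" using au by (intro mult_left_mono mult_right_mono) auto
  finally have "2 * (6 * u) \<le> (\<epsilon> / 2 * sqrt (real n / (w * real k)))\<^sup>2" unfolding sq by simp
  moreover have "w * (6 * u) \<le> 1 / 4 * (6 * u)" using w u_ge by (intro mult_right_mono) auto
  ultimately have "2 * u \<le> (\<epsilon> / 2 * sqrt (real n / (w * real k)))\<^sup>2 / (2 * (1 + w))"
    using w u_ge by (intro gaussian_exponent_ge[where A = "6 * u"]) auto
  from p_tail_le[OF this] show ?thesis by simp
qed

lemma total_bound:
  "real p * (2 * rare) + (real p)\<^sup>2 * tail (\<eta> * sqrt (real n)) + real p * tail (3 * sqrt u)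
    + real p * tail (x1 - \<mu> * (1 + w)) / (real m + 1) + real p * tail x2
    + (exp (- (real (p - k) * hit (x1 + \<epsilon> * a / 2))) + rare)
    + real G * (exp (- (real g * hit x3)) + rare) + real p * tail (\<epsilon> / 2 * sqrt (real n / (w * real k)))
    \<le> 20 * (exp (- u) + exp (- (\<epsilon> * L / 4)))" (is "?total \<le> _")
proof -
  have "real p * (2 * rare) \<le> 2 * (real p * exp (- 3 * u))" using rare_le by (simp add: mult_left_mono)
  also have "\<dots> \<le> 2 * exp (- u)" unfolding p_times(2) using u_ge by simp
  finally have "real p * (2 * rare) \<le> 2 * exp (- u)" .
  then have "?total
    \<le> 2 * exp (- u) + 3 * exp (- u) + 3 * exp (- u) + (2 * exp (- (\<epsilon> * L / 4)) + exp (- u))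
    + (2 * exp (- (\<epsilon> * L / 4)) + exp (- u)) + (exp (- (\<epsilon> * L / 4)) + exp (- u))
    + (2 * exp (- (\<epsilon> * L / 4)) + 2 * exp (- u)) + 3 * exp (- u)"
    by (intro add_mono coherence_term max_term count_term noise_term noise_hit_term
        signal_hit_term interference_term)
  also have "\<dots> \<le> 20 * (exp (- u) + exp (- (\<epsilon> * L / 4)))" by simp
  finally show ?thesis .
qed

end

section \<open>The asymptotic regime\<close>

locale asymptotic_regime =
  fixes k n p :: "nat \<Rightarrow> nat" and c1 c2 c3 c4 c5 :: real
  assumes n_top: "filterlim n at_top sequentially" and p_top: "filterlim p at_top sequentially"
    and c_pos: "c1 > 0" "c2 > 0" "c3 > 0" "c4 > 0" "c5 > 0"
    and n_lower: "\<And>l. c1 * real (p l) / ln (real (p l)) powr c2 \<le> real (n l)"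
    and n_upper: "\<And>l. real (n l) \<le> c3 * real (p l)"
    and k_lower: "\<And>l. c4 * real (n l) \<le> real (k l)"
    and k_upper: "\<And>l. real (k l) \<le>
      min (0.99 * real (p l)) (c5 * real (n l) * ln (real (p l)) powr 0.99)"
begin

definition u :: "nat \<Rightarrow> real" where "u l = ln (real (p l))"
definition a :: "nat \<Rightarrow> real" where "a l = sqrt (real (n l) / real (k l))"
definition L :: "nat \<Rightarrow> real" where "L l = a l * sqrt (2 * u l)"
definition C :: real where "C = 1 / sqrt c4"
definition K\<^sub>0 :: real where "K\<^sub>0 = \<bar>ln (c4 * c1)\<bar>"

lemma u_top: "filterlim u at_top sequentially"
  unfolding u_def
  by (rule filterlim_compose[OF ln_at_top filterlim_compose[OF filterlim_real_sequentially p_top]])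

lemma eventually_u: "eventually Q at_top \<Longrightarrow> \<forall>\<^sub>F l in sequentially. Q (u l)"
  by (rule eventually_compose_filterlim[OF _ u_top])

lemma eventually_n_pos: "\<forall>\<^sub>F l in sequentially. n l > 0"
  by (rule eventually_compose_filterlim[OF eventually_gt_at_top n_top])

lemma eventually_p: "\<forall>\<^sub>F l in sequentially. real (p l) = exp (u l)"
proof -
  have "\<forall>\<^sub>F l in sequentially. p l > 0" by (rule eventually_compose_filterlim[OF eventually_gt_at_top p_top])
  then show ?thesis by eventually_elim (simp add: u_def)
qed

lemma C_pos: "C > 0"
  using c_pos by (simp add: C_def)

lemma n_div_k_le: "real (n l) / real (k l) \<le> 1 / c4"
proof (cases "k l = 0")
  case True
  then show ?thesis using c_pos by simp
next
  case False
  then show ?thesis using k_lower[of l] c_pos by (simp add: field_simps)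
qed

lemma a_bounds: "0 \<le> a l" "a l \<le> C"
proof -
  show "0 \<le> a l" by (simp add: a_def)
  have "C = sqrt (1 / c4)" by (simp add: C_def real_sqrt_divide)
  then show "a l \<le> C" unfolding a_def using n_div_k_le[of l] by simp
qed

lemma L_le: "L l \<le> C * sqrt (2 * u l)"
proof (cases "p l = 0")
  case False
  then have "0 \<le> u l" by (simp add: u_def)
  then show ?thesis unfolding L_def using a_bounds by (intro mult_right_mono) auto
qed (simp add: L_def u_def)

lemma k_pos: "n l > 0 \<Longrightarrow> k l > 0"
proof -
  assume "n l > 0"
  then have "0 < c4 * real (n l)" using c_pos by simp
  also note k_lower
  finally show "k l > 0" by simp
qed

text \<open>
  This is where the exponent \<open>0.99 < 1\<close> in the upper bound on \<open>k\<close> enters: it keeps \<open>L\<close> above a positive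
  power of \<open>u\<close>, hence above any multiple of \<open>ln u\<close>.
\<close>

lemma L_ge: "\<forall>\<^sub>F l in sequentially. sqrt (2 * u l powr 0.01 / c5) \<le> L l"
  using eventually_n_pos eventually_u[OF eventually_ge_at_top[of 1]]
proof eventually_elim
  case (elim l)
  have k: "real (k l) > 0" using k_pos elim by simp
  have "real (k l) \<le> c5 * real (n l) * u l powr 0.99" using k_upper[of l] by (simp add: u_def)
  then have "1 / (c5 * u l powr 0.99) \<le> real (n l) / real (k l)"
    using k c_pos elim by (simp add: field_simps)
  then have "1 / (c5 * u l powr 0.99) * (2 * u l) \<le> real (n l) / real (k l) * (2 * u l)"
    using elim by (intro mult_right_mono) auto
  moreover have "u l powr 0.01 * u l powr 0.99 = u l" using elim by (simp add: powr_add[symmetric])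
  then have "1 / (c5 * u l powr 0.99) * (2 * u l) = 2 * u l powr 0.01 / c5"
    using c_pos elim by (simp add: field_simps)
  ultimately show ?case
    unfolding L_def a_def real_sqrt_mult[symmetric] by (intro real_sqrt_le_mono) simp
qed

lemma L_dominates_log:
  assumes "K > 0"
  shows "\<forall>\<^sub>F l in sequentially. K * ln (u l) + K \<le> L l"
proof -
  have "\<forall>\<^sub>F x in at_top. K * ln x + K \<le> sqrt (2 * x powr 0.01 / c5)"
    using assms c_pos by real_asymp
  from eventually_u[OF this] L_ge show ?thesis by eventually_elim simp
qed

lemma L_top: "filterlim L at_top sequentially"
proof -
  have "filterlim (\<lambda>x. sqrt (2 * x powr 0.01 / c5)) at_top at_top" using c_pos by real_asymp
  from filterlim_compose[OF this u_top] show ?thesis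
    by (rule filterlim_at_top_mono[OF _ L_ge])
qed

lemma eventually_L: "eventually Q at_top \<Longrightarrow> \<forall>\<^sub>F l in sequentially. Q (L l)"
  by (rule eventually_compose_filterlim[OF _ L_top])

lemma n_ge: "\<forall>\<^sub>F l in sequentially. c1 * exp (u l) / u l powr c2 \<le> real (n l)"
  using eventually_p
proof eventually_elim
  case (elim l)
  then show ?case using n_lower[of l] by (simp add: u_def[symmetric])
qed

lemma k_ge: "\<forall>\<^sub>F l in sequentially. exp (u l - (c2 * ln (u l) + K\<^sub>0)) \<le> real (k l)"
  using n_ge eventually_u[OF eventually_ge_at_top[of 1]]
proof eventually_elim
  case (elim l)
  have "exp (u l - (c2 * ln (u l) + K\<^sub>0)) = exp (u l) / u l powr c2 * exp (- K\<^sub>0)"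
    using elim by (simp add: powr_def exp_diff exp_add exp_minus field_simps)
  also have "\<dots> \<le> exp (u l) / u l powr c2 * (c4 * c1)"
  proof (rule mult_left_mono)
    have "exp (- K\<^sub>0) \<le> exp (ln (c4 * c1))" by (simp add: K\<^sub>0_def)
    also have "exp (ln (c4 * c1)) = c4 * c1" using c_pos by simp
    finally show "exp (- K\<^sub>0) \<le> c4 * c1" .
  qed simp
  also have "exp (u l) / u l powr c2 * (c4 * c1) = c4 * (c1 * exp (u l) / u l powr c2)" by simp
  also have "\<dots> \<le> c4 * real (n l)" using elim c_pos by (intro mult_left_mono) auto
  also have "\<dots> \<le> real (k l)" by (rule k_lower)
  finally show ?case by simp
qed

lemma eventually_tuning:
  assumes eps: "0 < \<epsilon>" "\<epsilon> \<le> 1 / 40"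
  shows "\<forall>\<^sub>F l in sequentially. \<forall>\<mu>. (1 - \<epsilon>) * a l \<le> \<mu> \<longrightarrow> \<mu> \<le> a l \<longrightarrow>
    tuning (u l) (a l) (L l) C \<epsilon> (1 / u l ^ 3) \<mu> (c2 * ln (u l) + K\<^sub>0) (n l) (p l) (k l)"
proof -
  define K where "K = 4 / \<epsilon> * (c2 + K\<^sub>0 + C\<^sup>2 + 21)"
  have K0: "K\<^sub>0 \<ge> 0" by (simp add: K\<^sub>0_def)
  have K: "K > 0" unfolding K_def using eps c_pos K0
    by (intro mult_pos_pos add_nonneg_pos add_nonneg_nonneg) auto
  have large_u:
    "\<forall>\<^sub>F x in at_top. 1 / x ^ 3 \<le> \<epsilon> / 2"
    "\<forall>\<^sub>F x in at_top. x * (1 / x ^ 3) \<le> (1::real)"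
    "\<forall>\<^sub>F x in at_top. 3 * C \<le> sqrt x"
    "\<forall>\<^sub>F x in at_top. 3 * x \<le> c1 * exp x / x powr c2 * (1 / x ^ 3)\<^sup>2 / 16"
    "\<forall>\<^sub>F x in at_top. 3 * x \<le> exp (- (x / 4)) * (c1 * exp x / x powr c2) / 4"
    "\<forall>\<^sub>F x in at_top. 2 * exp (2 * (C * sqrt (2 * x))) * exp (- (x / 8)) \<le> 1 / x ^ 3"
    "\<forall>\<^sub>F x in at_top. 64 * (1 / x ^ 3) * sqrt x \<le> \<epsilon> * (1 / sqrt (2 * x)) / 2"
    "\<forall>\<^sub>F x in at_top. c2 * ln x + K\<^sub>0 + C * sqrt (2 * x) + 4 \<le> x"
    "\<forall>\<^sub>F x in at_top. 96 \<le> \<epsilon>\<^sup>2 * x"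
    using eps c_pos C_pos by real_asymp+
  have exp4: "\<forall>\<^sub>F y in at_top. 2 * y \<le> exp (4 * \<epsilon> * y)" using eps by real_asymp
  show ?thesis
    using eventually_u[OF eventually_ge_at_top[of 4]] large_u[THEN eventually_u]
      eventually_L[OF exp4] eventually_L[OF eventually_ge_at_top[of 1]]
      eventually_L[OF eventually_ge_at_top[of "4 / \<epsilon>"]]
      L_dominates_log[OF K] n_ge k_ge eventually_p
  proof eventually_elim
    case (elim l)
    have lnu: "ln (u l) \<ge> 0" using elim(1) by simp
    have su: "sqrt (2 * u l) > 0" using elim(1) by simp
    have aL: "a l = L l / sqrt (2 * u l)" using su by (simp add: L_def)
    show ?case
    proof (intro allI impI)
      fix \<mu> assume \<mu>: "(1 - \<epsilon>) * a l \<le> \<mu>" "\<mu> \<le> a l"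
      show "tuning (u l) (a l) (L l) C \<epsilon> (1 / u l ^ 3) \<mu> (c2 * ln (u l) + K\<^sub>0) (n l) (p l) (k l)"
      proof
        show "0 < a l" unfolding aL using elim(12) su by simp
        show "u l * (1 / u l ^ 3) \<le> \<epsilon> * L l / 4"
        proof -
          have "4 \<le> \<epsilon> * L l" using elim(13) eps by (simp add: field_simps)
          with elim(3) show ?thesis by linarith
        qed
        show "3 * u l \<le> real (n l) * (1 / u l ^ 3)\<^sup>2 / 16"
        proof -
          have "c1 * exp (u l) / u l powr c2 * (1 / u l ^ 3)\<^sup>2 / 16 \<le> real (n l) * (1 / u l ^ 3)\<^sup>2 / 16"
            using elim(15) by (intro divide_right_mono mult_right_mono) auto
          with elim(5) show ?thesis by linarith
        qed
        show "3 * u l \<le> exp (- (u l / 4)) * real (n l) / 4"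
        proof -
          have "exp (- (u l / 4)) * (c1 * exp (u l) / u l powr c2) / 4 \<le> exp (- (u l / 4)) * real (n l) / 4"
            using elim(15) by (intro divide_right_mono mult_left_mono) auto
          with elim(6) show ?thesis by linarith
        qed
        show "2 * exp (2 * L l) * exp (- (u l / 8)) \<le> 1 / u l ^ 3"
        proof -
          have "2 * exp (2 * L l) * exp (- (u l / 8)) \<le> 2 * exp (2 * (C * sqrt (2 * u l))) * exp (- (u l / 8))"
            using L_le[of l] by (intro mult_right_mono mult_left_mono) auto
          with elim(7) show ?thesis by linarith
        qed
        show "64 * (1 / u l ^ 3) * sqrt (u l) \<le> \<epsilon> * a l / 2"
        proof -
          have "\<epsilon> * (1 / sqrt (2 * u l)) / 2 \<le> \<epsilon> * a l / 2"
            unfolding aL using elim(12) su eps by (intro divide_right_mono mult_left_mono) auto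
          with elim(8) show ?thesis by linarith
        qed
        show "real (k l) \<le> 0.99 * real (p l)" using k_upper[of l] by simp
        show "c2 * ln (u l) + K\<^sub>0 + ln (u l) + C\<^sup>2 + 20 \<le> \<epsilon> * L l / 4"
        proof -
          let ?S = "c2 + K\<^sub>0 + C\<^sup>2 + 21"
          have "c2 * ln (u l) + K\<^sub>0 + ln (u l) + C\<^sup>2 + 20 = (c2 + 1) * ln (u l) + (K\<^sub>0 + C\<^sup>2 + 20)"
            by (simp add: algebra_simps)
          also have "\<dots> \<le> ?S * ln (u l) + ?S"
            using lnu c_pos K0 by (intro add_mono mult_right_mono) auto
          also have "\<dots> = \<epsilon> / 4 * (K * ln (u l) + K)"
            using eps by (simp add: K_def field_simps)
          also have "\<dots> \<le> \<epsilon> / 4 * L l" using elim(14) eps by (intro mult_left_mono) auto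
          finally show ?thesis by simp
        qed
        show "c2 * ln (u l) + K\<^sub>0 + L l + 4 \<le> u l" using elim(9) L_le[of l] by linarith
        show "0 \<le> c2 * ln (u l) + K\<^sub>0" using lnu c_pos K0 by simp
      qed (use elim eps \<mu> a_bounds[of l] in \<open>auto simp: L_def a_def\<close>)
    qed
  qed
qed

definition rate :: "nat \<Rightarrow> real" where
  "rate l = sqrt (2 * real (n l) * ln (real (p l)) / real (k l)) - real (n l) / (2 * real (k l)) +
     ln (real (n l) / (2 * real (p l) * ln (real (p l))))"

text \<open>
  The second term of the rate is bounded and the third is of order \<open>ln u\<close>, because \<open>n / p\<close> lies between a
  negative power of \<open>u\<close> and a constant.
\<close>

lemma rate_asymp:
  assumes eps: "\<epsilon> > 0"
  shows "\<forall>\<^sub>F l in sequentially. \<bar>rate l - L l\<bar> \<le> \<epsilon> * L l"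
proof -
  define K where "K = (1 / \<epsilon>) * (c2 + 1 + \<bar>ln (c1 / 2)\<bar> + \<bar>ln (c3 / 2)\<bar> + 1 / c4)"
  have K: "K > 0" unfolding K_def using eps c_pos by (intro mult_pos_pos add_pos_nonneg add_nonneg_pos) auto
  show ?thesis
    using L_dominates_log[OF K] n_ge eventually_p eventually_n_pos eventually_u[OF eventually_ge_at_top[of 1]]
  proof eventually_elim
    case (elim l)
    have lnu: "ln (u l) \<ge> 0" using elim(5) by simp
    let ?x = "real (n l) / (2 * real (p l) * u l)"
    have p: "real (p l) > 0" using elim(3) by simp
    have x: "?x > 0" using elim p by simp
    have "c1 / 2 / (u l powr c2 * u l) = (c1 * real (p l) / u l powr c2) / (2 * real (p l) * u l)"
      using p by simp
    also have "\<dots> \<le> ?x"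
      using elim(2,5) p unfolding elim(3)[symmetric] by (intro divide_right_mono) auto
    finally have "ln (c1 / 2 / (u l powr c2 * u l)) \<le> ln ?x"
      using c_pos elim by (intro ln_mono) auto
    moreover have "ln (c1 / 2 / (u l powr c2 * u l)) = ln (c1 / 2) - (c2 * ln (u l) + ln (u l))"
      using c_pos elim by (simp add: ln_div ln_mult ln_powr)
    ultimately have lower: "ln (c1 / 2) - (c2 + 1) * ln (u l) \<le> ln ?x" by (simp add: algebra_simps)
    have "?x \<le> c3 / 2 / u l"
    proof -
      have "?x \<le> (c3 * real (p l)) / (2 * real (p l) * u l)"
        using n_upper[of l] p elim(5) by (intro divide_right_mono) auto
      also have "\<dots> = c3 / 2 / u l" using p by simp
      finally show ?thesis .
    qed
    also have "\<dots> \<le> c3 / 2" using elim c_pos by (simp add: divide_le_eq)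
    finally have "?x \<le> c3 / 2" .
    then have upper: "ln ?x \<le> ln (c3 / 2)" using x by (intro ln_mono) auto
    have sq: "sqrt (2 * real (n l) * ln (real (p l)) / real (k l)) = L l"
      unfolding L_def a_def real_sqrt_mult[symmetric] by (simp add: u_def mult_ac)
    have q: "0 \<le> real (n l) / (2 * real (k l))" "real (n l) / (2 * real (k l)) \<le> 1 / c4"
    proof -
      show "0 \<le> real (n l) / (2 * real (k l))" by simp
      have "real (n l) / (2 * real (k l)) \<le> real (n l) / real (k l)" using k_pos elim by (simp add: field_simps)
      with n_div_k_le[of l] show "real (n l) / (2 * real (k l)) \<le> 1 / c4" by linarith
    qed
    have "rate l - L l = ln ?x - real (n l) / (2 * real (k l))"
      unfolding rate_def sq by (simp add: u_def)
    moreover have "0 \<le> (c2 + 1) * ln (u l)" using lnu c_pos by simp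
    ultimately have "\<bar>rate l - L l\<bar> \<le> (c2 + 1) * ln (u l) + (\<bar>ln (c1 / 2)\<bar> + \<bar>ln (c3 / 2)\<bar> + 1 / c4)"
      using lower upper q by linarith
    also have "\<dots> \<le> \<epsilon> * (K * ln (u l) + K)"
    proof -
      let ?S = "c2 + 1 + \<bar>ln (c1 / 2)\<bar> + \<bar>ln (c3 / 2)\<bar> + 1 / c4"
      have "(c2 + 1) * ln (u l) + (\<bar>ln (c1 / 2)\<bar> + \<bar>ln (c3 / 2)\<bar> + 1 / c4) \<le> ?S * ln (u l) + ?S"
      proof -
        have S: "c2 + 1 \<le> ?S" "\<bar>ln (c1 / 2)\<bar> + \<bar>ln (c3 / 2)\<bar> + 1 / c4 \<le> ?S"
          using c_pos by simp_all
        show ?thesis by (rule add_mono[OF mult_right_mono[OF S(1) lnu] S(2)])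
      qed
      also have "\<dots> = \<epsilon> * (K * ln (u l) + K)" using eps by (simp add: K_def field_simps)
      finally show ?thesis .
    qed
    also have "\<dots> \<le> \<epsilon> * L l" using elim eps by (intro mult_left_mono) auto
    finally show ?case .
  qed
qed

end

section \<open>Rank of the first noise variable\<close>

context spurious_model
begin

text \<open>
  Since \<open>s\<^sup>2 = k * amp\<^sup>2 / n + \<sigma>\<^sup>2\<close>, the shift of a signal correlation in units of \<open>s\<close> is close to \<open>sqrt (n / k)\<close> when the
  noise variance is small compared with the contribution of the signals.
\<close>

lemma signal_to_noise_bounds:
  assumes k: "k > 0"
  shows "\<bar>amp\<bar> / s \<le> sqrt (real n / real k)"
    and "0 < \<epsilon> \<Longrightarrow> \<epsilon> \<le> 1 \<Longrightarrow> \<sigma>\<^sup>2 * real n \<le> \<epsilon> * (real k * amp\<^sup>2) \<Longrightarrow> (1 - \<epsilon>) * sqrt (real n / real k) \<le> \<bar>amp\<bar> / s"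
proof -
  have s: "s > 0" by (rule s_pos[OF k])
  define q where "q = sqrt (real k / real n)"
  have q: "q > 0" using k n_pos by (simp add: q_def)
  have a: "sqrt (real n / real k) = 1 / q"
    unfolding q_def by (simp only: real_sqrt_divide divide_divide_eq_right mult_1_left)
  have sq: "s\<^sup>2 = (\<bar>amp\<bar> * q)\<^sup>2 + \<sigma>\<^sup>2"
  proof -
    have "s\<^sup>2 = real k * amp\<^sup>2 / real n + \<sigma>\<^sup>2"
      unfolding s_eq by (intro real_sqrt_pow2 add_nonneg_nonneg) simp_all
    moreover have "(\<bar>amp\<bar> * q)\<^sup>2 = real k * amp\<^sup>2 / real n"
      unfolding power_mult_distrib q_def by simp
    ultimately show ?thesis by simp
  qed
  have "\<bar>amp\<bar> * q \<le> s"
  proof (rule power2_le_imp_le)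
    show "(\<bar>amp\<bar> * q)\<^sup>2 \<le> s\<^sup>2" unfolding sq by simp
    show "0 \<le> s" using s by simp
  qed
  then show "\<bar>amp\<bar> / s \<le> sqrt (real n / real k)"
    unfolding a using s q by (simp add: field_simps)
  assume eps: "0 < \<epsilon>" "\<epsilon> \<le> 1" and noise: "\<sigma>\<^sup>2 * real n \<le> \<epsilon> * (real k * amp\<^sup>2)"
  have "\<sigma>\<^sup>2 \<le> \<epsilon> * (real k * amp\<^sup>2) / real n"
    using noise n_pos by (simp add: pos_le_divide_eq)
  also have "\<dots> = \<epsilon> * (\<bar>amp\<bar> * q)\<^sup>2" by (simp add: q_def power_mult_distrib)
  finally have "s\<^sup>2 \<le> (1 + \<epsilon>) * (\<bar>amp\<bar> * q)\<^sup>2" unfolding sq by (simp add: distrib_right)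
  then have "(1 - \<epsilon>)\<^sup>2 * s\<^sup>2 \<le> (1 - \<epsilon>)\<^sup>2 * ((1 + \<epsilon>) * (\<bar>amp\<bar> * q)\<^sup>2)" by (intro mult_left_mono) auto
  also have "\<dots> = ((1 - \<epsilon>) * (1 - \<epsilon>\<^sup>2)) * (\<bar>amp\<bar> * q)\<^sup>2" by (simp add: power2_eq_square algebra_simps)
  also have "\<dots> \<le> 1 * (\<bar>amp\<bar> * q)\<^sup>2"
    using eps by (intro mult_right_mono mult_le_one) (auto simp: power_le_one)
  finally have "((1 - \<epsilon>) * s)\<^sup>2 \<le> (\<bar>amp\<bar> * q)\<^sup>2" by (simp add: power_mult_distrib)
  then have "(1 - \<epsilon>) * s \<le> \<bar>amp\<bar> * q" using q by (elim power2_le_imp_le) simp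
  then show "(1 - \<epsilon>) * sqrt (real n / real k) \<le> \<bar>amp\<bar> / s"
    unfolding a using s q by (simp add: field_simps)
qed

lemma log_rank_bounds:
  assumes "tuning u a L C \<epsilon> w (\<bar>amp\<bar> / s) \<kappa> n p k"
  shows "\<exists>B\<in>events. prob B \<le> 20 * (exp (- u) + exp (- (\<epsilon> * L / 4))) \<and>
    (\<forall>\<omega>\<in>space M - B. \<forall>y. (\<forall>i<n. y i = response \<omega> i) \<longrightarrow>
      (\<forall>rank\<in>{forward_stepwise_rank, lasso_rank, lar_rank}.
        (1 - 9 * \<epsilon>) * L \<le> ln (real (rank n p (X \<omega>) y signal)) \<and>
        ln (real (rank n p (X \<omega>) y signal)) \<le> (1 + 5 * \<epsilon>) * L))"
proof -
  interpret T: tuning u a L C \<epsilon> w "\<bar>amp\<bar> / s" \<kappa> n p k by fact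
  have "real k > 0" using T.k_ge exp_gt_zero less_le_trans by blast
  then have k: "k > 0" by simp
  obtain B where B: "B \<in> events" and prob: "prob B \<le> 20 * (exp (- u) + exp (- (\<epsilon> * L / 4)))"
    and rank: "\<And>\<omega> y rank. \<omega> \<in> space M - B \<Longrightarrow> \<forall>i<n. y i = response \<omega> i \<Longrightarrow>
      rank \<in> {forward_stepwise_rank, lasso_rank, lar_rank} \<Longrightarrow>
      T.G + 1 \<le> rank n p (X \<omega>) y signal \<and> rank n p (X \<omega>) y signal \<le> T.m + 1"
  proof -
    have "0 \<le> \<epsilon> * a / 2" "0 \<le> T.\<eta>" "0 < 1 / sqrt u" "0 \<le> \<epsilon> / 2" "0 \<le> 3 * sqrt u"
      using T.a T.eps T.u_ge by (auto simp: T.\<eta>_def)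
    from rank_bounds[OF T.w(1,2) this(2) T.small this(3) k this(4) this(5) T.thresholds(1-3) this(1)
        T.slack T.thresholds(5,4) T.groups]
    show ?thesis
      using T.total_bound unfolding T.tail_def T.hit_def T.rare_def
      by (elim bexE conjE) (rule that, assumption, erule order_trans, assumption, blast)
  qed
  have "(1 - 9 * \<epsilon>) * L \<le> ln (real (rank n p (X \<omega>) y signal)) \<and>
      ln (real (rank n p (X \<omega>) y signal)) \<le> (1 + 5 * \<epsilon>) * L"
    if "\<omega> \<in> space M - B" "\<forall>i<n. y i = response \<omega> i"
      "rank \<in> {forward_stepwise_rank, lasso_rank, lar_rank}" for \<omega> y rank
  proof -
    let ?r = "real (rank n p (X \<omega>) y signal)"
    have "real T.G + 1 \<le> ?r" "?r \<le> real T.m + 1" using rank[OF that] by (auto simp: of_nat_le_iff[symmetric] simp del: of_nat_le_iff)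
    then have "exp ((1 - 9 * \<epsilon>) * L) \<le> ?r" "?r \<le> exp ((1 + 5 * \<epsilon>) * L)" "?r > 0"
      using T.G_bounds(1) T.m_bounds(2) by linarith+
    then show ?thesis using ln_mono[of ?r "exp ((1 + 5 * \<epsilon>) * L)"] by (simp add: ln_ge_iff)
  qed
  with B prob show ?thesis by blast
qed

end

theorem theorem2:
  fixes P :: "nat \<Rightarrow> 'a measure"
    and k n p :: "nat \<Rightarrow> nat"
    and X :: "nat \<Rightarrow> 'a \<Rightarrow> nat \<Rightarrow> nat \<Rightarrow> real"
    and z y :: "nat \<Rightarrow> 'a \<Rightarrow> nat \<Rightarrow> real"
    and \<beta> :: "nat \<Rightarrow> nat \<Rightarrow> real"
    and \<sigma> M :: "nat \<Rightarrow> real"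
    and c1 c2 c3 c4 c5 :: real
  assumes prob: "\<And>l. prob_space (P l)"
    and dims: "filterlim k at_top sequentially"
      "filterlim n at_top sequentially"
      "filterlim p at_top sequentially"
    and X_normal: "\<And>l i j. i < n l \<Longrightarrow> j < p l \<Longrightarrow>
      normal_rv (P l) (\<lambda>\<omega>. X l \<omega> i j) (1 / sqrt (real (n l)))"
    and z_normal: "\<And>l i. i < n l \<Longrightarrow> normal_rv (P l) (\<lambda>\<omega>. z l \<omega> i) (\<sigma> l)"
    and indep: "\<And>l. prob_space.indep_vars (P l) (\<lambda>_. borel)
      (\<lambda>q \<omega>. case q of Inl (i, j) \<Rightarrow> X l \<omega> i j | Inr i \<Rightarrow> z l \<omega> i)
      (({..<n l} \<times> {..<p l}) <+> {..<n l})"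
    and model: "\<And>l \<omega> i. \<omega> \<in> space (P l) \<Longrightarrow> i < n l \<Longrightarrow>
      y l \<omega> i = (\<Sum>j<p l. X l \<omega> i j * \<beta> l j) + z l \<omega> i"
    and \<beta>_vals: "\<And>l j. j < p l \<Longrightarrow> \<beta> l j = M l \<or> \<beta> l j = 0"
    and \<beta>_card: "\<And>l. card {j. j < p l \<and> \<beta> l j = M l} = k l"
    and M_nz: "\<And>l. M l \<noteq> 0"
    and \<sigma>_nonneg: "\<And>l. \<sigma> l \<ge> 0"
    and c_pos: "c1 > 0" "c2 > 0" "c3 > 0" "c4 > 0" "c5 > 0"
    and n_lower: "\<And>l. c1 * real (p l) / ln (real (p l)) powr c2 \<le> real (n l)"
    and n_upper: "\<And>l. real (n l) \<le> c3 * real (p l)"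
    and k_lower: "\<And>l. c4 * real (n l) \<le> real (k l)"
    and k_upper: "\<And>l. real (k l) \<le>
      min (0.99 * real (p l)) (c5 * real (n l) * ln (real (p l)) powr 0.99)"
    and snr: "(\<lambda>l. \<sigma> l / M l) \<longlonglongrightarrow> 0"
  shows "\<forall>rank \<in> {forward_stepwise_rank, lasso_rank, lar_rank}.
    \<exists>\<delta>. tendsto_zero_in_prob P \<delta> \<and>
      (\<forall>\<^sub>F l in sequentially. \<forall>\<omega> \<in> space (P l).
        ln (real (rank (n l) (p l) (X l \<omega>) (y l \<omega>) {j. j < p l \<and> \<beta> l j \<noteq> 0})) =
          (1 + \<delta> l \<omega>) *
          (sqrt (2 * real (n l) * ln (real (p l)) / real (k l)) - real (n l) / (2 * real (k l)) +
           ln (real (n l) / (2 * real (p l) * ln (real (p l))))))"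
proof
  fix rank assume rank: "rank \<in> {forward_stepwise_rank, lasso_rank, lar_rank}"
  interpret R: asymptotic_regime k n p c1 c2 c3 c4 c5
    by unfold_locales (fact dims c_pos n_lower n_upper k_lower k_upper)+
  let ?rank = "\<lambda>l \<omega>. rank (n l) (p l) (X l \<omega>) (y l \<omega>) {j. j < p l \<and> \<beta> l j \<noteq> 0}"
  define \<delta> where "\<delta> l \<omega> = ln (real (?rank l \<omega>)) / R.rate l - 1" for l \<omega>

  have bounds: "\<forall>\<^sub>F l in sequentially. \<exists>B\<in>sets (P l).
      measure (P l) B \<le> 20 * (exp (- R.u l) + exp (- (\<epsilon> * R.L l / 4))) \<and>
      (\<forall>\<omega>\<in>space (P l) - B. (1 - 9 * \<epsilon>) * R.L l \<le> ln (real (?rank l \<omega>)) \<and>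
        ln (real (?rank l \<omega>)) \<le> (1 + 5 * \<epsilon>) * R.L l)"
    if eps: "0 < \<epsilon>" "\<epsilon> \<le> 1 / 40" for \<epsilon>
  proof -
    have "(\<lambda>l. (\<sigma> l / M l)\<^sup>2) \<longlonglongrightarrow> 0\<^sup>2" by (intro tendsto_power snr)
    from order_tendstoD(2)[OF this, of "\<epsilon> * c4"]
    have "\<forall>\<^sub>F l in sequentially. (\<sigma> l / M l)\<^sup>2 < \<epsilon> * c4" using eps c_pos by simp
    then show ?thesis
      using R.eventually_tuning[OF eps] R.eventually_n_pos
    proof eventually_elim
      case (elim l)
      interpret S: spurious_model "P l" "n l" "p l" "X l" "z l" "\<sigma> l" "\<beta> l" "M l"
      proof (intro spurious_model.intro gaussian_design.intro gaussian_design_axioms.intro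
          spurious_model_axioms.intro)
        show "prob_space (P l)" by (rule prob)
        show "0 < n l" by (rule elim(3))
      qed (fact X_normal z_normal indep \<beta>_vals M_nz \<sigma>_nonneg)+
      have "j < p l \<and> \<beta> l j \<noteq> 0 \<longleftrightarrow> j < p l \<and> \<beta> l j = M l" for j
        using \<beta>_vals[of j l] M_nz[of l] by auto
      then have k_eq: "S.k = k l"
        unfolding S.k_def S.signal_def by (simp only: \<beta>_card)
      have k_pos: "k l > 0" using R.k_pos elim(3) .
      have noise: "(\<sigma> l)\<^sup>2 * real (n l) \<le> \<epsilon> * (real S.k * (M l)\<^sup>2)"
      proof -
        have M2: "(M l)\<^sup>2 > 0" using M_nz by simp
        have "(\<sigma> l)\<^sup>2 \<le> \<epsilon> * c4 * (M l)\<^sup>2"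
          using elim(1) M2 by (simp add: power_divide pos_divide_less_eq)
        then have "(\<sigma> l)\<^sup>2 * real (n l) \<le> \<epsilon> * c4 * (M l)\<^sup>2 * real (n l)" by (rule mult_right_mono) simp
        also have "\<dots> = \<epsilon> * ((c4 * real (n l)) * (M l)\<^sup>2)" by simp
        also have "\<dots> \<le> \<epsilon> * (real (k l) * (M l)\<^sup>2)"
          using k_lower[of l] eps by (intro mult_left_mono mult_right_mono) auto
        finally show ?thesis unfolding k_eq .
      qed
      have "tuning (R.u l) (R.a l) (R.L l) R.C \<epsilon> (1 / R.u l ^ 3) (\<bar>M l\<bar> / S.s)
          (c2 * ln (R.u l) + R.K\<^sub>0) (n l) (p l) S.k"
        using S.signal_to_noise_bounds(1) S.signal_to_noise_bounds(2)[OF _ eps(1) _ noise] eps k_pos elim(2)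
        unfolding k_eq R.a_def by simp
      from S.log_rank_bounds[OF this] obtain B where B: "B \<in> sets (P l)"
        "measure (P l) B \<le> 20 * (exp (- R.u l) + exp (- (\<epsilon> * R.L l / 4)))"
        and logs: "\<And>\<omega> y rank. \<omega> \<in> space (P l) - B \<Longrightarrow> \<forall>i<n l. y i = S.response \<omega> i \<Longrightarrow>
          rank \<in> {forward_stepwise_rank, lasso_rank, lar_rank} \<Longrightarrow>
          (1 - 9 * \<epsilon>) * R.L l \<le> ln (real (rank (n l) (p l) (X l \<omega>) y S.signal)) \<and>
          ln (real (rank (n l) (p l) (X l \<omega>) y S.signal)) \<le> (1 + 5 * \<epsilon>) * R.L l"
        by blast
      have "(1 - 9 * \<epsilon>) * R.L l \<le> ln (real (?rank l \<omega>)) \<and> ln (real (?rank l \<omega>)) \<le> (1 + 5 * \<epsilon>) * R.L l"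
        if \<omega>: "\<omega> \<in> space (P l) - B" for \<omega>
      proof -
        have "\<forall>i<n l. y l \<omega> i = S.response \<omega> i"
          using model[of \<omega> l] \<omega> by (simp add: S.response_def S.lin_comb_def)
        from logs[OF \<omega> this rank] show ?thesis unfolding S.signal_def .
      qed
      with B show ?case by blast
    qed
  qed

  have half: "(0::real) < 1 / 2" by simp
  have rate_pos: "\<forall>\<^sub>F l in sequentially. 0 < R.rate l"
    using R.rate_asymp[OF half] R.eventually_L[OF eventually_gt_at_top[of 0]]
    by eventually_elim linarith

  have "tendsto_zero_in_prob P \<delta>"
    unfolding tendsto_zero_in_prob_def
  proof (intro allI impI)
    fix e :: real assume e: "e > 0"
    \<comment> \<open>the logarithm of the rank and the rate differ by at most \<open>10 * \<epsilon> * L\<close>, and the rate is at least \<open>(39 / 40) * L\<close>\<close>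
    define \<epsilon> where "\<epsilon> = min (1 / 40) (e / 11)"
    have eps: "0 < \<epsilon>" "\<epsilon> \<le> 1 / 40" "11 * \<epsilon> \<le> e" using e by (auto simp: \<epsilon>_def)
    define bound where "bound l = 20 * (exp (- R.u l) + exp (- (\<epsilon> * R.L l / 4)))" for l
    let ?bad = "\<lambda>l. {\<omega> \<in> space (P l). \<bar>\<delta> l \<omega>\<bar> > e}"
    \<comment> \<open>for the finitely many other problems the whole space serves as the exceptional event\<close>
    define good where "good l \<longleftrightarrow> (\<exists>B\<in>sets (P l). ?bad l \<subseteq> B \<and> measure (P l) B \<le> bound l)" for l
    have good: "\<forall>\<^sub>F l in sequentially. good l"
      using bounds[OF eps(1,2)] R.rate_asymp[OF eps(1)] R.eventually_L[OF eventually_gt_at_top[of 0]] rate_pos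
    proof eventually_elim
      case (elim l)
      then obtain B where B: "B \<in> sets (P l)" "measure (P l) B \<le> bound l"
        and logs: "\<And>\<omega>. \<omega> \<in> space (P l) - B \<Longrightarrow> (1 - 9 * \<epsilon>) * R.L l \<le> ln (real (?rank l \<omega>)) \<and>
          ln (real (?rank l \<omega>)) \<le> (1 + 5 * \<epsilon>) * R.L l"
        unfolding bound_def by blast
      have "\<bar>\<delta> l \<omega>\<bar> \<le> e" if \<omega>: "\<omega> \<in> space (P l) - B" for \<omega>
      proof -
        let ?x = "ln (real (?rank l \<omega>))" and ?L = "R.L l" and ?r = "R.rate l"
        have "?L - 9 * (\<epsilon> * ?L) \<le> ?x" "?x \<le> ?L + 5 * (\<epsilon> * ?L)"
          using logs[OF \<omega>] by (simp_all add: algebra_simps)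
        moreover have "?L - \<epsilon> * ?L \<le> ?r" "?r \<le> ?L + \<epsilon> * ?L" using elim(2) by (simp_all add: abs_le_iff)
        moreover have "0 \<le> \<epsilon> * ?L" "\<epsilon> * ?L \<le> 1 / 40 * ?L"
          using eps elim(3) by (auto intro!: mult_nonneg_nonneg mult_right_mono)
        ultimately have "\<bar>?x - ?r\<bar> \<le> 10 * (\<epsilon> * ?L)" "39 / 40 * ?L \<le> ?r" by linarith+
        moreover from this(2) have "\<epsilon> * (39 / 40 * ?L) \<le> \<epsilon> * ?r" using eps by (intro mult_left_mono) auto
        then have "39 / 40 * (\<epsilon> * ?L) \<le> \<epsilon> * ?r" by (simp only: mult.left_commute)
        ultimately have "\<bar>?x - ?r\<bar> \<le> 11 * (\<epsilon> * ?r)"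
          using \<open>0 \<le> \<epsilon> * ?L\<close> by linarith
        then have "\<bar>?x - ?r\<bar> \<le> 11 * \<epsilon> * ?r" by (simp only: mult.assoc)
        also have "\<dots> \<le> e * ?r" using eps elim(4) by (intro mult_right_mono) auto
        finally have "\<bar>?x - ?r\<bar> / ?r \<le> e" using elim(4) by (simp add: pos_divide_le_eq)
        moreover have "\<bar>\<delta> l \<omega>\<bar> = \<bar>?x - ?r\<bar> / ?r"
        proof -
          have "\<delta> l \<omega> = (?x - ?r) / ?r" using elim(4) by (simp add: \<delta>_def diff_divide_distrib)
          then show ?thesis using elim(4) by (simp add: abs_divide)
        qed
        ultimately show ?thesis by simp
      qed
      then have "?bad l \<subseteq> B" by (force simp: not_less[symmetric])
      with B show ?case unfolding good_def by blast
    qed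
    have "\<exists>B. B \<in> sets (P l) \<and> ?bad l \<subseteq> B \<and> (good l \<longrightarrow> measure (P l) B \<le> bound l)" for l
    proof (cases "good l")
      case False
      then show ?thesis by (intro exI[of _ "space (P l)"]) auto
    qed (auto simp: good_def)
    then obtain A where A: "\<And>l. A l \<in> sets (P l)" "\<And>l. ?bad l \<subseteq> A l" "\<And>l. good l \<Longrightarrow> measure (P l) (A l) \<le> bound l"
      by metis
    have "bound \<longlonglongrightarrow> 20 * (0 + 0)"
      unfolding bound_def
    proof (intro tendsto_mult tendsto_const tendsto_add)
      have "((\<lambda>x::real. exp (- x)) \<longlongrightarrow> 0) at_top" by real_asymp
      then show "(\<lambda>l. exp (- R.u l)) \<longlonglongrightarrow> 0" by (rule filterlim_compose[OF _ R.u_top])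
      have "((\<lambda>x::real. exp (- (\<epsilon> * x / 4))) \<longlongrightarrow> 0) at_top" using eps by real_asymp
      then show "(\<lambda>l. exp (- (\<epsilon> * R.L l / 4))) \<longlonglongrightarrow> 0" by (rule filterlim_compose[OF _ R.L_top])
    qed
    then have bound_zero: "bound \<longlonglongrightarrow> 0" by simp
    have "\<forall>\<^sub>F l in sequentially. measure (P l) (A l) \<le> bound l"
      using good by eventually_elim (rule A(3))
    then have "(\<lambda>l. measure (P l) (A l)) \<longlonglongrightarrow> 0"
      by (intro tendsto_sandwich[OF _ _ tendsto_const bound_zero]) (simp_all add: always_eventually)
    with A(1,2) show "\<exists>A. (\<forall>l. A l \<in> sets (P l) \<and> ?bad l \<subseteq> A l) \<and> (\<lambda>l. measure (P l) (A l)) \<longlonglongrightarrow> 0"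
      by blast
  qed
  moreover have "\<forall>\<^sub>F l in sequentially. \<forall>\<omega> \<in> space (P l). ln (real (?rank l \<omega>)) = (1 + \<delta> l \<omega>) * R.rate l"
    using rate_pos by eventually_elim (simp add: \<delta>_def)
  ultimately show "\<exists>\<delta>. tendsto_zero_in_prob P \<delta> \<and>
      (\<forall>\<^sub>F l in sequentially. \<forall>\<omega> \<in> space (P l). ln (real (?rank l \<omega>)) =
          (1 + \<delta> l \<omega>) *
          (sqrt (2 * real (n l) * ln (real (p l)) / real (k l)) - real (n l) / (2 * real (k l)) +
           ln (real (n l) / (2 * real (p l) * ln (real (p l))))))"
    unfolding R.rate_def by blast
qed

end
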